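(* Let $\Omega$ and $\Gamma^{\rm D}$ be as in the geometric setting described in the context. Then there exists a continuous mapping ${\bf E}:\dot H^{1/2}(\Gamma^{\rm D})\to\dot H^1(\Omega)$ (for the corresponding semi-norms) such that ${\rm Tr}^{\rm D}\circ{\bf E}$ is the identity of $\dot H^{1/2}(\Gamma^{\rm D})$, where ${\rm Tr}^{\rm D}:\phi\mapsto\phi_{|_{\Gamma^{\rm D}}}$ is the trace mapping on $\Gamma^{\rm D}$.
   Context: Geometry. Points of $\mathbb R^2$ are written $(x,z)$. Let $N\ge 1$. The domain $\Omega\subset\mathbb R^2$ is a curved polygon of finite depth ($\Omega\subset\mathbb R\times(-h_0,0)$ for some $h_0>0$), delimited from above and from below by two open curves $\Gamma^{(\rm top)}$ and $\Gamma^{(\rm b)}$ that do not intersect, such that: (1) there exist $-\infty\le x_0^{\rm r}<x_1^{\rm l}<x_1^{\rm r}<\dots<x_N^{\rm l}<x_N^{\rm r}<x_{N+1}^{\rm l}\le\infty$ such that $\Gamma^{(\rm top)}$ is a curved broken line with (possibly infinite) endpoints $(x_0^{\rm r},0)$ and $(x_{N+1}^{\rm l},0)$ and vertices $(x_j^{\rm l},0),(x_j^{\rm r},0)$, $1\le j\le N$; for $1\le j\le N$ the portion joining $(x_j^{\rm l},0)$ to $(x_j^{\rm r},0)$ is a smooth open curve contained in $\{z<0\}$, and all other portions of $\Gamma^{(\rm top)}$ are flat and contained in $\{z=0\}$; (2) $\Gamma^{(\rm b)}$ is the graph over $(x_0^{\rm r},x_{N+1}^{\rm l})$ of a smooth function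 $b$ with $b(x_0^{\rm r})=0$ if $x_0^{\rm r}>-\infty$ and $\limsup_{x\to-\infty}b(x)<0$ if $x_0^{\rm r}=-\infty$, and similarly at $x_{N+1}^{\rm l}$; (3) at each corner $\Omega$ forms an angle strictly larger than $0$ and strictly smaller than $\pi$. Set $\mathcal E_j=(x_{j-1}^{\rm r},x_j^{\rm l})$ for $1\le j\le N+1$ and $\Gamma^{\rm D}=\bigcup_{j=1}^{N+1}\mathcal E_j\times\{0\}$, identified with $\bigcup_j\mathcal E_j\subset\mathbb R$. Spaces. $\dot H^1(\Omega)=\{\phi\in L^1_{\rm loc}(\Omega):\nabla\phi\in L^2(\Omega)^2\}$ with semi-norm $\|\nabla\phi\|_{L^2(\Omega)}$. $\widetilde L^1_{\rm loc}(A)$ ($A=\Gamma^{\rm D}$ or an interval) is the set of restrictions to $A$ of functions of $L^1_{\rm loc}(\mathbb R)$. For a finite interval $I$, $|f|_{\dot H^{1/2}(I)}^2=\int_I\int_I\frac{|f(x)-f(y)|^2}{|x-y|^2}dx\,dy$; for a half-line $I$, $|f|_{\dot H^{1/2}(I)}^2=\int_I\int_{I\cap(x-1,x+1)}\frac{|f(y)-f(x)|^2}{|y-x|^2}dy\,dx$; $\dot H^{1/2}(I)=\{f\in\widetilde L^1_{\rm loc}(I):|f|_{\dot H^{1/2}(I)}<\infty\}$. Let $I_j=\mathcal E_j$ if $\mathcal E_j$ is bounded and otherwise let $I_j$ be a fixed non-empty bounded open subinterval of $\mathcal E_j$; for $\psi\in\widetilde L^1_{\rm loc}(\Gamma^{\rm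 D})$ put $\psi_j=\psi_{|\mathcal E_j}$ and $\overline\psi_j=\frac1{|I_j|}\int_{I_j}\psi_j$. Then $\dot H^{1/2}(\Gamma^{\rm D})=\{\psi\in\widetilde L^1_{\rm loc}(\Gamma^{\rm D}):\psi_j\in\dot H^{1/2}(\mathcal E_j),\ 1\le j\le N+1\}$ with semi-norm $|\psi|_{\dot H^{1/2}(\Gamma^{\rm D})}=\sum_{j=1}^{N+1}|\psi_j|_{\dot H^{1/2}(\mathcal E_j)}+\sum_{j=1}^N|\overline\psi_{j+1}-\overline\psi_j|$. The trace ${\rm Tr}^{\rm D}$ is well defined on $\dot H^1(\Omega)$, whose elements are locally $H^1$. *)

theory Defs
  imports "HOL-Analysis.Analysis"
begin

section \<open>Smooth maps\<close>

fun Ck_on :: "nat \<Rightarrow> 'a::real_normed_vector set \<Rightarrow> ('a \<Rightarrow> 'b::real_normed_vector) \<Rightarrow> bool" where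
  "Ck_on 0 S f \<longleftrightarrow> continuous_on S f"
| "Ck_on (Suc k) S f \<longleftrightarrow> (\<forall>x\<in>S. f differentiable at x) \<and>
     (\<forall>v. Ck_on k S (\<lambda>x. frechet_derivative f (at x) v))"

text \<open>Meant for open \<open>S\<close>, since derivatives are taken in the full space.\<close>

definition smooth_on :: "'a::real_normed_vector set \<Rightarrow> ('a \<Rightarrow> 'b::real_normed_vector) \<Rightarrow> bool" where
  "smooth_on S f \<longleftrightarrow> (\<forall>k. Ck_on k S f)"


section \<open>Geometry\<close>

text \<open>
  The open set \<open>\<Omega>\<close> forms the angle \<open>\<alpha>\<close> at \<open>p\<close>: near \<open>p\<close> it is asymptotically the sector of
  directions \<open>\<theta> < t < \<theta> + \<alpha>\<close> issued from \<open>p\<close>.  When \<open>\<Omega>\<close> is locally bounded by two arcs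
  leaving \<open>p\<close> with a tangent there, \<open>\<alpha>\<close> is the angle between these tangents, measured inside \<open>\<Omega>\<close>.
\<close>

definition forms_angle :: "(real \<times> real) set \<Rightarrow> real \<times> real \<Rightarrow> real \<Rightarrow> bool" where
  "forms_angle \<Omega> p \<alpha> \<longleftrightarrow> 0 \<le> \<alpha> \<and> \<alpha> \<le> 2 * pi \<and>
     (\<exists>\<theta>. \<forall>\<epsilon>>0. \<forall>\<^sub>F r in at_right 0. \<forall>t.
        (\<theta> + \<epsilon> \<le> t \<and> t \<le> \<theta> + \<alpha> - \<epsilon> \<longrightarrow> p + r *\<^sub>R (cos t, sin t) \<in> \<Omega>) \<and>
        (\<theta> + \<alpha> + \<epsilon> \<le> t \<and> t \<le> \<theta> + 2 * pi - \<epsilon> \<longrightarrow> p + r *\<^sub>R (cos t, sin t) \<notin> \<Omega>))"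

text \<open>
  \<open>xr j\<close> for \<open>0 \<le> j \<le> N\<close> and \<open>xl j\<close> for \<open>1 \<le> j \<le> N + 1\<close> are the abscissae of the
  vertices; only \<open>xr 0\<close> and \<open>xl (N + 1)\<close> can be infinite once the ordering is imposed.
\<close>

definition surface_part :: "(nat \<Rightarrow> ereal) \<Rightarrow> (nat \<Rightarrow> ereal) \<Rightarrow> nat \<Rightarrow> real set" where
  "surface_part xl xr j = einterval (xr (j - 1)) (xl j)"

definition Gamma_D :: "nat \<Rightarrow> (nat \<Rightarrow> ereal) \<Rightarrow> (nat \<Rightarrow> ereal) \<Rightarrow> real set" where
  "Gamma_D N xl xr = (\<Union>j\<in>{1..N+1}. surface_part xl xr j)"

definition vertices :: "nat \<Rightarrow> (nat \<Rightarrow> ereal) \<Rightarrow> (nat \<Rightarrow> ereal) \<Rightarrow> (real \<times> real) set" where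
  "vertices N xl xr = (\<Union>j\<in>{1..N}. {(real_of_ereal (xl j), 0), (real_of_ereal (xr j), 0)})"

definition finite_ends :: "nat \<Rightarrow> (nat \<Rightarrow> ereal) \<Rightarrow> (nat \<Rightarrow> ereal) \<Rightarrow> (real \<times> real) set" where
  "finite_ends N xl xr = {(x, 0) |x. ereal x = xr 0 \<or> ereal x = xl (N + 1)}"

definition Gamma_top ::
  "nat \<Rightarrow> (nat \<Rightarrow> ereal) \<Rightarrow> (nat \<Rightarrow> ereal) \<Rightarrow> (nat \<Rightarrow> real \<Rightarrow> real \<times> real) \<Rightarrow> (real \<times> real) set" where
  "Gamma_top N xl xr \<gamma> =
     Gamma_D N xl xr \<times> {0} \<union> vertices N xl xr \<union> (\<Union>j\<in>{1..N}. \<gamma> j ` {0<..<1})"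

definition Gamma_b ::
  "nat \<Rightarrow> (nat \<Rightarrow> ereal) \<Rightarrow> (nat \<Rightarrow> ereal) \<Rightarrow> (real \<Rightarrow> real) \<Rightarrow> (real \<times> real) set" where
  "Gamma_b N xl xr b = (\<lambda>x. (x, b x)) ` einterval (xr 0) (xl (N + 1))"

text \<open>
  The arc \<open>\<gamma> j\<close> parametrises the immersed part joining \<open>(xl j, 0)\<close> to \<open>(xr j, 0)\<close>; it need not
  be a graph.  That \<open>\<Omega>\<close> lies between the two curves is expressed by \<open>boundary\<close>: by
  connectedness and \<open>finite_depth\<close>, \<open>\<Omega>\<close> is the only component of the complement of the curves
  that lies in a strip below \<open>z = 0\<close> and has all of them as its frontier.
\<close>

locale curved_polygon =
  fixes N :: nat
    and xl xr :: "nat \<Rightarrow> ereal"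
    and \<gamma> :: "nat \<Rightarrow> real \<Rightarrow> real \<times> real"
    and b :: "real \<Rightarrow> real"
    and \<Omega> :: "(real \<times> real) set"
  assumes N: "N \<ge> 1"
    and order_surface: "\<And>j. j \<in> {1..N+1} \<Longrightarrow> xr (j - 1) < xl j"
    and order_object: "\<And>j. j \<in> {1..N} \<Longrightarrow> xl j < xr j"
    and arc: "\<And>j. j \<in> {1..N} \<Longrightarrow> arc (\<gamma> j)"
    and arc_start: "\<And>j. j \<in> {1..N} \<Longrightarrow> pathstart (\<gamma> j) = (real_of_ereal (xl j), 0)"
    and arc_finish: "\<And>j. j \<in> {1..N} \<Longrightarrow> pathfinish (\<gamma> j) = (real_of_ereal (xr j), 0)"
    and arc_smooth: "\<And>j. j \<in> {1..N} \<Longrightarrow> smooth_on {0<..<1} (\<gamma> j)"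
    and arc_regular: "\<And>j t. j \<in> {1..N} \<Longrightarrow> t \<in> {0<..<1} \<Longrightarrow> vector_derivative (\<gamma> j) (at t) \<noteq> 0"
    and arc_immersed: "\<And>j t. j \<in> {1..N} \<Longrightarrow> t \<in> {0<..<1} \<Longrightarrow> snd (\<gamma> j t) < 0"
    and arcs_disjoint: "disjoint_family_on (\<lambda>j. path_image (\<gamma> j)) {1..N}"
    and bottom_smooth: "smooth_on (einterval (xr 0) (xl (N + 1))) b"
    and bottom_left_finite:
      "\<And>x. xr 0 = ereal x \<Longrightarrow> b x = 0 \<and> continuous (at_right x) b"
    and bottom_left_infinite:
      "xr 0 = -\<infinity> \<Longrightarrow> Limsup at_bot (\<lambda>x. ereal (b x)) < 0"
    and bottom_right_finite:
      "\<And>x. xl (N + 1) = ereal x \<Longrightarrow> b x = 0 \<and> continuous (at_left x) b"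
    and bottom_right_infinite:
      "xl (N + 1) = \<infinity> \<Longrightarrow> Limsup at_top (\<lambda>x. ereal (b x)) < 0"
    and top_bottom_disjoint: "Gamma_top N xl xr \<gamma> \<inter> Gamma_b N xl xr b = {}"
    and domain: "open \<Omega>" "connected \<Omega>"
    and boundary: "frontier \<Omega> = Gamma_top N xl xr \<gamma> \<union> Gamma_b N xl xr b \<union> finite_ends N xl xr"
    and finite_depth: "\<exists>h\<^sub>0>0. \<Omega> \<subseteq> UNIV \<times> {-h\<^sub>0<..<0}"
    and corners: "\<And>p. p \<in> vertices N xl xr \<union> finite_ends N xl xr \<Longrightarrow>
      \<exists>\<alpha>. forms_angle \<Omega> p \<alpha> \<and> 0 < \<alpha> \<and> \<alpha> < pi"


section \<open>Function spaces\<close>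

text \<open>
  Functions on a set are represented by total functions whose values off the set are
  irrelevant, and elements of the spaces below by representatives of their classes
  modulo equality almost everywhere.
\<close>

definition locally_integrable_on :: "('a::euclidean_space \<Rightarrow> 'b::euclidean_space) \<Rightarrow> 'a set \<Rightarrow> bool" where
  "locally_integrable_on f S \<longleftrightarrow> (\<forall>K. compact K \<and> K \<subseteq> S \<longrightarrow> f absolutely_integrable_on K)"

definition square_integrable_on :: "('a::euclidean_space \<Rightarrow> 'b::euclidean_space) \<Rightarrow> 'a set \<Rightarrow> bool" where
  "square_integrable_on f S \<longleftrightarrow>
     set_borel_measurable lebesgue S f \<and> (\<lambda>x. (norm (f x))\<^sup>2) absolutely_integrable_on S"

definition test_function :: "'a::euclidean_space set \<Rightarrow> ('a \<Rightarrow> real) \<Rightarrow> bool" where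
  "test_function S \<eta> \<longleftrightarrow> smooth_on UNIV \<eta> \<and>
     compact (closure {x. \<eta> x \<noteq> 0}) \<and> closure {x. \<eta> x \<noteq> 0} \<subseteq> S"

definition has_weak_gradient ::
  "('a::euclidean_space \<Rightarrow> real) \<Rightarrow> ('a \<Rightarrow> 'a) \<Rightarrow> 'a set \<Rightarrow> bool" where
  "has_weak_gradient \<phi> g S \<longleftrightarrow> locally_integrable_on g S \<and>
     (\<forall>\<eta>. test_function S \<eta> \<longrightarrow> (\<forall>v\<in>Basis.
        (LINT x:S|lebesgue. \<phi> x * frechet_derivative \<eta> (at x) v) =
        - (LINT x:S|lebesgue. (g x \<bullet> v) * \<eta> x)))"

definition weak_gradient :: "'a::euclidean_space set \<Rightarrow> ('a \<Rightarrow> real) \<Rightarrow> 'a \<Rightarrow> 'a" where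
  "weak_gradient S \<phi> = (SOME g. has_weak_gradient \<phi> g S)"

definition H1dot :: "'a::euclidean_space set \<Rightarrow> ('a \<Rightarrow> real) set" where
  "H1dot S = {\<phi>. locally_integrable_on \<phi> S \<and>
     (\<exists>g. has_weak_gradient \<phi> g S \<and> square_integrable_on g S)}"

definition H1dot_seminorm :: "'a::euclidean_space set \<Rightarrow> ('a \<Rightarrow> real) \<Rightarrow> real" where
  "H1dot_seminorm S \<phi> = sqrt (LINT x:S|lebesgue. (norm (weak_gradient S \<phi> x))\<^sup>2)"

definition L1loc_tilde :: "real set \<Rightarrow> (real \<Rightarrow> real) set" where
  "L1loc_tilde A = {f. \<exists>g. locally_integrable_on g UNIV \<and> (\<forall>x\<in>A. f x = g x)}"

text \<open>For an open interval \<open>J\<close> which is bounded or a half-line.\<close>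

definition Hhalf_sq :: "real set \<Rightarrow> (real \<Rightarrow> real) \<Rightarrow> ennreal" where
  "Hhalf_sq J f =
     (if bounded J
      then (\<integral>\<^sup>+y\<in>J. (\<integral>\<^sup>+x\<in>J. ennreal (\<bar>f x - f y\<bar>\<^sup>2 / \<bar>x - y\<bar>\<^sup>2) \<partial>lebesgue) \<partial>lebesgue)
      else (\<integral>\<^sup>+x\<in>J. (\<integral>\<^sup>+y\<in>J \<inter> {x-1<..<x+1}. ennreal (\<bar>f y - f x\<bar>\<^sup>2 / \<bar>y - x\<bar>\<^sup>2) \<partial>lebesgue) \<partial>lebesgue))"

definition Hhalf_seminorm :: "real set \<Rightarrow> (real \<Rightarrow> real) \<Rightarrow> real" where
  "Hhalf_seminorm J f = sqrt (enn2real (Hhalf_sq J f))"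

definition Hhalf :: "real set \<Rightarrow> (real \<Rightarrow> real) set" where
  "Hhalf J = {f \<in> L1loc_tilde J. Hhalf_sq J f < \<infinity>}"

definition average :: "real set \<Rightarrow> (real \<Rightarrow> real) \<Rightarrow> real" where
  "average J f = (LINT x:J|lebesgue. f x) / measure lebesgue J"

definition averaging_intervals ::
  "nat \<Rightarrow> (nat \<Rightarrow> ereal) \<Rightarrow> (nat \<Rightarrow> ereal) \<Rightarrow> (nat \<Rightarrow> real set) \<Rightarrow> bool" where
  "averaging_intervals N xl xr I \<longleftrightarrow> (\<forall>j\<in>{1..N+1}.
     if bounded (surface_part xl xr j) then I j = surface_part xl xr j
     else (\<exists>u v. u < v \<and> I j = {u<..<v} \<and> I j \<subseteq> surface_part xl xr j))"

definition Hhalf_D :: "nat \<Rightarrow> (nat \<Rightarrow> ereal) \<Rightarrow> (nat \<Rightarrow> ereal) \<Rightarrow> (real \<Rightarrow> real) set" where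
  "Hhalf_D N xl xr =
     {\<psi> \<in> L1loc_tilde (Gamma_D N xl xr). \<forall>j\<in>{1..N+1}. \<psi> \<in> Hhalf (surface_part xl xr j)}"

definition Hhalf_D_seminorm ::
  "nat \<Rightarrow> (nat \<Rightarrow> ereal) \<Rightarrow> (nat \<Rightarrow> ereal) \<Rightarrow> (nat \<Rightarrow> real set) \<Rightarrow> (real \<Rightarrow> real) \<Rightarrow> real" where
  "Hhalf_D_seminorm N xl xr I \<psi> =
     (\<Sum>j=1..N+1. Hhalf_seminorm (surface_part xl xr j) \<psi>) +
     (\<Sum>j=1..N. \<bar>average (I (j + 1)) \<psi> - average (I j) \<psi>\<bar>)"


section \<open>Trace on the flat part of the boundary and continuity\<close>

text \<open>
  \<open>\<tau>\<close> is the trace of \<open>\<phi>\<close> on \<open>A \<times> {0}\<close>, where \<open>A\<close> is open and \<open>\<Omega>\<close> lies locally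
  below \<open>A \<times> {0}\<close>.  This is the usual extension by continuity of the restriction map:
  on small rectangles \<open>R\<close> below \<open>A\<close>, \<open>\<phi>\<close> is the limit in \<open>H\<^sup>1(R)\<close> of functions which are
  continuous up to the boundary, and whose restrictions tend to \<open>\<tau>\<close> in \<open>L\<^sup>2\<close>.
  The trace inequality on \<open>R\<close> makes \<open>\<tau>\<close> unique up to null sets.
\<close>

definition has_trace ::
  "(real \<times> real) set \<Rightarrow> real set \<Rightarrow> (real \<times> real \<Rightarrow> real) \<Rightarrow> (real \<Rightarrow> real) \<Rightarrow> bool" where
  "has_trace \<Omega> A \<phi> \<tau> \<longleftrightarrow>
     (\<forall>c d. c < d \<and> {c..d} \<subseteq> A \<longrightarrow>
        (\<exists>\<delta>>0. let R = {c<..<d} \<times> {-\<delta><..<0} in R \<subseteq> \<Omega> \<and>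
          (\<exists>u :: nat \<Rightarrow> real \<times> real \<Rightarrow> real.
             (\<forall>n. continuous_on (closure R) (u n) \<and> u n \<in> H1dot R) \<and>
             (\<lambda>n. \<integral>\<^sup>+p\<in>R. ennreal ((u n p - \<phi> p)\<^sup>2) \<partial>lebesgue) \<longlonglongrightarrow> 0 \<and>
             (\<lambda>n. H1dot_seminorm R (\<lambda>p. u n p - \<phi> p)) \<longlonglongrightarrow> 0 \<and>
             (\<lambda>n. \<integral>\<^sup>+x\<in>{c<..<d}. ennreal ((u n (x, 0) - \<tau> x)\<^sup>2) \<partial>lebesgue) \<longlonglongrightarrow> 0)))"

text \<open>
  Continuity of a not necessarily linear map from the space \<open>V\<close> with semi-norm \<open>p\<close> to the
  space \<open>W\<close> with semi-norm \<open>q\<close>.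
\<close>

definition seminorm_continuous ::
  "('a \<Rightarrow> real) set \<Rightarrow> (('a \<Rightarrow> real) \<Rightarrow> real) \<Rightarrow> ('b \<Rightarrow> real) set \<Rightarrow> (('b \<Rightarrow> real) \<Rightarrow> real) \<Rightarrow>
   (('a \<Rightarrow> real) \<Rightarrow> ('b \<Rightarrow> real)) \<Rightarrow> bool" where
  "seminorm_continuous V p W q F \<longleftrightarrow> F \<in> V \<rightarrow> W \<and>
     (\<forall>f\<in>V. \<forall>\<epsilon>>0. \<exists>\<delta>>0. \<forall>g\<in>V.
        p (\<lambda>x. g x - f x) < \<delta> \<longrightarrow> q (\<lambda>y. F g y - F f y) < \<epsilon>)"

end

theory Submission
  imports Defs
begin

text \<open>
  The extension is made in two steps: from the free surface to the whole line, and from the line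
  to the strip that contains the domain.  The geometry of \<open>\<Omega>\<close> enters only through two facts:
  \<open>\<Omega>\<close> lies in a strip \<open>-h < z < 0\<close>, and it contains a thin rectangle below every compact
  interval of the free surface (\<open>rectangle_below_surface\<close>).  The second fact holds because the
  other pieces of the boundary keep a positive distance from such an interval.

  From the line to the strip.  Write \<open>U x s\<close> for the mean of \<open>f (x + t + r)\<close> over
  \<open>0 \<le> t, r \<le> s\<close>; the value at depth \<open>z\<close> is \<open>U x (\<kappa> \<bar>z\<bar>)\<close>.  A second primitive of a locally
  integrable function is continuously differentiable, so \<open>U\<close> is a classical \<open>C\<^sup>1\<close> function in the
  open half-plane and its weak gradient is its gradient.  Both partial derivatives are means
  of increments \<open>f y - f y'\<close> divided by \<open>s\<close>, hence, by the Cauchy-Schwarz inequality and an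
  integration in \<open>s\<close>, their square integral is bounded by the Gagliardo energy of \<open>f\<close>
  restricted to \<open>\<bar>x - y\<bar> < w\<close> (\<open>lift_energy\<close>), where \<open>\<kappa> = w / h\<close> ties the range of the means to
  the depth of the strip.  For the same reason \<open>U x s - f x\<close> has mean square \<open>O(s)\<close>
  (\<open>square_mean2_diff_le\<close>), and this gives the trace: the translates \<open>(x, z) \<mapsto> U x (\<kappa> \<bar>z - \<epsilon>\<bar>)\<close>
  are continuous up to the surface and their gradients converge since they converge
  pointwise and their norms converge (\<open>has_trace_lift\<close>).

  From the free surface to the line.  A gap \<open>(p, q)\<close> between two intervals is filled with
  \<open>(1 - \<theta>) L + \<theta> R\<close>, where \<open>\<theta>\<close> grows linearly from 0 to 1 and \<open>L\<close>, \<open>R\<close> are the reflections of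
  the left and right data at \<open>p\<close> and \<open>q\<close>, contracted so that they only see the adjacent
  intervals.  The fold that defines \<open>L\<close> does not increase distances, so it preserves
  finite energy; the cross term is controlled by the mean square of \<open>L - R\<close> over the gap, hence, by
  a Poincare inequality for the truncated energy (\<open>poincare_average\<close>), by the energies on both
  sides and the difference of the averages (\<open>fill_gap_bounded\<close>).  This is where the differences
  of averages in the semi-norm come from.  Filling the gaps one after the other, and gluing a constant to
  each finite end, gives a function on the line (\<open>extend_to_line\<close>).

  The semi-norm on \<open>\<Omega>\<close> is that of an arbitrarily chosen weak gradient, so the argument also
  needs that weak gradients are unique (\<open>weak_gradient_unique\<close>), for which enough test
  functions are built from \<open>exp (- 1 / x)\<close>.  Up to the choice of Borel representatives all the
  operators are linear, so continuity follows from the bound on the difference of two functions.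
\<close>

section \<open>Smooth bump functions\<close>

text \<open>
  A class of differentiable functions that contains the directional derivatives of its members
  consists of smooth functions; this avoids computing derivatives of every order.
\<close>
lemma Ck_on_closed_class:
  assumes "\<And>f x. f \<in> F \<Longrightarrow> f differentiable at x"
    and "\<And>f v. f \<in> F \<Longrightarrow> (\<lambda>x. frechet_derivative f (at x) v) \<in> F"
    and "f \<in> F"
  shows "Ck_on k UNIV f"
  using assms(3)
proof (induction k arbitrary: f)
  case 0
  then show ?case
    using assms(1) by (simp add: continuous_on_eq_continuous_within differentiable_imp_continuous_within)
next
  case (Suc k)
  then show ?case using assms by simp
qed

lemma Ck_on_Suc_imp: "Ck_on (Suc k) S f \<Longrightarrow> Ck_on k S f"
proof (induction k arbitrary: f)
  case 0
  then show ?case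
    by (auto simp: continuous_on_eq_continuous_within intro!: differentiable_imp_continuous_within
        intro: differentiable_at_withinI)
next
  case (Suc k)
  have "Ck_on k S (\<lambda>x. frechet_derivative f (at x) v)" for v
    using Suc by (metis Ck_on.simps(2))
  then show ?case using Suc.prems by simp
qed

lemma Ck_on_add:
  fixes f g :: "'a::real_normed_vector \<Rightarrow> real"
  assumes "Ck_on k UNIV f" "Ck_on k UNIV g"
  shows "Ck_on k UNIV (\<lambda>x. f x + g x)"
  using assms
proof (induction k arbitrary: f g)
  case 0
  then show ?case by (auto intro: continuous_on_add)
next
  case (Suc k)
  have D: "((\<lambda>x. f x + g x) has_derivative
      (\<lambda>v. frechet_derivative f (at x) v + frechet_derivative g (at x) v)) (at x)" for x
    using Suc.prems by (auto intro!: has_derivative_add simp: frechet_derivative_works[symmetric])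
  have eq: "frechet_derivative (\<lambda>x. f x + g x) (at x) v =
      frechet_derivative f (at x) v + frechet_derivative g (at x) v" for x v
    using frechet_derivative_at[OF D[of x]] by metis
  show ?case
    using Suc by (simp add: eq)
qed

lemma Ck_on_mult:
  fixes f g :: "'a::real_normed_vector \<Rightarrow> real"
  assumes "Ck_on k UNIV f" "Ck_on k UNIV g"
  shows "Ck_on k UNIV (\<lambda>x. f x * g x)"
  using assms
proof (induction k arbitrary: f g)
  case 0
  then show ?case by (auto intro: continuous_on_mult)
next
  case (Suc k)
  have D: "((\<lambda>x. f x * g x) has_derivative
      (\<lambda>v. f x * frechet_derivative g (at x) v + frechet_derivative f (at x) v * g x)) (at x)" for x
    using Suc.prems by (auto intro!: has_derivative_mult simp: frechet_derivative_works[symmetric])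
  have "Ck_on k UNIV f" "Ck_on k UNIV g"
    using Suc.prems by (auto intro: Ck_on_Suc_imp)
  moreover have eq: "frechet_derivative (\<lambda>x. f x * g x) (at x) v =
      f x * frechet_derivative g (at x) v + frechet_derivative f (at x) v * g x" for x v
    using frechet_derivative_at[OF D[of x]] by metis
  ultimately show ?case
    using Suc by (simp add: eq Ck_on_add)
qed

lemma Ck_on_const: "Ck_on k UNIV (\<lambda>x. c)"
  by (rule Ck_on_closed_class[of "range (\<lambda>c x. c)"]) auto

text \<open>Makes functions of one variable into functions of several: the coordinates are inner products.\<close>
lemma Ck_on_compose_inner:
  fixes f :: "real \<Rightarrow> real" and w :: "'a::euclidean_space"
  assumes "Ck_on k UNIV f"
  shows "Ck_on k UNIV (\<lambda>p. f (w \<bullet> p + c))"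
  using assms
proof (induction k arbitrary: f)
  case 0
  then show ?case
    by (auto intro!: continuous_on_compose2[of UNIV f] continuous_intros)
next
  case (Suc k)
  have fd: "(f has_derivative frechet_derivative f (at y)) (at y)" for y
    using Suc.prems by (simp add: frechet_derivative_works[symmetric])
  have D: "((\<lambda>p. f (w \<bullet> p + c)) has_derivative
      (\<lambda>v. frechet_derivative f (at (w \<bullet> x + c)) (w \<bullet> v))) (at x)" for x
    by (rule has_derivative_compose[OF _ fd]) (auto intro!: derivative_eq_intros)
  have eq: "frechet_derivative (\<lambda>p. f (w \<bullet> p + c)) (at x) v =
      (w \<bullet> v) * frechet_derivative f (at (w \<bullet> x + c)) 1" for x v
    using frechet_derivative_at[OF D[of x]] linear_cmul[OF has_derivative_linear[OF fd], of _ "w \<bullet> v" 1]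
    by (metis mult.right_neutral real_scaleR_def)
  have "(\<lambda>p. f (w \<bullet> p + c)) differentiable at x" for x
    using D[of x] by (rule differentiableI)
  then show ?case
    using Suc.prems Suc.IH[of "\<lambda>x. frechet_derivative f (at x) 1"]
    by (simp add: eq Ck_on_mult Ck_on_const)
qed

text \<open>
  The derivatives of \<open>exp (- 1 / x)\<close>, extended by 0, all have this form, which
  makes the family closed under differentiation.
\<close>
definition exp_recip :: "real poly \<Rightarrow> real \<Rightarrow> real" where
  "exp_recip p x = (if x > 0 then poly p (1 / x) * exp (- (1 / x)) else 0)"

lemma exp_recip_tendsto_0: "(exp_recip p \<longlongrightarrow> 0) (at_right 0)"
proof -
  have "((\<lambda>t. poly p t * exp (- t)) \<longlongrightarrow> (\<Sum>i\<le>degree p. coeff p i * 0)) at_top"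
    unfolding poly_altdef sum_distrib_right mult.assoc exp_minus
    by (intro tendsto_sum tendsto_mult tendsto_const)
      (simp add: tendsto_power_div_exp_0 flip: divide_inverse)
  then have "((\<lambda>x. poly p (inverse x) * exp (- inverse x)) \<longlongrightarrow> 0) (at_right 0)"
    using filterlim_compose[OF _ filterlim_inverse_at_top_right] by force
  then show ?thesis
    by (rule Lim_transform_eventually)
      (auto simp: exp_recip_def divide_inverse eventually_at_right_less intro: eventually_at_rightI[of 0 1])
qed

text \<open>
  At 0 the difference quotient is the member of the family with \<open>p\<close> multiplied by
  the variable, so it tends to 0.
\<close>
lemma exp_recip_has_derivative:
  "(exp_recip p has_real_derivative exp_recip (monom 1 2 * (p - pderiv p)) x) (at x)"
proof -
  consider "x > 0" | "x < 0" | "x = 0" by linarith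
  then show ?thesis
  proof cases
    case 1
    have "((\<lambda>x. poly p (1 / x) * exp (- (1 / x))) has_real_derivative
        exp_recip (monom 1 2 * (p - pderiv p)) x) (at x)"
      using 1 by (auto intro!: derivative_eq_intros DERIV_chain2[OF poly_DERIV]
          simp: exp_recip_def poly_monom field_simps power2_eq_square)
    then show ?thesis
      by (rule has_field_derivative_transform_within_open[of _ _ _ "{0<..}"])
        (use 1 in \<open>auto simp: exp_recip_def\<close>)
  next
    case 2
    have "((\<lambda>x. 0) has_real_derivative exp_recip (monom 1 2 * (p - pderiv p)) x) (at x)"
      using 2 by (simp add: exp_recip_def)
    then show ?thesis
      by (rule has_field_derivative_transform_within_open[of _ _ _ "{..<0}"])
        (use 2 in \<open>auto simp: exp_recip_def\<close>)
  next
    case 3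
    have "((\<lambda>h. exp_recip p h / h) \<longlongrightarrow> 0) (at_right 0)"
      using exp_recip_tendsto_0[of "monom 1 1 * p"]
      by (rule Lim_transform_eventually)
        (auto simp: exp_recip_def poly_monom intro: eventually_at_rightI[of 0 1])
    moreover have "((\<lambda>h. exp_recip p h / h) \<longlongrightarrow> 0) (at_left 0)"
      by (rule Lim_transform_eventually[OF tendsto_const])
        (auto simp: exp_recip_def intro: eventually_at_leftI[of "-1" 0])
    ultimately have "((\<lambda>h. exp_recip p h / h) \<longlongrightarrow> 0) (at 0)"
      by (simp add: filterlim_at_split)
    then show ?thesis
      using 3 by (simp add: DERIV_def exp_recip_def)
  qed
qed

lemma Ck_on_exp_recip: "Ck_on k UNIV (exp_recip p)"
proof (rule Ck_on_closed_class[of "range exp_recip"])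
  fix f :: "real \<Rightarrow> real" and x v assume "f \<in> range exp_recip"
  then obtain p where p: "f = exp_recip p" by auto
  have D: "(exp_recip p has_derivative (*) (exp_recip (monom 1 2 * (p - pderiv p)) x)) (at x)" for x
    using exp_recip_has_derivative[of p x] by (simp add: has_field_derivative_def)
  show "f differentiable at x"
    using D p by (auto simp: differentiable_def)
  have "(\<lambda>x. frechet_derivative f (at x) v) = exp_recip (smult v (monom 1 2 * (p - pderiv p)))"
    using D by (auto simp: p frechet_derivative_at[OF D, symmetric] exp_recip_def fun_eq_iff)
  then show "(\<lambda>x. frechet_derivative f (at x) v) \<in> range exp_recip" by auto
qed auto

text \<open>
  The factor \<open>n\<close> steepens the bump: at a point inside \<open>(c, d)\<close> both
  exponents tend to 0, so the bumps tend to the indicator of the interval.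
\<close>
definition bump :: "nat \<Rightarrow> real \<Rightarrow> real \<Rightarrow> real \<Rightarrow> real" where
  "bump n c d x = exp_recip 1 (real n * (x - c)) * exp_recip 1 (real n * (d - x))"

lemma bump_bounds: "0 \<le> bump n c d x" "bump n c d x \<le> 1"
  by (auto simp: bump_def exp_recip_def intro!: mult_le_one)

lemma bump_eq_0: "x \<notin> {c<..<d} \<Longrightarrow> bump n c d x = 0"
  by (auto simp: bump_def exp_recip_def zero_less_mult_iff)

lemma bump_tendsto: "(\<lambda>n. bump n c d x) \<longlonglongrightarrow> indicator {c<..<d} x"
proof (cases "x \<in> {c<..<d}")
  case True
  have *: "(\<lambda>n. exp_recip 1 (real n * t)) \<longlonglongrightarrow> 1" if "t > 0" for t
  proof -
    have "(\<lambda>n. exp (- (inverse t * inverse (real n)))) \<longlonglongrightarrow> exp (- (inverse t * 0))"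
      by (intro tendsto_intros lim_inverse_n)
    then have "(\<lambda>n. exp (- (inverse t * inverse (real n)))) \<longlonglongrightarrow> 1" by simp
    then show ?thesis
      by (rule Lim_transform_eventually)
        (use that in \<open>auto simp: exp_recip_def divide_inverse mult.commute
          intro!: eventually_sequentiallyI[of 1]\<close>)
  qed
  show ?thesis
    using tendsto_mult[OF *[of "x - c"] *[of "d - x"]] True by (simp add: bump_def)
next
  case False
  then show ?thesis by (simp add: bump_eq_0)
qed

definition box_bump :: "nat \<Rightarrow> real \<times> real \<Rightarrow> real \<times> real \<Rightarrow> real \<times> real \<Rightarrow> real" where
  "box_bump n a b p = bump n (fst a) (fst b) (fst p) * bump n (snd a) (snd b) (snd p)"

lemma smooth_box_bump: "smooth_on UNIV (box_bump n a b)"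
proof -
  have *: "Ck_on k UNIV (\<lambda>p::real\<times>real. exp_recip 1 (real n * (fst p - c)))"
          "Ck_on k UNIV (\<lambda>p::real\<times>real. exp_recip 1 (real n * (c - fst p)))"
          "Ck_on k UNIV (\<lambda>p::real\<times>real. exp_recip 1 (real n * (snd p - c)))"
          "Ck_on k UNIV (\<lambda>p::real\<times>real. exp_recip 1 (real n * (c - snd p)))" for k c
    using Ck_on_compose_inner[OF Ck_on_exp_recip, of k 1 "(real n, 0)" "- real n * c"]
      Ck_on_compose_inner[OF Ck_on_exp_recip, of k 1 "(- real n, 0)" "real n * c"]
      Ck_on_compose_inner[OF Ck_on_exp_recip, of k 1 "(0, real n)" "- real n * c"]
      Ck_on_compose_inner[OF Ck_on_exp_recip, of k 1 "(0, - real n)" "real n * c"]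
    by (simp_all add: inner_prod_def algebra_simps)
  show ?thesis
    unfolding smooth_on_def box_bump_def bump_def by (intro allI Ck_on_mult *)
qed

lemma closure_support_box_bump: "closure {p. box_bump n a b p \<noteq> 0} \<subseteq> cbox a b"
proof (rule closure_minimal)
  show "{p. box_bump n a b p \<noteq> 0} \<subseteq> cbox a b"
  proof
    fix p assume "p \<in> {p. box_bump n a b p \<noteq> 0}"
    then have "fst p \<in> {fst a<..<fst b}" "snd p \<in> {snd a<..<snd b}"
      using bump_eq_0 by (auto simp: box_bump_def simp del: greaterThanLessThan_iff)
    then show "p \<in> cbox a b"
      by (auto simp: cbox_def Basis_prod_def inner_prod_def)
  qed
qed auto

lemma test_function_box_bump:
  assumes "cbox a b \<subseteq> S"
  shows "test_function S (box_bump n a b)"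
  unfolding test_function_def
proof (intro conjI smooth_box_bump)
  show "compact (closure {p. box_bump n a b p \<noteq> 0})"
    using bounded_subset[OF bounded_cbox closure_support_box_bump] compact_eq_bounded_closed by blast
qed (use closure_support_box_bump[of n a b] assms in blast)

section \<open>Uniqueness of weak gradients\<close>

text \<open>
  The sets over which the integral of \<open>h\<close> vanishes form a Dynkin system; boxes
  generate the Borel sets, so \<open>{h > 0}\<close> and \<open>{h < 0}\<close> belong to it.
\<close>
lemma integral_boxes_zero_imp_AE_zero:
  fixes h :: "'a::euclidean_space \<Rightarrow> real"
  assumes int: "integrable lborel h"
    and zero: "\<And>a b. (LINT x:box a b|lborel. h x) = 0"
    and total: "(LINT x|lborel. h x) = 0"
  shows "AE x in lborel. h x = 0"
proof -
  have A0: "(LINT x:A|lborel. h x) = 0" if "A \<in> sets borel" for A :: "'a set"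
  proof -
    have si: "set_integrable lborel B h" if "B \<in> sets borel" for B
      using int that integrable_mult_indicator[of B lborel h] by (simp add: set_integrable_def)
    have sg: "A \<in> sigma_sets UNIV (range (\<lambda>(a, b). box a b :: 'a set))"
      using that by (simp add: borel_eq_box)
    have st: "Int_stable (range (\<lambda>(a, b). box a b :: 'a set))"
      by (auto simp: Int_stable_def box_Int_box)
    have pw: "range (\<lambda>(a, b). box a b :: 'a set) \<subseteq> Pow UNIV" by simp
    show ?thesis
      using sg
    proof (induction A rule: sigma_sets_induct_disjoint[OF st pw, consumes 1, case_names basic empty compl union])
      case (basic A)
      then show ?case using zero by auto
    next
      case empty
      then show ?case by (simp add: set_lebesgue_integral_def)
    next
      case (compl A)
      have A: "A \<in> sets borel"
        using compl(1) by (simp add: borel_eq_box)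
      have "(LINT x:UNIV|lborel. h x) = (LINT x:A \<union> (UNIV - A)|lborel. h x)" by simp
      also have "\<dots> = (LINT x:A|lborel. h x) + (LINT x:UNIV - A|lborel. h x)"
        by (rule set_integral_Un) (use A si in auto)
      finally show ?case using compl(2) total by (simp add: set_lebesgue_integral_def)
    next
      case (union A)
      have A: "A i \<in> sets borel" for i
        using union(2) by (auto simp: borel_eq_box)
      have "(LINT x:(\<Union>i. A i)|lborel. h x) = (\<Sum>i. (LINT x:(A i)|lborel. h x))"
        by (rule lebesgue_integral_countable_add)
          (use A si union(1) in \<open>auto simp: disjoint_family_on_def\<close>)
      then show ?case using union(3) by simp
    qed
  qed
  have [measurable]: "h \<in> borel_measurable borel"
    using borel_measurable_integrable[OF int] by simp
  have *: "AE x in lborel. k x \<le> 0" if k: "k = h \<or> k = (\<lambda>x. - h x)" for k :: "'a \<Rightarrow> real"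
  proof -
    have [measurable]: "k \<in> borel_measurable borel" using k by auto
    let ?A = "{x. k x > 0}"
    have "(LINT x:?A|lborel. k x) = 0"
      using k A0[of ?A] by (auto simp: set_lebesgue_integral_def)
    then have "(LINT x|lborel. indicator ?A x * k x) = 0"
      by (simp add: set_lebesgue_integral_def)
    moreover have "integrable lborel (\<lambda>x. indicator ?A x * k x)"
      using int k by (intro integrable_mult_indicator[where 'b=real, simplified]) auto
    ultimately have "AE x in lborel. indicator ?A x * k x = 0"
      by (subst integral_nonneg_eq_0_iff_AE[symmetric]) (auto simp: indicator_def)
    then show ?thesis by eventually_elim (auto simp: indicator_def split: if_splits)
  qed
  show ?thesis
    using *[of h] *[of "\<lambda>x. - h x"] by auto
qed

text \<open>
  The fundamental lemma of the calculus of variations.  The bumps of a box tend to its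
  indicator, so the integral of \<open>g\<close> over every box with closure in \<open>S\<close>
  vanishes, and \<open>S\<close> is a countable union of boxes.
\<close>
lemma AE_zero_if_test_integrals_zero:
  fixes g :: "real \<times> real \<Rightarrow> real"
  assumes S: "open S" and g: "locally_integrable_on g S"
    and zero: "\<And>\<eta>. test_function S \<eta> \<Longrightarrow> (LINT x:S|lebesgue. g x * \<eta> x) = 0"
  shows "AE x in lebesgue. x \<in> S \<longrightarrow> g x = 0"
proof -
  have box0: "(LINT x:box a b|lebesgue. g x) = 0" if ab: "cbox a b \<subseteq> S" for a b
  proof -
    have int: "set_integrable lebesgue (cbox a b) g"
      using g ab by (auto simp: locally_integrable_on_def)
    then have m: "(\<lambda>x. indicator (cbox a b) x * g x) \<in> borel_measurable lebesgue"
      by (simp add: set_integrable_def)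
    have "(\<lambda>n. LINT x|lebesgue. (indicator (cbox a b) x * g x) * box_bump n a b x)
        \<longlonglongrightarrow> (LINT x|lebesgue. indicator (box a b) x * g x)"
    proof (rule integral_dominated_convergence)
      show "integrable lebesgue (\<lambda>x. \<bar>indicator (cbox a b) x * g x\<bar>)"
        using int by (auto simp: set_integrable_def intro: integrable_abs)
      have "box_bump n a b \<in> borel_measurable lebesgue" for n
        using smooth_box_bump[of n a b] Ck_on.simps(1)[of UNIV "box_bump n a b"]
          borel_measurable_continuous_onI[of "box_bump n a b"]
        unfolding smooth_on_def by (intro measurable_completion) simp
      then show "(\<lambda>x. (indicator (cbox a b) x * g x) * box_bump n a b x) \<in> borel_measurable lebesgue" for n
        using m by (rule borel_measurable_times[rotated])
      have "box a b \<in> sets lebesgue" by simp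
      moreover have "(\<lambda>x. indicator (box a b) x * g x) = (\<lambda>x. indicator (box a b) x * (indicator (cbox a b) x * g x))"
        using box_subset_cbox[of a b] by (auto simp: indicator_def fun_eq_iff)
      ultimately show "(\<lambda>x. indicator (box a b) x * g x) \<in> borel_measurable lebesgue"
        using borel_measurable_times[OF borel_measurable_indicator m] by simp
      have "0 \<le> box_bump n a b x" "box_bump n a b x \<le> 1" for n x
        using bump_bounds by (auto simp: box_bump_def intro!: mult_le_one)
      then have "\<bar>box_bump n a b x\<bar> \<le> 1" for n x by simp
      then have "norm (indicator (cbox a b) x * g x * box_bump n a b x)
          \<le> \<bar>indicator (cbox a b) x * g x\<bar>" for n x
        unfolding real_norm_def abs_mult[of _ "box_bump n a b x"] by (rule mult_left_le) simp
      then show "AE x in lebesgue. norm (indicator (cbox a b) x * g x * box_bump n a b x)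
          \<le> \<bar>indicator (cbox a b) x * g x\<bar>" for n
        by simp
      have "(\<lambda>n. (indicator (cbox a b) x * g x) * box_bump n a b x) \<longlonglongrightarrow>
          indicator (cbox a b) x * g x * (indicator {fst a<..<fst b} (fst x) * indicator {snd a<..<snd b} (snd x))" for x
        unfolding box_bump_def by (intro tendsto_intros bump_tendsto)
      moreover have "indicator (cbox a b) x * g x * (indicator {fst a<..<fst b} (fst x) * indicator {snd a<..<snd b} (snd x))
          = indicator (box a b) x * g x" for x
      proof -
        have "x \<in> box a b \<longleftrightarrow> fst x \<in> {fst a<..<fst b} \<and> snd x \<in> {snd a<..<snd b}"
          by (auto simp: box_def Basis_prod_def inner_prod_def)
        then show ?thesis
          using box_subset_cbox[of a b] by (cases "x \<in> box a b") (auto simp: indicator_def)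
      qed
      ultimately show "AE x in lebesgue. (\<lambda>n. indicator (cbox a b) x * g x * box_bump n a b x)
          \<longlonglongrightarrow> indicator (box a b) x * g x"
        by (intro AE_I2) metis
    qed
    moreover have "(LINT x|lebesgue. (indicator (cbox a b) x * g x) * box_bump n a b x) = 0" for n
    proof -
      have "(LINT x|lebesgue. (indicator (cbox a b) x * g x) * box_bump n a b x)
          = (LINT x:S|lebesgue. g x * box_bump n a b x)"
        unfolding set_lebesgue_integral_def
      proof (rule Bochner_Integration.integral_cong[OF refl])
        fix x
        have "box_bump n a b x = 0" if "x \<notin> cbox a b"
          using closure_support_box_bump[of n a b] closure_subset[of "{p. box_bump n a b p \<noteq> 0}"] that by auto
        then show "indicator (cbox a b) x * g x * box_bump n a b x
            = indicator S x *\<^sub>R (g x * box_bump n a b x)"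
          using ab by (cases "x \<in> cbox a b") (auto simp del: indicator_simps simp: indicator_def)
      qed
      then show ?thesis
        using zero[OF test_function_box_bump[OF ab]] by simp
    qed
    ultimately have "(LINT x|lebesgue. indicator (box a b) x * g x) = 0"
      by (simp add: LIMSEQ_const_iff)
    then show ?thesis by (simp add: set_lebesgue_integral_def)
  qed
  have loc: "AE x in lebesgue. x \<in> box a b \<longrightarrow> g x = 0" if ab: "cbox a b \<subseteq> S" for a b
  proof -
    have "set_integrable lebesgue (box a b) g"
      using g ab set_integrable_subset[of lebesgue "cbox a b" g "box a b"] box_subset_cbox[of a b]
      by (auto simp: locally_integrable_on_def)
    then have int: "integrable lebesgue (\<lambda>x. indicator (box a b) x * g x)"
      by (simp add: set_integrable_def)
    obtain h where h: "h \<in> borel_measurable lborel" "AE x in lborel. indicator (box a b) x * g x = h x"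
      using completion_ex_borel_measurable_real[OF borel_measurable_integrable[OF int]] by auto
    have h': "AE x in lebesgue. indicator (box a b) x * g x = h x"
      using h(2) by (rule AE_completion)
    have hm: "h \<in> borel_measurable lebesgue" using h(1) by (rule measurable_completion)
    have hi: "integrable lebesgue h"
      using int integrable_cong_AE[OF borel_measurable_integrable[OF int] hm h'] by blast
    then have hb: "integrable lborel h"
      using h(1) by (simp add: integrable_completion)
    have "(LINT x:box c d|lborel. h x) = 0" for c d
    proof -
      obtain e f where ef: "box a b \<inter> box c d = box e f" "cbox e f \<subseteq> cbox a b"
      proof (cases "box a b \<inter> box c d = {}")
        case True
        have "box (a::real\<times>real) a = {}" "cbox (b + (1,1)) b = {}" "box (b + (1,1)) b = {}"
          by (auto simp: box_eq_empty Basis_prod_def inner_prod_def)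
        then show ?thesis using True that[of "b + (1,1)" b] by auto
      next
        case False
        obtain e f where ef: "box a b \<inter> box c d = box e f"
          using box_Int_box[of a b c d] by blast
        have "closure (box e f) \<subseteq> closure (box a b)"
          by (rule closure_mono) (use ef in blast)
        moreover have "box e f \<noteq> {}" "box a b \<noteq> {}" using False ef by auto
        ultimately have "cbox e f \<subseteq> cbox a b" by (simp add: closure_box)
        then show ?thesis using that ef by blast
      qed
      have "(LINT x:box c d|lborel. h x) = (LINT x:box c d|lebesgue. h x)"
        using h(1) by (simp add: set_lebesgue_integral_def integral_completion)
      also have "\<dots> = (LINT x:box e f|lebesgue. g x)"
        unfolding set_lebesgue_integral_def
      proof (rule integral_cong_AE)
        show "AE x in lebesgue. indicator (box c d) x *\<^sub>R h x = indicator (box e f) x *\<^sub>R g x"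
          using h' by eventually_elim (auto simp: indicator_def ef(1)[symmetric])
        show "(\<lambda>x. indicator (box c d) x *\<^sub>R h x) \<in> borel_measurable lebesgue"
          using hm by (intro borel_measurable_scaleR borel_measurable_indicator) auto
        have "set_integrable lebesgue (box e f) g"
          using g ab ef(2) set_integrable_subset[of lebesgue "cbox a b" g "box e f"]
            order_trans[OF box_subset_cbox ef(2)]
          by (auto simp: locally_integrable_on_def)
        then show "(\<lambda>x. indicator (box e f) x *\<^sub>R g x) \<in> borel_measurable lebesgue"
          by (simp add: set_integrable_def)
      qed
      also have "\<dots> = 0" using box0 ef ab by blast
      finally show ?thesis .
    qed
    moreover have "(LINT x|lborel. h x) = 0"
    proof -
      have "(LINT x|lborel. h x) = (LINT x|lebesgue. h x)"
        using h(1) by (simp add: integral_completion)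
      also have "\<dots> = (LINT x|lebesgue. indicator (box a b) x * g x)"
        using h' hm int by (intro integral_cong_AE) auto
      also have "\<dots> = 0"
        using box0[OF ab] by (simp add: set_lebesgue_integral_def)
      finally show ?thesis .
    qed
    ultimately have "AE x in lborel. h x = 0"
      using hb by (intro integral_boxes_zero_imp_AE_zero)
    then have "AE x in lebesgue. h x = 0" by (rule AE_completion)
    with h' show ?thesis by eventually_elim (auto simp: indicator_def)
  qed
  obtain D where D: "countable D" "D \<subseteq> Pow S" "\<And>X. X \<in> D \<Longrightarrow> \<exists>a b. X = cbox a b" "\<Union>D = S"
    using open_countable_Union_open_cbox[OF S] by metis
  have "AE x in lebesgue. \<forall>X\<in>D. x \<in> X \<longrightarrow> g x = 0"
  proof (subst AE_ball_countable[OF D(1)], intro ballI)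
    fix X assume "X \<in> D"
    then obtain a b where X: "X = cbox a b" "cbox a b \<subseteq> S" using D by blast
    have "AE x in lebesgue. x \<notin> cbox a b - box a b"
      using negligible_frontier_interval[of a b] by (intro AE_not_in) (simp add: negligible_iff_null_sets)
    with loc[OF X(2)] show "AE x in lebesgue. x \<in> X \<longrightarrow> g x = 0"
      unfolding X by eventually_elim auto
  qed
  then show ?thesis
    by eventually_elim (use D(4) in blast)
qed

section \<open>Continuously differentiable functions in the homogeneous Sobolev space\<close>

text \<open>
  By Fubini, integrate along horizontal lines first: the inner integral is the difference of two
  boundary values, which vanish.
\<close>
lemma integral_partial_derivative_fst_zero:
  fixes w W :: "real \<times> real \<Rightarrow> real"
  assumes D: "\<And>x y. ((\<lambda>x. w (x, y)) has_real_derivative W (x, y)) (at x)"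
    and W: "continuous_on UNIV W"
    and M: "\<And>p. p \<notin> box (-M, -M) (M, M) \<Longrightarrow> w p = 0" and "M > 0"
  shows "integral (cbox (-M, -M) (M, M)) W = 0"
proof -
  have "integral (cbox (-M, -M) (M, M)) W = integral (cbox (-M) M) (\<lambda>y. integral (cbox (-M) M) (\<lambda>x. W (x, y)))"
    by (subst integral_prod_continuous)
      (use W integral_swap_continuous[of "-M" "-M" M M "\<lambda>x y. W (x, y)"] in
        \<open>auto intro: continuous_on_subset\<close>)
  also have "\<dots> = integral (cbox (-M) M) (\<lambda>y. 0)"
  proof (rule Henstock_Kurzweil_Integration.integral_cong)
    fix y
    have "((\<lambda>x. W (x, y)) has_integral (w (M, y) - w (-M, y))) {-M..M}"
      using D \<open>M > 0\<close> by (intro fundamental_theorem_of_calculus)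
        (auto simp: has_real_derivative_iff_has_vector_derivative[symmetric] intro: has_field_derivative_at_within)
    moreover have "w (M, y) = 0" "w (-M, y) = 0"
      by (auto intro!: M simp: box_def Basis_prod_def inner_prod_def)
    ultimately show "integral (cbox (-M) M) (\<lambda>x. W (x, y)) = 0"
      by (simp add: integral_unique)
  qed
  finally show ?thesis by simp
qed

lemma integral_partial_derivative_snd_zero:
  fixes w W :: "real \<times> real \<Rightarrow> real"
  assumes D: "\<And>x y. ((\<lambda>y. w (x, y)) has_real_derivative W (x, y)) (at y)"
    and W: "continuous_on UNIV W"
    and M: "\<And>p. p \<notin> box (-M, -M) (M, M) \<Longrightarrow> w p = 0" and "M > 0"
  shows "integral (cbox (-M, -M) (M, M)) W = 0"
proof -
  have "integral (cbox (-M, -M) (M, M)) W = integral (cbox (-M) M) (\<lambda>x. integral (cbox (-M) M) (\<lambda>y. W (x, y)))"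
    by (rule integral_prod_continuous) (use W in \<open>auto intro: continuous_on_subset\<close>)
  also have "\<dots> = integral (cbox (-M) M) (\<lambda>y. 0)"
  proof (rule Henstock_Kurzweil_Integration.integral_cong)
    fix x
    have "((\<lambda>y. W (x, y)) has_integral (w (x, M) - w (x, -M))) {-M..M}"
      using D \<open>M > 0\<close> by (intro fundamental_theorem_of_calculus)
        (auto simp: has_real_derivative_iff_has_vector_derivative[symmetric] intro: has_field_derivative_at_within)
    moreover have "w (x, M) = 0" "w (x, -M) = 0"
      by (auto intro!: M simp: box_def Basis_prod_def inner_prod_def)
    ultimately show "integral (cbox (-M) M) (\<lambda>y. W (x, y)) = 0"
      by (simp add: integral_unique)
  qed
  finally show ?thesis by simp
qed

text \<open>
  A classical derivative represented by its gradient; the point is that the gradient is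
  continuous, so that classical calculus applies.
\<close>
definition C1_gradient :: "(real \<times> real) set \<Rightarrow> (real \<times> real \<Rightarrow> real) \<Rightarrow> (real \<times> real \<Rightarrow> real \<times> real) \<Rightarrow> bool" where
  "C1_gradient S \<phi> G \<longleftrightarrow>
     (\<forall>p\<in>S. (\<phi> has_derivative (\<lambda>v. G p \<bullet> v)) (at p)) \<and> continuous_on S G"

lemma C1_gradient_subset: "C1_gradient S \<phi> G \<Longrightarrow> T \<subseteq> S \<Longrightarrow> C1_gradient T \<phi> G"
  by (auto simp: C1_gradient_def intro: continuous_on_subset)

lemma C1_gradient_diff:
  "C1_gradient S \<phi> G \<Longrightarrow> C1_gradient S \<phi>' G' \<Longrightarrow> C1_gradient S (\<lambda>p. \<phi> p - \<phi>' p) (\<lambda>p. G p - G' p)"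
  by (auto simp: C1_gradient_def inner_diff_left intro!: has_derivative_diff continuous_on_diff)

lemma C1_gradient_continuous: "C1_gradient S \<phi> G \<Longrightarrow> continuous_on S \<phi>"
  unfolding C1_gradient_def
  by (metis continuous_at_imp_continuous_on has_derivative_continuous)

lemma continuous_imp_locally_integrable:
  "continuous_on S (f :: 'a::euclidean_space \<Rightarrow> 'b::euclidean_space) \<Longrightarrow> locally_integrable_on f S"
  unfolding locally_integrable_on_def
proof (intro allI impI)
  fix K assume "continuous_on S f" "compact K \<and> K \<subseteq> S"
  then show "f absolutely_integrable_on K"
    using borel_integrable_compact[of K f] continuous_on_subset[of S f K]
      integrable_completion[of "\<lambda>x. indicat_real K x *\<^sub>R f x" lborel] borel_measurable_integrable
    unfolding set_integrable_def by blast
qed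

text \<open>All that the integration by parts uses of a test function.\<close>
lemma test_function_C1:
  assumes "test_function S (\<eta> :: 'a::euclidean_space \<Rightarrow> real)"
  shows "(\<eta> has_derivative frechet_derivative \<eta> (at p)) (at p)"
    and "continuous_on UNIV (\<lambda>x. frechet_derivative \<eta> (at x) v)"
    and "continuous_on UNIV \<eta>"
    and "p \<notin> closure {x. \<eta> x \<noteq> 0} \<Longrightarrow> frechet_derivative \<eta> (at p) v = 0"
proof -
  have 1: "Ck_on (Suc 0) UNIV \<eta>" "Ck_on 0 UNIV \<eta>"
    using assms by (simp_all add: test_function_def smooth_on_def del: Ck_on.simps)
  show "(\<eta> has_derivative frechet_derivative \<eta> (at p)) (at p)"
    using 1 by (simp add: frechet_derivative_works[symmetric])
  show "continuous_on UNIV (\<lambda>x. frechet_derivative \<eta> (at x) v)"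
    using 1 by simp
  show "continuous_on UNIV \<eta>" using 1 by simp
  assume "p \<notin> closure {x. \<eta> x \<noteq> 0}"
  then have "(\<eta> has_derivative (\<lambda>v. 0)) (at p)"
    by (intro has_derivative_transform_within_open[OF has_derivative_const[of 0], of "- closure {x. \<eta> x \<noteq> 0}"])
      (use closure_subset[of "{x. \<eta> x \<noteq> 0}"] in auto)
  then show "frechet_derivative \<eta> (at p) v = 0"
    using frechet_derivative_at[of \<eta> "\<lambda>v. 0" p] by (simp add: fun_eq_iff)
qed

text \<open>
  The product \<open>\<phi> \<eta>\<close>, extended by 0, is continuously differentiable with
  compact support in the plane, so its partial derivatives integrate to 0.
\<close>
lemma C1_gradient_imp_weak_gradient:
  assumes S: "open S" and C1: "C1_gradient S \<phi> G"
  shows "has_weak_gradient \<phi> G S"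
  unfolding has_weak_gradient_def
proof (intro conjI allI impI ballI)
  show "locally_integrable_on G S"
    using C1 by (intro continuous_imp_locally_integrable) (simp add: C1_gradient_def)
  fix \<eta> and v :: "real \<times> real" assume \<eta>: "test_function S \<eta>" and v: "v \<in> Basis"
  define K where "K = closure {x. \<eta> x \<noteq> 0}"
  let ?D = "\<lambda>x. frechet_derivative \<eta> (at x) v"
  note T = test_function_C1[OF \<eta>, folded K_def]
  have K: "compact K" "K \<subseteq> S" using \<eta> by (auto simp: test_function_def K_def)
  have \<eta>0: "\<eta> p = 0" if "p \<notin> K" for p
    using that closure_subset[of "{x. \<eta> x \<noteq> 0}"] unfolding K_def by auto
  have "closed K" by (simp add: K_def)
  define w where "w = (\<lambda>p. if p \<in> S then \<phi> p * \<eta> p else 0)"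
  define W1 where "W1 = (\<lambda>p. if p \<in> S then \<phi> p * ?D p else 0)"
  define W2 where "W2 = (\<lambda>p. if p \<in> S then (G p \<bullet> v) * \<eta> p else 0)"
  have glue: "continuous_on UNIV (\<lambda>p. if p \<in> S then k p else 0)"
    if "continuous_on S k" "\<And>p. p \<notin> K \<Longrightarrow> k p = 0" for k :: "real \<times> real \<Rightarrow> real"
  proof -
    have "continuous_on (S \<union> - K) (\<lambda>p. if p \<in> S then k p else 0)"
    proof (rule continuous_on_open_Un)
      show "continuous_on S (\<lambda>p. if p \<in> S then k p else 0)"
        using that(1) by (rule continuous_on_eq) auto
      show "continuous_on (- K) (\<lambda>p. if p \<in> S then k p else 0)"
        by (rule continuous_on_eq[of _ "\<lambda>_. 0"]) (use that(2) in auto)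
    qed (use S \<open>closed K\<close> in auto)
    moreover have "S \<union> - K = UNIV" using K by auto
    ultimately show ?thesis by simp
  qed
  have cW1: "continuous_on UNIV W1"
    unfolding W1_def
  proof (rule glue)
    show "continuous_on S (\<lambda>p. \<phi> p * ?D p)"
      by (intro continuous_on_mult C1_gradient_continuous[OF C1] continuous_on_subset[OF T(2)]) simp
  qed (metis T(4) mult_zero_right)
  have cW2: "continuous_on UNIV W2"
    unfolding W2_def
  proof (rule glue)
    show "continuous_on S (\<lambda>p. (G p \<bullet> v) * \<eta> p)"
    proof (rule continuous_on_mult)
      show "continuous_on S (\<lambda>p. G p \<bullet> v)"
        using C1 by (intro continuous_on_inner continuous_on_const) (simp add: C1_gradient_def)
      show "continuous_on S \<eta>"
        using T(3) by (rule continuous_on_subset) simp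
    qed
  qed (metis \<eta>0 mult_zero_right)
  have cW: "continuous_on UNIV (\<lambda>p. W1 p + W2 p)"
    using cW1 cW2 by (rule continuous_on_add)
  have Dw: "(w has_derivative (\<lambda>u. \<phi> p * frechet_derivative \<eta> (at p) u + (G p \<bullet> u) * \<eta> p)) (at p)" if "p \<in> S" for p
  proof (rule has_derivative_transform_within_open[OF _ S that])
    show "((\<lambda>p. \<phi> p * \<eta> p) has_derivative (\<lambda>u. \<phi> p * frechet_derivative \<eta> (at p) u + (G p \<bullet> u) * \<eta> p)) (at p)"
      using C1 that T(1) by (intro has_derivative_mult) (auto simp: C1_gradient_def)
  qed (simp add: w_def)
  have Dw0: "(w has_derivative (\<lambda>u. 0)) (at p)" if "p \<notin> K" for p
    by (rule has_derivative_transform_within_open[OF has_derivative_const[of 0], of "- K"])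
      (use that \<open>closed K\<close> \<eta>0 in \<open>auto simp: w_def\<close>)
  \<comment> \<open>\<open>W1 + W2\<close> is the directional derivative of the product along \<open>v\<close>.\<close>
  have dir: "((\<lambda>t. w (p + t *\<^sub>R v)) has_real_derivative (W1 p + W2 p)) (at 0)" for p
  proof -
    have "(w has_derivative (\<lambda>u. if p \<in> S then \<phi> p * frechet_derivative \<eta> (at p) u + (G p \<bullet> u) * \<eta> p else 0)) (at p)"
      using Dw[of p] Dw0[of p] K by (cases "p \<in> S") (auto dest: subsetD)
    then have "(w has_derivative (\<lambda>u. if p \<in> S then \<phi> p * frechet_derivative \<eta> (at p) u + (G p \<bullet> u) * \<eta> p else 0)) (at (p + 0 *\<^sub>R v))"
      by simp
    moreover have "((\<lambda>t. p + t *\<^sub>R v) has_derivative (\<lambda>t. t *\<^sub>R v)) (at 0)"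
      by (auto intro!: derivative_eq_intros)
    ultimately have "((\<lambda>t. w (p + t *\<^sub>R v)) has_derivative (\<lambda>t. if p \<in> S then \<phi> p * frechet_derivative \<eta> (at p) (t *\<^sub>R v) + (G p \<bullet> (t *\<^sub>R v)) * \<eta> p else 0)) (at 0)"
      by (rule has_derivative_compose[rotated])
    moreover have "frechet_derivative \<eta> (at p) (t *\<^sub>R v) = t * ?D p" for t
      using linear_cmul[OF has_derivative_linear[OF T(1)]] by simp
    ultimately show ?thesis
      unfolding has_field_derivative_def W1_def W2_def
      by (auto elim!: has_derivative_eq_rhs simp: fun_eq_iff algebra_simps)
  qed
  obtain M where M: "M > 0" "K \<subseteq> box (-M,-M) (M,M)"
  proof -
    obtain B where B: "B > 0" "\<And>p. p \<in> K \<Longrightarrow> norm p < B"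
      using compact_imp_bounded[OF K(1)] unfolding bounded_pos_less by metis
    have "p \<in> box (-B,-B) (B,B)" if "p \<in> K" for p
    proof -
      have "\<bar>fst p\<bar> < B" "\<bar>snd p\<bar> < B"
        using B(2)[OF that] norm_fst_le[of "fst p" "snd p"] norm_snd_le[of "snd p" "fst p"] by simp_all
      then show ?thesis by (auto simp: box_def Basis_prod_def inner_prod_def)
    qed
    then show ?thesis using that[of B] B by blast
  qed
  let ?Q = "cbox (-M,-M) (M,M)"
  have w0: "w p = 0" "W1 p = 0" "W2 p = 0" if "p \<notin> box (-M,-M) (M,M)" for p
  proof -
    have "p \<notin> K" using that M by blast
    then show "w p = 0" "W1 p = 0" "W2 p = 0"
      using \<eta>0 T(4) by (auto simp: w_def W1_def W2_def)
  qed
  have "integral ?Q (\<lambda>p. W1 p + W2 p) = 0"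
  proof -
    from v consider "v = (1, 0)" | "v = (0, 1)"
      by (auto simp: Basis_prod_def)
    then show ?thesis
    proof cases
      case 1
      show ?thesis
      proof (rule integral_partial_derivative_fst_zero[of w])
        fix x y
        have "((\<lambda>t. w (t, y)) has_real_derivative (W1 (x,y) + W2 (x,y))) (at (0 + x))"
          using dir[of "(x,y)"] unfolding 1 DERIV_at_within_shift by (subst DERIV_shift) (simp add: 1 add.commute)
        then show "((\<lambda>t. w (t, y)) has_real_derivative (W1 (x,y) + W2 (x,y))) (at x)" by simp
      qed (use M(1) w0(1) cW in \<open>auto\<close>)
    next
      case 2
      show ?thesis
      proof (rule integral_partial_derivative_snd_zero[of w])
        fix x y
        have "((\<lambda>t. w (x, t)) has_real_derivative (W1 (x,y) + W2 (x,y))) (at (0 + y))"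
          using dir[of "(x,y)"] unfolding 2 by (subst DERIV_shift) (simp add: 2 add.commute)
        then show "((\<lambda>t. w (x, t)) has_real_derivative (W1 (x,y) + W2 (x,y))) (at y)" by simp
      qed (use M(1) w0(1) cW in \<open>auto\<close>)
    qed
  qed
  moreover have si: "set_integrable lebesgue ?Q W1" "set_integrable lebesgue ?Q W2"
    using continuous_imp_locally_integrable[OF cW1] continuous_imp_locally_integrable[OF cW2]
    by (simp_all add: locally_integrable_on_def)
  then have "integral ?Q W1 = (LINT x:?Q|lebesgue. W1 x)" "integral ?Q W2 = (LINT x:?Q|lebesgue. W2 x)"
    by (simp_all add: set_lebesgue_integral_eq_integral)
  moreover have "integral ?Q (\<lambda>p. W1 p + W2 p) = integral ?Q W1 + integral ?Q W2"
    using si by (intro Henstock_Kurzweil_Integration.integral_add) (simp_all add: absolutely_integrable_on_def)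
  moreover have "(LINT x:?Q|lebesgue. W1 x) = (LINT x:S|lebesgue. \<phi> x * ?D x)"
    "(LINT x:?Q|lebesgue. W2 x) = (LINT x:S|lebesgue. (G x \<bullet> v) * \<eta> x)"
  proof -
    have q: "p \<notin> ?Q \<Longrightarrow> W1 p = 0 \<and> W2 p = 0" for p
      using w0 box_subset_cbox by blast
    have iQ: "indicat_real ?Q p * W1 p = W1 p" "indicat_real ?Q p * W2 p = W2 p" for p
      by (cases "p \<in> ?Q"; use q[of p] in simp)+
    show "(LINT x:?Q|lebesgue. W1 x) = (LINT x:S|lebesgue. \<phi> x * ?D x)"
      unfolding set_lebesgue_integral_def
      by (rule Bochner_Integration.integral_cong[OF refl]) (simp add: iQ, simp add: W1_def indicator_def)
    show "(LINT x:?Q|lebesgue. W2 x) = (LINT x:S|lebesgue. (G x \<bullet> v) * \<eta> x)"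
      unfolding set_lebesgue_integral_def
      by (rule Bochner_Integration.integral_cong[OF refl]) (simp add: iQ, simp add: W2_def indicator_def)
  qed
  ultimately show "(LINT x:S|lebesgue. \<phi> x * ?D x) = - (LINT x:S|lebesgue. (G x \<bullet> v) * \<eta> x)"
    by simp
qed

lemma integrable_test_function_mult:
  assumes g: "locally_integrable_on g S" and \<eta>: "test_function S \<eta>"
  shows "set_integrable lebesgue S (\<lambda>x. (g x \<bullet> v) * \<eta> x)"
proof -
  define K where "K = closure {x. \<eta> x \<noteq> 0}"
  have K: "compact K" "K \<subseteq> S" using \<eta> by (auto simp: test_function_def K_def)
  have \<eta>0: "\<eta> p = 0" if "p \<notin> K" for p
    using that closure_subset[of "{x. \<eta> x \<noteq> 0}"] unfolding K_def by auto
  have "compact (\<eta> ` K)"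
    using test_function_C1(3)[OF \<eta>] K by (intro compact_continuous_image) (auto intro: continuous_on_subset)
  then have "bounded (\<eta> ` K)" by (rule compact_imp_bounded)
  moreover have "(\<lambda>x. g x \<bullet> v) absolutely_integrable_on K"
    using g K absolutely_integrable_linear[OF _ bounded_linear_inner_left[of v], where f=g]
    by (auto simp: o_def locally_integrable_on_def)
  ultimately have "(\<lambda>x. \<eta> x * (g x \<bullet> v)) absolutely_integrable_on K"
    using K by (intro absolutely_integrable_bounded_measurable_product[OF bilinear_times]
        continuous_imp_measurable_on_sets_lebesgue continuous_on_subset[OF test_function_C1(3)[OF \<eta>]])
      (auto intro!: fmeasurableD lmeasurable_compact)
  moreover have "indicat_real K x *\<^sub>R (\<eta> x * (g x \<bullet> v)) = indicat_real S x *\<^sub>R ((g x \<bullet> v) * \<eta> x)" for x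
    using \<eta>0[of x] K by (auto simp: indicator_def)
  ultimately show ?thesis
    unfolding set_integrable_def by (simp only:)
qed

text \<open>
  Two weak gradients have the same integrals against all test functions; apply the fundamental
  lemma to the coordinates of their difference.
\<close>
lemma weak_gradient_unique:
  assumes S: "open S" and "has_weak_gradient \<phi> g S" "has_weak_gradient \<phi> g' S"
  shows "AE x in lebesgue. x \<in> S \<longrightarrow> g x = (g' x :: real \<times> real)"
proof -
  have "AE x in lebesgue. x \<in> S \<longrightarrow> (g x - g' x) \<bullet> v = 0" if v: "v \<in> Basis" for v
  proof (rule AE_zero_if_test_integrals_zero[OF S])
    have l: "locally_integrable_on g S" "locally_integrable_on g' S"
      using assms by (auto simp: has_weak_gradient_def)
    show "locally_integrable_on (\<lambda>x. (g x - g' x) \<bullet> v) S"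
      unfolding locally_integrable_on_def
    proof (intro allI impI)
      fix K assume "compact K \<and> K \<subseteq> S"
      then have "(\<lambda>x. g x - g' x) absolutely_integrable_on K"
        using l by (intro set_integral_diff) (auto simp: locally_integrable_on_def)
      then show "(\<lambda>x. (g x - g' x) \<bullet> v) absolutely_integrable_on K"
        using absolutely_integrable_linear[OF _ bounded_linear_inner_left[of v]] by (auto simp: o_def)
    qed
    fix \<eta> assume \<eta>: "test_function S \<eta>"
    have "(LINT x:S|lebesgue. (g x - g' x) \<bullet> v * \<eta> x)
        = (LINT x:S|lebesgue. (g x \<bullet> v) * \<eta> x) - (LINT x:S|lebesgue. (g' x \<bullet> v) * \<eta> x)"
      by (subst set_integral_diff(2)[symmetric])
        (use integrable_test_function_mult[OF _ \<eta>] l in \<open>auto simp: inner_diff_left left_diff_distrib\<close>)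
    also have "\<dots> = 0"
      using assms \<eta> v by (fastforce simp: has_weak_gradient_def)
    finally show "(LINT x:S|lebesgue. (g x - g' x) \<bullet> v * \<eta> x) = 0" .
  qed
  then have "AE x in lebesgue. \<forall>v\<in>Basis. x \<in> S \<longrightarrow> (g x - g' x) \<bullet> v = 0"
    by (intro AE_finite_allI) auto
  then show ?thesis
  proof eventually_elim
    case (elim x)
    show ?case
    proof
      assume "x \<in> S"
      then show "g x = g' x"
        using elim by (intro euclidean_eqI[of "g x" "g' x"]) (simp add: inner_diff_left)
    qed
  qed
qed

text \<open>
  Since weak gradients are unique almost everywhere, the one chosen by
  \<open>weak_gradient\<close> has the norm of the classical gradient.
\<close>
lemma C1_gradient_imp_H1dot:
  assumes S: "open S" and C1: "C1_gradient S \<phi> G"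
    and fin: "(\<integral>\<^sup>+p\<in>S. ennreal ((norm (G p))\<^sup>2) \<partial>lborel) < \<infinity>"
  shows "\<phi> \<in> H1dot S"
    and "ennreal ((H1dot_seminorm S \<phi>)\<^sup>2) = (\<integral>\<^sup>+p\<in>S. ennreal ((norm (G p))\<^sup>2) \<partial>lborel)"
proof -
  have wg: "has_weak_gradient \<phi> G S"
    using S C1 by (rule C1_gradient_imp_weak_gradient)
  have c: "continuous_on S G" using C1 by (simp add: C1_gradient_def)
  have [measurable]: "S \<in> sets borel" using S by simp
  have mG: "(\<lambda>p. indicator S p *\<^sub>R G p) \<in> borel_measurable borel"
    using c by (intro borel_measurable_continuous_on_indicator) simp
  have mN: "(\<lambda>p. indicator S p *\<^sub>R (norm (G p))\<^sup>2) \<in> borel_measurable borel"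
    using c by (intro borel_measurable_continuous_on_indicator continuous_intros) simp_all
  have nn: "(\<integral>\<^sup>+p\<in>S. ennreal ((norm (G p))\<^sup>2) \<partial>lborel) = (\<integral>\<^sup>+p. ennreal (indicator S p *\<^sub>R (norm (G p))\<^sup>2) \<partial>lborel)"
    by (intro nn_integral_cong) (simp add: indicator_def)
  have intN: "integrable lborel (\<lambda>p. indicator S p *\<^sub>R (norm (G p))\<^sup>2)"
    using mN fin unfolding nn by (intro integrableI_nonneg) simp_all
  then have intN': "set_integrable lebesgue S (\<lambda>p. (norm (G p))\<^sup>2)"
    unfolding set_integrable_def using mN by (simp add: integrable_completion)
  have sq: "square_integrable_on G S"
    unfolding square_integrable_on_def set_borel_measurable_def
    using intN' measurable_completion[of _ lborel borel, simplified, OF mG] by simp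
  show "\<phi> \<in> H1dot S"
    unfolding H1dot_def
    using wg sq continuous_imp_locally_integrable[OF C1_gradient_continuous[OF C1]] by auto
  have "has_weak_gradient \<phi> (weak_gradient S \<phi>) S"
    unfolding weak_gradient_def using someI[of "\<lambda>g. has_weak_gradient \<phi> g S", OF wg] .
  then have ae: "AE x in lebesgue. x \<in> S \<longrightarrow> G x = weak_gradient S \<phi> x"
    by (rule weak_gradient_unique[OF S wg])
  let ?l = "\<lambda>p. indicator S p *\<^sub>R (norm (weak_gradient S \<phi> p))\<^sup>2"
  let ?r = "\<lambda>p. indicator S p *\<^sub>R (norm (G p))\<^sup>2"
  have ae': "AE p in lebesgue. ?r p = ?l p"
    using ae by eventually_elim (auto simp: indicator_def)
  have r: "?r \<in> borel_measurable lebesgue"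
    using intN' by (auto simp: set_integrable_def)
  have "?l \<in> borel_measurable lebesgue"
    using r ae' by (rule borel_measurable_AE)
  then have "(LINT p:S|lebesgue. (norm (weak_gradient S \<phi> p))\<^sup>2) = (LINT p:S|lebesgue. (norm (G p))\<^sup>2)"
    unfolding set_lebesgue_integral_def using ae' r by (intro integral_cong_AE) auto
  also have "\<dots> = (LINT p|lborel. ?r p)"
    unfolding set_lebesgue_integral_def using mN by (simp add: integral_completion)
  finally have *: "(LINT p:S|lebesgue. (norm (weak_gradient S \<phi> p))\<^sup>2) = (LINT p|lborel. ?r p)" .
  moreover have "(LINT p|lborel. ?r p) \<ge> 0"
    by (intro Bochner_Integration.integral_nonneg) auto
  moreover have "ennreal (LINT p|lborel. ?r p) = (\<integral>\<^sup>+p\<in>S. ennreal ((norm (G p))\<^sup>2) \<partial>lborel)"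
    unfolding nn using intN by (subst nn_integral_eq_integral) auto
  ultimately show "ennreal ((H1dot_seminorm S \<phi>)\<^sup>2) = (\<integral>\<^sup>+p\<in>S. ennreal ((norm (G p))\<^sup>2) \<partial>lborel)"
    by (simp add: H1dot_seminorm_def)
qed

section \<open>Extending a function on the line to the half-plane by double means\<close>

text \<open>
  Borel instead of Lebesgue measurability: double integrals of Borel functions are measurable in
  each variable, so the theorem of Tonelli applies to them.
\<close>
definition loc_int :: "(real \<Rightarrow> real) \<Rightarrow> bool" where
  "loc_int f \<longleftrightarrow> f \<in> borel_measurable borel \<and> (\<forall>a b. f absolutely_integrable_on {a..b})"

text \<open>
  One of the two integrals is over an empty interval or a point; their difference is the
  oriented integral from 0 to \<open>x\<close>.
\<close>
definition primitive :: "(real \<Rightarrow> real) \<Rightarrow> real \<Rightarrow> real" where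
  "primitive f x = integral {0..x} f - integral {x..0} f"

lemma loc_int_measurable[measurable_dest]: "loc_int f \<Longrightarrow> f \<in> borel_measurable borel"
  by (simp add: loc_int_def)

lemma loc_int_integrable: "loc_int f \<Longrightarrow> f integrable_on {a..b}"
  by (simp add: loc_int_def absolutely_integrable_on_def)

lemma continuous_imp_loc_int: "continuous_on UNIV f \<Longrightarrow> loc_int f"
  unfolding loc_int_def
  by (auto intro: borel_measurable_continuous_onI absolutely_integrable_continuous_real continuous_on_subset)

lemma primitive_diff:
  assumes f: "loc_int f" and "y \<le> x"
  shows "primitive f x - primitive f y = integral {y..x} f"
proof -
  have e: "integral {x..y} f = 0" if "y \<le> x" for x y
    using that by (cases "x = y") auto
  have c: "integral {a..b} f + integral {b..c} f = integral {a..c} f" if "a \<le> b" "b \<le> c" for a b c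
    using that by (intro Henstock_Kurzweil_Integration.integral_combine loc_int_integrable f)
  consider "0 \<le> y" | "y \<le> 0" "0 \<le> x" | "x \<le> 0" using \<open>y \<le> x\<close> by linarith
  then show ?thesis
    by cases (use e[of 0 x] e[of 0 y] e[of x 0] e[of y 0] c[of 0 y x] c[of y 0 x] c[of y x 0] \<open>y \<le> x\<close>
        in \<open>auto simp: primitive_def\<close>)
qed

lemma continuous_primitive:
  assumes f: "loc_int f"
  shows "continuous_on UNIV (primitive f)"
proof (rule continuous_at_imp_continuous_on, rule ballI)
  fix x :: real
  let ?a = "x - 1"
  have "continuous_on {?a..x+1} (\<lambda>y. integral {?a..y} f)"
    using f by (intro indefinite_integral_continuous_1 loc_int_integrable)
  then have "continuous_on {?a<..<x+1} (\<lambda>y. integral {?a..y} f + primitive f ?a)"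
    by (intro continuous_intros) (auto intro: continuous_on_subset)
  then have "continuous_on {?a<..<x+1} (primitive f)"
  proof (rule continuous_on_eq)
    fix y assume "y \<in> {?a<..<x+1}"
    then show "integral {?a..y} f + primitive f ?a = primitive f y"
      using primitive_diff[OF f, of ?a y] by simp
  qed
  then show "continuous (at x) (primitive f)"
    by (simp add: continuous_on_eq_continuous_at)
qed

lemma DERIV_primitive:
  assumes g: "continuous_on UNIV g"
  shows "(primitive g has_real_derivative g x) (at x)"
proof -
  let ?a = "x - 1"
  have "((\<lambda>y. integral {?a..y} g) has_real_derivative g x) (at x within {?a..x+1})"
    using g by (intro integral_has_real_derivative) (auto intro: continuous_on_subset)
  then have "((\<lambda>y. integral {?a..y} g) has_real_derivative g x) (at x)"
    by (subst (asm) at_within_interior) auto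
  then have "((\<lambda>y. integral {?a..y} g + primitive g ?a) has_real_derivative g x) (at x)"
    by (auto intro!: derivative_eq_intros)
  then show ?thesis
  proof (rule has_field_derivative_transform_within_open[of _ _ _ "{?a<..<x+1}"])
    fix y assume "y \<in> {?a<..<x+1}"
    then show "integral {?a..y} g + primitive g ?a = primitive g y"
      using primitive_diff[OF continuous_imp_loc_int[OF g], of ?a y] by simp
  qed auto
qed

text \<open>
  The mean of \<open>f (x + t + r)\<close> over \<open>0 \<le> t, r \<le> s\<close>, written as
  a second difference of a second primitive.  A single mean would only be differentiable almost
  everywhere.
\<close>
definition mean2 :: "(real \<Rightarrow> real) \<Rightarrow> real \<Rightarrow> real \<Rightarrow> real" where
  "mean2 f x s = (primitive (primitive f) (x + 2 * s) - 2 * primitive (primitive f) (x + s)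
      + primitive (primitive f) x) / s\<^sup>2"

text \<open>The partial derivatives of \<open>mean2\<close> in \<open>x\<close> and in \<open>s\<close>.\<close>
definition mean2_dx :: "(real \<Rightarrow> real) \<Rightarrow> real \<Rightarrow> real \<Rightarrow> real" where
  "mean2_dx f x s = (primitive f (x + 2 * s) - 2 * primitive f (x + s) + primitive f x) / s\<^sup>2"

definition mean2_ds :: "(real \<Rightarrow> real) \<Rightarrow> real \<Rightarrow> real \<Rightarrow> real" where
  "mean2_ds f x s = (2 * primitive f (x + 2 * s) - 2 * primitive f (x + s)) / s\<^sup>2
     - 2 * (primitive (primitive f) (x + 2 * s) - 2 * primitive (primitive f) (x + s)
      + primitive (primitive f) x) / s ^ 3"

text \<open>
  At depth \<open>- z\<close> the mean is taken at scale \<open>\<kappa> (- z)\<close>; the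
  factor \<open>\<kappa>\<close> limits the range of the means in a strip of given depth.
\<close>
definition lift :: "real \<Rightarrow> (real \<Rightarrow> real) \<Rightarrow> real \<times> real \<Rightarrow> real" where
  "lift \<kappa> f p = mean2 f (fst p) (- \<kappa> * snd p)"

definition lift_grad :: "real \<Rightarrow> (real \<Rightarrow> real) \<Rightarrow> real \<times> real \<Rightarrow> real \<times> real" where
  "lift_grad \<kappa> f p = (mean2_dx f (fst p) (- \<kappa> * snd p), - \<kappa> * mean2_ds f (fst p) (- \<kappa> * snd p))"

lemma lift_has_derivative:
  assumes f: "loc_int f" and "\<kappa> > 0" "snd p < 0"
  shows "(lift \<kappa> f has_derivative (\<lambda>v. lift_grad \<kappa> f p \<bullet> v)) (at p)"
proof -
  let ?Q = "primitive (primitive f)" and ?P = "primitive f"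
  have Q: "(?Q has_derivative (*) (?P x)) (at x)" for x
    using DERIV_primitive[OF continuous_primitive[OF f], of x] by (simp add: has_field_derivative_def)
  define x z where "x = fst p" and "z = snd p"
  define s where "s = - \<kappa> * z"
  have s: "s > 0" using assms by (simp add: mult_pos_neg s_def z_def)
  have 1: "((\<lambda>p. ?Q (fst p + c * (- \<kappa> * snd p))) has_derivative
      (\<lambda>v. ?P (x + c * s) * (fst v + c * (- \<kappa> * snd v)))) (at p)" for c
    unfolding x_def s_def z_def
    by (rule has_derivative_compose[OF _ Q]) (auto intro!: derivative_eq_intros)
  let ?N = "\<lambda>p. ?Q (fst p + 2 * (- \<kappa> * snd p)) - 2 * ?Q (fst p + 1 * (- \<kappa> * snd p)) + ?Q (fst p + 0 * (- \<kappa> * snd p))"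
  let ?N' = "\<lambda>v. ?P (x + 2 * s) * (fst v + 2 * (- \<kappa> * snd v)) - 2 * (?P (x + 1 * s) * (fst v + 1 * (- \<kappa> * snd v)))
      + ?P (x + 0 * s) * (fst v + 0 * (- \<kappa> * snd v))"
  have N: "(?N has_derivative ?N') (at p)"
    by (intro has_derivative_add has_derivative_diff has_derivative_mult_right 1)
  have R: "((\<lambda>p. (- \<kappa> * snd p)\<^sup>2) has_derivative (\<lambda>v. 2 * s * (- \<kappa> * snd v))) (at p)"
    by (auto intro!: derivative_eq_intros simp: s_def z_def)
  have "((\<lambda>p. ?N p / (- \<kappa> * snd p)\<^sup>2) has_derivative
      (\<lambda>v. (?N' v * s\<^sup>2 - ?N p * (2 * s * (- \<kappa> * snd v))) / (s\<^sup>2 * s\<^sup>2))) (at p)"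
  proof -
    have nz: "(- \<kappa> * snd p)\<^sup>2 \<noteq> 0" using assms by simp
    show ?thesis
      using has_derivative_divide'[OF N R nz] unfolding s_def z_def .
  qed
  moreover have "(?N' v * s\<^sup>2 - ?N p * (2 * s * (- \<kappa> * snd v))) / (s\<^sup>2 * s\<^sup>2) = lift_grad \<kappa> f p \<bullet> v" for v
  proof -
    have alg: "((a * (v1 + 2 * (- \<kappa> * v2)) - 2 * (b * (v1 + 1 * (- \<kappa> * v2))) + c * (v1 + 0 * (- \<kappa> * v2))) * s\<^sup>2
        - n * (2 * s * (- \<kappa> * v2))) / (s\<^sup>2 * s\<^sup>2)
        = (a - 2 * b + c) / s\<^sup>2 * v1 + - \<kappa> * ((2 * a - 2 * b) / s\<^sup>2 - 2 * n / s ^ 3) * v2" for a b c n v1 v2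
      using s by (simp add: field_simps power2_eq_square power3_eq_cube)
    show ?thesis
      unfolding alg using s
      by (simp add: lift_grad_def mean2_dx_def mean2_ds_def inner_prod_def s_def x_def z_def)
  qed
  ultimately show ?thesis by (simp add: lift_def[abs_def] mean2_def)
qed

lemma continuous_on_lift_grad:
  assumes f: "loc_int f" and "\<kappa> > 0"
  shows "continuous_on {p. snd p < 0} (lift_grad \<kappa> f)"
proof -
  have c: "continuous_on UNIV (primitive f)" "continuous_on UNIV (primitive (primitive f))"
    using f continuous_primitive continuous_imp_loc_int by blast+
  show ?thesis
    unfolding lift_grad_def mean2_dx_def mean2_ds_def
    using assms(2)
    by (intro continuous_intros continuous_on_compose2[OF c(1)] continuous_on_compose2[OF c(2)]) auto
qed

text \<open>
  The Cauchy-Schwarz inequality, as an inequality between extended non-negative numbers so that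
  it can be integrated further without checking finiteness.
\<close>
lemma square_integral_le:
  assumes f: "loc_int f" and "s \<ge> 0"
  shows "ennreal ((integral {0..s} f)\<^sup>2) \<le> ennreal s * (\<integral>\<^sup>+t\<in>{0..s}. ennreal ((f t)\<^sup>2) \<partial>lborel)"
proof -
  have [measurable]: "f \<in> borel_measurable borel" using f by (simp add: loc_int_def)
  have si: "set_integrable lebesgue {0..s} f" using f by (simp add: loc_int_def)
  have "\<bar>integral {0..s} f\<bar> = \<bar>LINT t:{0..s}|lebesgue. f t\<bar>"
    using si by (simp add: set_lebesgue_integral_eq_integral)
  also have "\<dots> \<le> (LINT t|lebesgue. \<bar>indicator {0..s} t * f t\<bar>)"
    unfolding set_lebesgue_integral_def using integral_abs_bound[of lebesgue "\<lambda>t. indicator {0..s} t * f t"] by simp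
  finally have "ennreal \<bar>integral {0..s} f\<bar> \<le> ennreal (LINT t|lebesgue. \<bar>indicator {0..s} t * f t\<bar>)"
    by (rule ennreal_leI)
  also have "\<dots> = (\<integral>\<^sup>+t. ennreal \<bar>indicator {0..s} t * f t\<bar> \<partial>lebesgue)"
    using si by (intro nn_integral_eq_integral[symmetric]) (simp_all add: set_integrable_def)
  also have "\<dots> = (\<integral>\<^sup>+t. indicator {0..s} t * ennreal \<bar>f t\<bar> \<partial>lborel)"
    unfolding nn_integral_completion by (intro nn_integral_cong) (simp add: indicator_def)
  finally have "(ennreal \<bar>integral {0..s} f\<bar>)\<^sup>2 \<le> (\<integral>\<^sup>+t. indicator {0..s} t * ennreal \<bar>f t\<bar> \<partial>lborel)\<^sup>2"
    by (rule power_mono) simp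
  also have "\<dots> = (\<integral>\<^sup>+t. indicator {0..s} t * (indicator {0..s} t * ennreal \<bar>f t\<bar>) \<partial>lborel)\<^sup>2"
    by (intro arg_cong[where f="\<lambda>x. x\<^sup>2"] nn_integral_cong) (simp add: indicator_def)
  also have "\<dots> \<le> (\<integral>\<^sup>+t. (indicator {0..s} t)\<^sup>2 \<partial>lborel) * (\<integral>\<^sup>+t. (indicator {0..s} t * ennreal \<bar>f t\<bar>)\<^sup>2 \<partial>lborel)"
    by (rule Cauchy_Schwarz_nn_integral) auto
  also have "(\<integral>\<^sup>+t. (indicator {0..s} t :: ennreal)\<^sup>2 \<partial>lborel) = (\<integral>\<^sup>+t. indicator {0..s} t \<partial>lborel)"
    by (intro nn_integral_cong) (simp add: indicator_def)
  also have "\<dots> = ennreal s" using \<open>s \<ge> 0\<close> by simp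
  also have "(\<integral>\<^sup>+t. (indicator {0..s} t * ennreal \<bar>f t\<bar>)\<^sup>2 \<partial>lborel) = (\<integral>\<^sup>+t\<in>{0..s}. ennreal ((f t)\<^sup>2) \<partial>lborel)"
    by (intro nn_integral_cong) (simp add: indicator_def ennreal_power)
  finally show ?thesis by (simp add: ennreal_power)
qed

text \<open>
  The energies of functions on the whole line are weighted integrals of this function of
  \<open>r\<close>.
\<close>
definition sq_increment :: "(real \<Rightarrow> real) \<Rightarrow> real \<Rightarrow> ennreal" where
  "sq_increment f r = (\<integral>\<^sup>+x. ennreal ((f (x + r) - f x)\<^sup>2) \<partial>lborel)"

lemma measurable_sq_increment[measurable]:
  assumes [measurable]: "f \<in> borel_measurable borel"
  shows "sq_increment f \<in> borel_measurable borel"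
  unfolding sq_increment_def by measurable

lemma nn_integral_shift:
  assumes [measurable]: "(g :: real \<Rightarrow> ennreal) \<in> borel_measurable borel"
  shows "(\<integral>\<^sup>+x. g (x + c) \<partial>lborel) = (\<integral>\<^sup>+x. g x \<partial>lborel)"
  using nn_integral_real_affine[of g 1 c] assms by (simp add: add.commute)

lemma sq_increment_shift:
  assumes [measurable]: "f \<in> borel_measurable borel"
  shows "(\<integral>\<^sup>+x. ennreal ((f (x + a) - f (x + b))\<^sup>2) \<partial>lborel) = sq_increment f (a - b)"
  unfolding sq_increment_def
  using nn_integral_shift[of "\<lambda>x. ennreal ((f (x + (a - b)) - f x)\<^sup>2)" b] by (simp add: algebra_simps)

text \<open>
  Local integrability as finiteness of integrals, the form in which it passes to sums and
  compositions.
\<close>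
lemma loc_int_iff:
  "loc_int f \<longleftrightarrow> f \<in> borel_measurable borel \<and> (\<forall>a b. (\<integral>\<^sup>+t\<in>{a..b}. ennreal \<bar>f t\<bar> \<partial>lborel) < \<infinity>)"
proof -
  have "f absolutely_integrable_on {a..b} \<longleftrightarrow> (\<integral>\<^sup>+t\<in>{a..b}. ennreal \<bar>f t\<bar> \<partial>lborel) < \<infinity>"
    if [measurable]: "f \<in> borel_measurable borel" for a b
  proof -
    have "f absolutely_integrable_on {a..b} \<longleftrightarrow> integrable lborel (\<lambda>t. indicator {a..b} t *\<^sub>R f t)"
      unfolding set_integrable_def by (rule integrable_completion) simp
    also have "\<dots> \<longleftrightarrow> (\<integral>\<^sup>+t. ennreal (norm (indicator {a..b} t *\<^sub>R f t)) \<partial>lborel) < \<infinity>"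
      by (simp add: integrable_iff_bounded)
    also have "(\<integral>\<^sup>+t. ennreal (norm (indicator {a..b} t *\<^sub>R f t)) \<partial>lborel) = (\<integral>\<^sup>+t\<in>{a..b}. ennreal \<bar>f t\<bar> \<partial>lborel)"
      by (intro nn_integral_cong) (simp add: indicator_def)
    finally show ?thesis .
  qed
  then show ?thesis by (auto simp: loc_int_def)
qed

lemma loc_int_shift:
  assumes f: "loc_int f"
  shows "loc_int (\<lambda>t. f (c + t))"
  unfolding loc_int_iff
proof (intro conjI allI)
  have [measurable]: "f \<in> borel_measurable borel" using f by (simp add: loc_int_def)
  show "(\<lambda>t. f (c + t)) \<in> borel_measurable borel" by measurable
  fix a b
  have "(\<integral>\<^sup>+t\<in>{a..b}. ennreal \<bar>f (c + t)\<bar> \<partial>lborel) = (\<integral>\<^sup>+t. ennreal \<bar>f (t + c)\<bar> * indicator {a+c..b+c} (t + c) \<partial>lborel)"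
    by (intro nn_integral_cong) (simp add: indicator_def add.commute)
  also have "\<dots> = (\<integral>\<^sup>+t. ennreal \<bar>f t\<bar> * indicator {a+c..b+c} t \<partial>lborel)"
    by (rule nn_integral_shift) measurable
  finally show "(\<integral>\<^sup>+t\<in>{a..b}. ennreal \<bar>f (c + t)\<bar> \<partial>lborel) < \<infinity>"
    using f by (simp add: loc_int_iff)
qed

lemma loc_int_diff: "loc_int f \<Longrightarrow> loc_int g \<Longrightarrow> loc_int (\<lambda>t. f t - g t)"
  by (auto simp: loc_int_def intro: set_integral_diff)

lemma primitive_increments:
  assumes f: "loc_int f" and "s \<ge> 0"
  shows "(primitive f (x + s) - primitive f x) - (primitive f (y + s) - primitive f y)
    = integral {0..s} (\<lambda>t. f (x + t) - f (y + t))"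
proof -
  have "primitive f (x + s) - primitive f x = integral {0..s} (\<lambda>t. f (x + t))" for x
    using primitive_diff[OF f, of x "x + s"] \<open>s \<ge> 0\<close> integral_shift_real_ivl[where a=x and b="x + s" and c=x and f=f] by (simp add: add.commute)
  then show ?thesis
    by (simp add: Henstock_Kurzweil_Integration.integral_diff loc_int_integrable loc_int_shift f)
qed

text \<open>
  An increment of the primitive over length \<open>s\<close> is an integral of \<open>f\<close>,
  so a difference of two of them is an integral of increments of \<open>f\<close>; by
  translation invariance, each contributes \<open>sq_increment f (a - b)\<close>.
\<close>
lemma sq_primitive_increments:
  assumes f: "loc_int f" and "s \<ge> 0"
  shows "(\<integral>\<^sup>+x. ennreal (((primitive f (x + a + s) - primitive f (x + a)) -
      (primitive f (x + b + s) - primitive f (x + b)))\<^sup>2) \<partial>lborel) \<le> ennreal (s\<^sup>2) * sq_increment f (a - b)"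
proof -
  have [measurable]: "f \<in> borel_measurable borel" using f by (simp add: loc_int_def)
  have "(\<integral>\<^sup>+x. ennreal (((primitive f (x + a + s) - primitive f (x + a)) -
      (primitive f (x + b + s) - primitive f (x + b)))\<^sup>2) \<partial>lborel)
      \<le> (\<integral>\<^sup>+x. ennreal s * (\<integral>\<^sup>+t\<in>{0..s}. ennreal ((f (x + a + t) - f (x + b + t))\<^sup>2) \<partial>lborel) \<partial>lborel)"
    unfolding primitive_increments[OF assms]
    by (intro nn_integral_mono square_integral_le loc_int_diff loc_int_shift f \<open>s \<ge> 0\<close>)
  also have "\<dots> = ennreal s * (\<integral>\<^sup>+x. (\<integral>\<^sup>+t. ennreal ((f (x + a + t) - f (x + b + t))\<^sup>2) * indicator {0..s} t \<partial>lborel) \<partial>lborel)"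
    by (subst nn_integral_cmult) auto
  also have "\<dots> = ennreal s * (\<integral>\<^sup>+t. (\<integral>\<^sup>+x. ennreal ((f (x + a + t) - f (x + b + t))\<^sup>2) * indicator {0..s} t \<partial>lborel) \<partial>lborel)"
    by (subst lborel_pair.Fubini') auto
  also have "\<dots> = ennreal s * (\<integral>\<^sup>+t. sq_increment f (a - b) * indicator {0..s} t \<partial>lborel)"
    using sq_increment_shift[of f "a + t" "b + t" for t]
    by (simp add: nn_integral_multc add.assoc)
  also have "\<dots> = ennreal s * (sq_increment f (a - b) * ennreal s)"
    using \<open>s \<ge> 0\<close> by (subst nn_integral_cmult) auto
  also have "\<dots> = ennreal (s\<^sup>2) * sq_increment f (a - b)"
  proof -
    have "ennreal (s\<^sup>2) = ennreal s * ennreal s"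
      using \<open>s \<ge> 0\<close> by (simp add: power2_eq_square ennreal_mult)
    then show ?thesis by (simp only: mult.assoc mult.commute[of "sq_increment f (a - b)"])
  qed
  finally show ?thesis .
qed

lemma measurable_primitive: "loc_int f \<Longrightarrow> primitive f \<in> borel_measurable borel"
  by (intro borel_measurable_continuous_onI continuous_primitive)

lemma loc_int_primitive: "loc_int f \<Longrightarrow> loc_int (primitive f)"
  by (rule continuous_imp_loc_int, rule continuous_primitive)

text \<open>
  The numerator of \<open>mean2_dx\<close> is a difference of two increments of the primitive at
  distance \<open>s\<close>.
\<close>
lemma square_mean2_dx:
  assumes f: "loc_int f" and s: "s > 0"
  shows "(\<integral>\<^sup>+x. ennreal ((mean2_dx f x s)\<^sup>2) \<partial>lborel) \<le> ennreal (1 / s\<^sup>2) * sq_increment f s"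
proof -
  have [measurable]: "primitive f \<in> borel_measurable borel" using f by (rule measurable_primitive)
  let ?d = "\<lambda>x. (primitive f (x + s + s) - primitive f (x + s)) - (primitive f (x + 0 + s) - primitive f (x + 0))"
  have "ennreal ((mean2_dx f x s)\<^sup>2) = ennreal (1 / s ^ 4) * ennreal ((?d x)\<^sup>2)" for x
    using s by (simp add: mean2_dx_def ennreal_mult[symmetric] power_divide algebra_simps flip: power_mult)
  then have "(\<integral>\<^sup>+x. ennreal ((mean2_dx f x s)\<^sup>2) \<partial>lborel) = ennreal (1 / s ^ 4) * (\<integral>\<^sup>+x. ennreal ((?d x)\<^sup>2) \<partial>lborel)"
    by (simp only:) (rule nn_integral_cmult, measurable)
  also have "\<dots> \<le> ennreal (1 / s ^ 4) * (ennreal (s\<^sup>2) * sq_increment f (s - 0))"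
    using sq_primitive_increments[OF f, of s s 0] s by (intro mult_left_mono) auto
  also have "\<dots> = ennreal (1 / s ^ 4 * s\<^sup>2) * sq_increment f s"
    by (subst ennreal_mult) (use s in \<open>auto simp: mult.assoc\<close>)
  also have "1 / s ^ 4 * s\<^sup>2 = 1 / s\<^sup>2"
    using s by (simp add: field_simps flip: power_add)
  finally show ?thesis .
qed

lemma nn_integral_reflect_Icc:
  assumes [measurable]: "(g :: real \<Rightarrow> ennreal) \<in> borel_measurable borel"
  shows "(\<integral>\<^sup>+r\<in>{0..s}. g (s - r) \<partial>lborel) = (\<integral>\<^sup>+r\<in>{0..s}. g r \<partial>lborel)"
  by (subst nn_integral_real_affine[where c="-1" and t=s and f="\<lambda>r. g r * indicator {0..s} r"])
    (auto intro!: nn_integral_cong simp: indicator_def)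

lemma primitive_diff_integral:
  assumes f: "loc_int f" and "s \<ge> 0"
  shows "primitive f (x + s) - primitive f x = integral {0..s} (\<lambda>t. f (x + t))"
  using primitive_diff[OF f, of x "x + s"] \<open>s \<ge> 0\<close>
    integral_shift_real_ivl[where a=x and b="x + s" and c=x and f=f] by (simp add: add.commute)

text \<open>
  The numerator of \<open>mean2_ds\<close> is the integral over \<open>r\<close> of differences
  of two increments of the primitive, at distance \<open>s - r\<close>.
\<close>
lemma square_mean2_ds:
  assumes f: "loc_int f" and s: "s > 0"
  shows "(\<integral>\<^sup>+x. ennreal ((mean2_ds f x s)\<^sup>2) \<partial>lborel)
    \<le> ennreal (4 / s ^ 3) * (\<integral>\<^sup>+r\<in>{0..s}. sq_increment f r \<partial>lborel)"
proof -
  let ?P = "primitive f" and ?Q = "primitive (primitive f)"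
  have [measurable]: "?P \<in> borel_measurable borel" "f \<in> borel_measurable borel"
    using f by (simp_all add: measurable_primitive loc_int_measurable)
  let ?d = "\<lambda>x r. (?P (x + s + s) - ?P (x + s)) - (?P (x + r + s) - ?P (x + r))"
  have cP: "continuous_on UNIV ?P" by (rule continuous_primitive[OF f])
  have lP: "loc_int ?P" by (rule loc_int_primitive[OF f])
  have ld: "loc_int (?d x)" for x
    by (intro continuous_imp_loc_int continuous_intros continuous_on_compose2[OF cP]) auto
  have eq: "mean2_ds f x s = 2 / s ^ 3 * integral {0..s} (?d x)" for x
  proof -
    have i: "(\<lambda>r. ?P (x + r)) integrable_on {0..s}" "(\<lambda>r. ?P (x + s + r)) integrable_on {0..s}" for x
      by (intro loc_int_integrable loc_int_shift lP)+
    have j1: "integral {0..s} (\<lambda>r. ?P (x + s + r)) = ?Q (x + s + s) - ?Q (x + s)"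
      using primitive_diff_integral[OF lP, of s "x + s"] s by simp
    have j2: "integral {0..s} (\<lambda>r. ?P (x + r)) = ?Q (x + s) - ?Q x"
      using primitive_diff_integral[OF lP, of s x] s by simp
    have "integral {0..s} (?d x) = integral {0..s} (\<lambda>r. ?P (x + s + s) - ?P (x + s))
        - integral {0..s} (\<lambda>r. ?P (x + s + r) - ?P (x + r))"
    proof -
      have "integral {0..s} (?d x) = integral {0..s} (\<lambda>r. (?P (x + s + s) - ?P (x + s)) - (?P (x + s + r) - ?P (x + r)))"
        by (simp add: add_ac)
      also have "\<dots> = integral {0..s} (\<lambda>r. ?P (x + s + s) - ?P (x + s)) - integral {0..s} (\<lambda>r. ?P (x + s + r) - ?P (x + r))"
        by (intro Henstock_Kurzweil_Integration.integral_diff Henstock_Kurzweil_Integration.integrable_diff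
            integrable_const_ivl i)
      finally show ?thesis .
    qed
    also have "\<dots> = s * (?P (x + s + s) - ?P (x + s)) - ((?Q (x + s + s) - ?Q (x + s)) - (?Q (x + s) - ?Q x))"
      using s by (simp add: Henstock_Kurzweil_Integration.integral_diff[OF i(2) i(1)] j1 j2)
    finally have e: "integral {0..s} (?d x) = \<dots>" .
    have x2: "x + 2 * s = x + s + s" by simp
    have alg: "(2 * a - 2 * b) / s\<^sup>2 - 2 * (c - 2 * d + e) / s ^ 3 = 2 / s ^ 3 * (s * (a - b) - ((c - d) - (d - e)))" for a b c d e
      using s by (simp add: field_simps power2_eq_square power3_eq_cube)
    show ?thesis unfolding e mean2_ds_def x2 by (rule alg)
  qed
  have "ennreal ((mean2_ds f x s)\<^sup>2) \<le> ennreal (4 / s ^ 6) * (ennreal s * (\<integral>\<^sup>+r\<in>{0..s}. ennreal ((?d x r)\<^sup>2) \<partial>lborel))" for x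
  proof -
    have "ennreal ((mean2_ds f x s)\<^sup>2) = ennreal (4 / s ^ 6) * ennreal ((integral {0..s} (?d x))\<^sup>2)"
      unfolding eq by (simp add: ennreal_mult[symmetric] power_mult_distrib power_divide flip: power_mult)
    also have "\<dots> \<le> ennreal (4 / s ^ 6) * (ennreal s * (\<integral>\<^sup>+r\<in>{0..s}. ennreal ((?d x r)\<^sup>2) \<partial>lborel))"
      using s by (intro mult_left_mono square_integral_le ld) auto
    finally show ?thesis .
  qed
  then have "(\<integral>\<^sup>+x. ennreal ((mean2_ds f x s)\<^sup>2) \<partial>lborel)
      \<le> (\<integral>\<^sup>+x. ennreal (4 / s ^ 6) * (ennreal s * (\<integral>\<^sup>+r\<in>{0..s}. ennreal ((?d x r)\<^sup>2) \<partial>lborel)) \<partial>lborel)"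
    by (intro nn_integral_mono) auto
  also have "\<dots> = ennreal (4 / s ^ 6) * (ennreal s * (\<integral>\<^sup>+x. (\<integral>\<^sup>+r\<in>{0..s}. ennreal ((?d x r)\<^sup>2) \<partial>lborel) \<partial>lborel))"
    by (simp add: nn_integral_cmult)
  also have "(\<integral>\<^sup>+x. (\<integral>\<^sup>+r\<in>{0..s}. ennreal ((?d x r)\<^sup>2) \<partial>lborel) \<partial>lborel)
      = (\<integral>\<^sup>+r. (\<integral>\<^sup>+x. ennreal ((?d x r)\<^sup>2) * indicator {0..s} r \<partial>lborel) \<partial>lborel)"
    by (subst lborel_pair.Fubini') auto
  also have "\<dots> = (\<integral>\<^sup>+r. (\<integral>\<^sup>+x. ennreal ((?d x r)\<^sup>2) \<partial>lborel) * indicator {0..s} r \<partial>lborel)"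
    by (subst nn_integral_multc) auto
  also have "\<dots> \<le> (\<integral>\<^sup>+r. (ennreal (s\<^sup>2) * sq_increment f (s - r)) * indicator {0..s} r \<partial>lborel)"
    using s by (intro nn_integral_mono mult_right_mono sq_primitive_increments f) auto
  also have "\<dots> = ennreal (s\<^sup>2) * (\<integral>\<^sup>+r\<in>{0..s}. sq_increment f r \<partial>lborel)"
    by (simp add: mult.assoc nn_integral_cmult nn_integral_reflect_Icc)
  finally have "(\<integral>\<^sup>+x. ennreal ((mean2_ds f x s)\<^sup>2) \<partial>lborel)
    \<le> ennreal (4 / s ^ 6) * (ennreal s * (ennreal (s\<^sup>2) * (\<integral>\<^sup>+r\<in>{0..s}. sq_increment f r \<partial>lborel)))"
    by (simp add: mult_left_mono)
  also have "\<dots> = ennreal (4 / s ^ 6 * s * s\<^sup>2) * (\<integral>\<^sup>+r\<in>{0..s}. sq_increment f r \<partial>lborel)"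
    using s by (simp add: ennreal_mult mult.assoc del: times_divide_eq_left)
  also have "4 / s ^ 6 * s * s\<^sup>2 = 4 / s ^ 3"
    using s by (simp add: field_simps eval_nat_numeral)
  finally show ?thesis .
qed

text \<open>
  \<open>mean2 f x s - f x\<close> is a mean of the increments \<open>f (x + r + t) - f
  x\<close> with \<open>r + t \<le> 2 s\<close>.
\<close>
lemma square_mean2_diff:
  assumes f: "loc_int f" and s: "s > 0"
  shows "(\<integral>\<^sup>+x. ennreal ((mean2 f x s - f x)\<^sup>2) \<partial>lborel)
    \<le> ennreal (1 / s) * (\<integral>\<^sup>+r\<in>{0..2 * s}. sq_increment f r \<partial>lborel)"
proof -
  let ?P = "primitive f" and ?Q = "primitive (primitive f)"
  have [measurable]: "?P \<in> borel_measurable borel" "f \<in> borel_measurable borel"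
    using f by (simp_all add: measurable_primitive loc_int_measurable)
  let ?d = "\<lambda>x r. (?P (x + r + s) - ?P (x + r)) - s * f x"
  have cP: "continuous_on UNIV ?P" by (rule continuous_primitive[OF f])
  have lP: "loc_int ?P" by (rule loc_int_primitive[OF f])
  have ld: "loc_int (?d x)" for x
    by (intro continuous_imp_loc_int continuous_intros continuous_on_compose2[OF cP]) auto
  have eq: "mean2 f x s - f x = 1 / s\<^sup>2 * integral {0..s} (?d x)" for x
  proof -
    have i: "(\<lambda>r. ?P (x + r)) integrable_on {0..s}" "(\<lambda>r. ?P (x + s + r)) integrable_on {0..s}" for x
      by (intro loc_int_integrable loc_int_shift lP)+
    have j1: "integral {0..s} (\<lambda>r. ?P (x + s + r)) = ?Q (x + s + s) - ?Q (x + s)"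
      using primitive_diff_integral[OF lP, of s "x + s"] s by simp
    have j2: "integral {0..s} (\<lambda>r. ?P (x + r)) = ?Q (x + s) - ?Q x"
      using primitive_diff_integral[OF lP, of s x] s by simp
    have "integral {0..s} (?d x) = integral {0..s} (\<lambda>r. ?P (x + s + r) - ?P (x + r)) - integral {0..s} (\<lambda>r. s * f x)"
    proof -
      have "integral {0..s} (?d x) = integral {0..s} (\<lambda>r. (?P (x + s + r) - ?P (x + r)) - s * f x)"
        by (simp add: add_ac)
      also have "\<dots> = integral {0..s} (\<lambda>r. ?P (x + s + r) - ?P (x + r)) - integral {0..s} (\<lambda>r. s * f x)"
        by (intro Henstock_Kurzweil_Integration.integral_diff Henstock_Kurzweil_Integration.integrable_diff
            integrable_const_ivl i)
      finally show ?thesis .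
    qed
    also have "\<dots> = ((?Q (x + s + s) - ?Q (x + s)) - (?Q (x + s) - ?Q x)) - s * (s * f x)"
      using s by (simp add: Henstock_Kurzweil_Integration.integral_diff[OF i(2) i(1)] j1 j2)
    finally show ?thesis
      using s by (simp add: mean2_def field_simps power2_eq_square)
  qed
  have d2: "ennreal ((?d x r)\<^sup>2) \<le> ennreal s * (\<integral>\<^sup>+t\<in>{0..s}. ennreal ((f (x + r + t) - f x)\<^sup>2) \<partial>lborel)" for x r
  proof -
    have "loc_int (\<lambda>t. f x)" by (rule continuous_imp_loc_int) (rule continuous_on_const)
    then have l: "loc_int (\<lambda>t. f (x + r + t) - f x)"
      by (rule loc_int_diff[OF loc_int_shift[OF f]])
    have "?d x r = integral {0..s} (\<lambda>t. f (x + r + t) - f x)"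
      using s by (subst Henstock_Kurzweil_Integration.integral_diff)
        (simp_all add: primitive_diff_integral[OF f] loc_int_integrable[OF loc_int_shift[OF f]] integrable_const_ivl)
    then show ?thesis using square_integral_le[OF l, of s] s by simp
  qed
  have "ennreal ((mean2 f x s - f x)\<^sup>2) \<le> ennreal (1 / s ^ 4) * (ennreal s *
      (\<integral>\<^sup>+r\<in>{0..s}. ennreal s * (\<integral>\<^sup>+t\<in>{0..s}. ennreal ((f (x + r + t) - f x)\<^sup>2) \<partial>lborel) \<partial>lborel))" for x
  proof -
    have "ennreal ((mean2 f x s - f x)\<^sup>2) = ennreal (1 / s ^ 4) * ennreal ((integral {0..s} (?d x))\<^sup>2)"
      unfolding eq by (simp add: ennreal_mult[symmetric] power_mult_distrib power_divide flip: power_mult)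
    also have "\<dots> \<le> ennreal (1 / s ^ 4) * (ennreal s * (\<integral>\<^sup>+r\<in>{0..s}. ennreal ((?d x r)\<^sup>2) \<partial>lborel))"
      using s by (intro mult_left_mono square_integral_le ld) auto
    also have "\<dots> \<le> ennreal (1 / s ^ 4) * (ennreal s *
      (\<integral>\<^sup>+r\<in>{0..s}. ennreal s * (\<integral>\<^sup>+t\<in>{0..s}. ennreal ((f (x + r + t) - f x)\<^sup>2) \<partial>lborel) \<partial>lborel))"
      by (intro mult_left_mono nn_integral_mono mult_right_mono d2) auto
    finally show ?thesis .
  qed
  then have "(\<integral>\<^sup>+x. ennreal ((mean2 f x s - f x)\<^sup>2) \<partial>lborel) \<le> (\<integral>\<^sup>+x. ennreal (1 / s ^ 4) * (ennreal s *
      (\<integral>\<^sup>+r\<in>{0..s}. ennreal s * (\<integral>\<^sup>+t\<in>{0..s}. ennreal ((f (x + r + t) - f x)\<^sup>2) \<partial>lborel) \<partial>lborel)) \<partial>lborel)"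
    by (intro nn_integral_mono) auto
  also have "\<dots> = ennreal (1 / s ^ 4) * (ennreal s * (\<integral>\<^sup>+x.
      (\<integral>\<^sup>+r\<in>{0..s}. ennreal s * (\<integral>\<^sup>+t\<in>{0..s}. ennreal ((f (x + r + t) - f x)\<^sup>2) \<partial>lborel) \<partial>lborel) \<partial>lborel))"
    by (simp add: nn_integral_cmult)
  also have "(\<integral>\<^sup>+x. (\<integral>\<^sup>+r\<in>{0..s}. ennreal s * (\<integral>\<^sup>+t\<in>{0..s}. ennreal ((f (x + r + t) - f x)\<^sup>2) \<partial>lborel) \<partial>lborel) \<partial>lborel)
      = (\<integral>\<^sup>+r. (\<integral>\<^sup>+x. ennreal s * (\<integral>\<^sup>+t\<in>{0..s}. ennreal ((f (x + r + t) - f x)\<^sup>2) \<partial>lborel) * indicator {0..s} r \<partial>lborel) \<partial>lborel)"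
    by (subst lborel_pair.Fubini') auto
  also have "\<dots> = (\<integral>\<^sup>+r. ennreal s * (\<integral>\<^sup>+x. (\<integral>\<^sup>+t\<in>{0..s}. ennreal ((f (x + r + t) - f x)\<^sup>2) \<partial>lborel) \<partial>lborel) * indicator {0..s} r \<partial>lborel)"
    by (simp add: nn_integral_multc nn_integral_cmult)
  also have "\<dots> \<le> (\<integral>\<^sup>+r. ennreal s * (\<integral>\<^sup>+t\<in>{0..2 * s}. sq_increment f t \<partial>lborel) * indicator {0..s} r \<partial>lborel)"
  proof (rule nn_integral_mono)
    fix r
    have "(\<integral>\<^sup>+x. (\<integral>\<^sup>+t\<in>{0..s}. ennreal ((f (x + r + t) - f x)\<^sup>2) \<partial>lborel) \<partial>lborel)
      \<le> (\<integral>\<^sup>+t\<in>{0..2 * s}. sq_increment f t \<partial>lborel)" if r: "r \<in> {0..s}"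
    proof -
      have "(\<integral>\<^sup>+x. (\<integral>\<^sup>+t\<in>{0..s}. ennreal ((f (x + r + t) - f x)\<^sup>2) \<partial>lborel) \<partial>lborel)
        = (\<integral>\<^sup>+t. (\<integral>\<^sup>+x. ennreal ((f (x + r + t) - f x)\<^sup>2) * indicator {0..s} t \<partial>lborel) \<partial>lborel)"
        by (subst lborel_pair.Fubini') auto
      also have "\<dots> = (\<integral>\<^sup>+t. sq_increment f (t + r) * indicator {0..s} t \<partial>lborel)"
        by (simp add: nn_integral_multc sq_increment_def add_ac)
      also have "\<dots> \<le> (\<integral>\<^sup>+t. sq_increment f (t + r) * indicator {0..2 * s} (t + r) \<partial>lborel)"
        using r by (intro nn_integral_mono) (auto simp: indicator_def)
      also have "\<dots> = (\<integral>\<^sup>+t\<in>{0..2 * s}. sq_increment f t \<partial>lborel)"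
        by (rule nn_integral_shift) measurable
      finally show ?thesis .
    qed
    then show "ennreal s * (\<integral>\<^sup>+x. (\<integral>\<^sup>+t\<in>{0..s}. ennreal ((f (x + r + t) - f x)\<^sup>2) \<partial>lborel) \<partial>lborel) * indicator {0..s} r
      \<le> ennreal s * (\<integral>\<^sup>+t\<in>{0..2 * s}. sq_increment f t \<partial>lborel) * indicator {0..s} r"
      by (cases "r \<in> {0..s}") (auto intro: mult_left_mono)
  qed
  also have "\<dots> = ennreal s * (\<integral>\<^sup>+t\<in>{0..2 * s}. sq_increment f t \<partial>lborel) * ennreal s"
    using s by (subst nn_integral_cmult) auto
  finally have "(\<integral>\<^sup>+x. ennreal ((mean2 f x s - f x)\<^sup>2) \<partial>lborel)
    \<le> ennreal (1 / s ^ 4) * (ennreal s * (ennreal s * (\<integral>\<^sup>+t\<in>{0..2 * s}. sq_increment f t \<partial>lborel) * ennreal s))"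
    by (simp add: mult_left_mono)
  also have "\<dots> = ennreal (1 / s ^ 4 * s * s * s) * (\<integral>\<^sup>+r\<in>{0..2 * s}. sq_increment f r \<partial>lborel)"
  proof -
    have "ennreal (1 / s ^ 4 * s * s * s) = ennreal (1 / s ^ 4) * ennreal s * ennreal s * ennreal s"
      using s by (simp add: ennreal_mult del: times_divide_eq_left)
    then show ?thesis by (simp only: mult.assoc mult.commute mult.left_commute)
  qed
  also have "1 / s ^ 4 * s * s * s = 1 / s"
    using s by (simp add: field_simps eval_nat_numeral)
  finally show ?thesis .
qed

text \<open>
  The double integral of the semi-norm of order one half, truncated to \<open>\<bar>x - y\<bar>
  < w\<close>; one definition covers bounded intervals and half-lines.
\<close>
definition gagliardo :: "real \<Rightarrow> real set \<Rightarrow> (real \<Rightarrow> real) \<Rightarrow> ennreal" where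
  "gagliardo w A f = (\<integral>\<^sup>+x. (\<integral>\<^sup>+y. ennreal ((f x - f y)\<^sup>2 / (x - y)\<^sup>2) *
     indicator {(x, y). x \<in> A \<and> y \<in> A \<and> \<bar>x - y\<bar> < w} (x, y) \<partial>lborel) \<partial>lborel)"

text \<open>
  The energy of a function on the line in terms of increments: half of \<open>gagliardo w
  UNIV\<close>, since only positive increments are counted.
\<close>
definition increment_energy :: "real \<Rightarrow> (real \<Rightarrow> real) \<Rightarrow> ennreal" where
  "increment_energy w f = (\<integral>\<^sup>+r\<in>{0<..<w}. ennreal (1 / r\<^sup>2) * sq_increment f r \<partial>lborel)"

text \<open>Substitute \<open>y = x + r\<close> and exchange the integrals.\<close>
lemma increment_energy_le_gagliardo:
  assumes [measurable]: "f \<in> borel_measurable borel"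
  shows "increment_energy w f \<le> gagliardo w UNIV f"
proof -
  have "gagliardo w UNIV f = (\<integral>\<^sup>+x. (\<integral>\<^sup>+r. ennreal ((f x - f (r + x))\<^sup>2 / r\<^sup>2) * indicator {r. \<bar>r\<bar> < w} r \<partial>lborel) \<partial>lborel)"
    unfolding gagliardo_def
  proof (rule nn_integral_cong)
    fix x
    have "(\<integral>\<^sup>+y. ennreal ((f x - f y)\<^sup>2 / (x - y)\<^sup>2) * indicator {(x, y). x \<in> UNIV \<and> y \<in> UNIV \<and> \<bar>x - y\<bar> < w} (x, y) \<partial>lborel)
      = (\<integral>\<^sup>+y. ennreal ((f x - f (y + x))\<^sup>2 / (x - (y + x))\<^sup>2) * indicator {y. \<bar>x - y\<bar> < w} (y + x) \<partial>lborel)"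
    proof -
      let ?g = "\<lambda>y. ennreal ((f x - f y)\<^sup>2 / (x - y)\<^sup>2) * indicator {y. \<bar>x - y\<bar> < w} y"
      have "?g \<in> borel_measurable borel" by measurable
      from nn_integral_shift[OF this, of x] show ?thesis
        by (simp add: indicator_def)
    qed
    also have "\<dots> = (\<integral>\<^sup>+r. ennreal ((f x - f (r + x))\<^sup>2 / r\<^sup>2) * indicator {r. \<bar>r\<bar> < w} r \<partial>lborel)"
      by (intro nn_integral_cong) (simp add: indicator_def)
    finally show "(\<integral>\<^sup>+y. ennreal ((f x - f y)\<^sup>2 / (x - y)\<^sup>2) * indicator {(x, y). x \<in> UNIV \<and> y \<in> UNIV \<and> \<bar>x - y\<bar> < w} (x, y) \<partial>lborel)
      = (\<integral>\<^sup>+r. ennreal ((f x - f (r + x))\<^sup>2 / r\<^sup>2) * indicator {r. \<bar>r\<bar> < w} r \<partial>lborel)" .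
  qed
  also have "\<dots> = (\<integral>\<^sup>+r. (\<integral>\<^sup>+x. ennreal ((f x - f (r + x))\<^sup>2 / r\<^sup>2) * indicator {r. \<bar>r\<bar> < w} r \<partial>lborel) \<partial>lborel)"
    by (subst lborel_pair.Fubini') auto
  also have "\<dots> \<ge> increment_energy w f"
    unfolding increment_energy_def
  proof (rule nn_integral_mono)
    fix r
    have "ennreal ((f x - f (r + x))\<^sup>2 / r\<^sup>2) = ennreal (1 / r\<^sup>2) * ennreal ((f (x + r) - f x)\<^sup>2)" for x
      by (simp add: ennreal_mult[symmetric] add.commute power2_commute)
    then have "(\<integral>\<^sup>+x. ennreal ((f x - f (r + x))\<^sup>2 / r\<^sup>2) * indicator {r. \<bar>r\<bar> < w} r \<partial>lborel)
      = ennreal (1 / r\<^sup>2) * sq_increment f r * indicator {r. \<bar>r\<bar> < w} r"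
      by (simp add: nn_integral_multc nn_integral_cmult sq_increment_def)
    then show "ennreal (1 / r\<^sup>2) * sq_increment f r * indicator {0<..<w} r
      \<le> (\<integral>\<^sup>+x. ennreal ((f x - f (r + x))\<^sup>2 / r\<^sup>2) * indicator {r. \<bar>r\<bar> < w} r \<partial>lborel)"
      by (auto simp: indicator_def)
  qed
  finally show ?thesis .
qed

lemma nn_integral_inverse_cube:
  assumes "r > 0"
  shows "(\<integral>\<^sup>+s. ennreal (4 / s ^ 3) * indicator {r..} s \<partial>lborel) = ennreal (2 / r\<^sup>2)"
proof -
  have "((\<lambda>s::real. - 2 * (inverse s)\<^sup>2) \<longlongrightarrow> - 2 * 0\<^sup>2) at_top"
    by (intro tendsto_intros tendsto_inverse_0_at_top filterlim_ident)
  then have "((\<lambda>s::real. - 2 / s\<^sup>2) \<longlongrightarrow> 0) at_top"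
    by (simp add: divide_inverse power_inverse)
  moreover have "DERIV (\<lambda>s. - 2 / s\<^sup>2) s :> 4 / s ^ 3" if "r \<le> s" for s
    using that assms by (auto intro!: derivative_eq_intros simp: field_simps eval_nat_numeral)
  ultimately have "(\<integral>\<^sup>+s. ennreal (4 / s ^ 3) * indicator {r..} s \<partial>lborel) = ennreal (0 - (- 2 / r\<^sup>2))"
    using assms by (intro nn_integral_FTC_atLeast) auto
  then show ?thesis by simp
qed

text \<open>
  Hardy-type inequality: exchange the integrals and use that \<open>4 / s^3\<close> has integral
  \<open>2 / r\<^sup>2\<close> over \<open>s \<ge> r\<close>.
\<close>
lemma averaged_sq_increment_le:
  assumes [measurable]: "f \<in> borel_measurable borel"
  shows "(\<integral>\<^sup>+s\<in>{0<..<w}. ennreal (4 / s ^ 3) * (\<integral>\<^sup>+r\<in>{0..s}. sq_increment f r \<partial>lborel) \<partial>lborel)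
    \<le> 2 * increment_energy w f"
proof -
  have "(\<integral>\<^sup>+s\<in>{0<..<w}. ennreal (4 / s ^ 3) * (\<integral>\<^sup>+r\<in>{0..s}. sq_increment f r \<partial>lborel) \<partial>lborel)
    = (\<integral>\<^sup>+s. (\<integral>\<^sup>+r. ennreal (4 / s ^ 3) * (sq_increment f r * (if 0 \<le> r \<and> r \<le> s then 1 else 0)) * indicator {0<..<w} s \<partial>lborel) \<partial>lborel)"
    by (simp add: nn_integral_multc nn_integral_cmult)
      (simp add: indicator_def of_bool_def)
  also have "\<dots> = (\<integral>\<^sup>+r. (\<integral>\<^sup>+s. ennreal (4 / s ^ 3) * (sq_increment f r * (if 0 \<le> r \<and> r \<le> s then 1 else 0)) * indicator {0<..<w} s \<partial>lborel) \<partial>lborel)"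
    by (subst lborel_pair.Fubini') auto
  also have "\<dots> \<le> (\<integral>\<^sup>+r. 2 * (ennreal (1 / r\<^sup>2) * sq_increment f r * indicator {0<..<w} r) \<partial>lborel)"
  proof (rule nn_integral_mono)
    fix r
    consider "r > 0" "r < w" | "r = 0" | "r < 0 \<or> r \<ge> w" by linarith
    then show "(\<integral>\<^sup>+s. ennreal (4 / s ^ 3) * (sq_increment f r * (if 0 \<le> r \<and> r \<le> s then 1 else 0)) * indicator {0<..<w} s \<partial>lborel)
      \<le> 2 * (ennreal (1 / r\<^sup>2) * sq_increment f r * indicator {0<..<w} r)"
    proof cases
      case 1
      have "(\<integral>\<^sup>+s. ennreal (4 / s ^ 3) * (sq_increment f r * (if 0 \<le> r \<and> r \<le> s then 1 else 0)) * indicator {0<..<w} s \<partial>lborel)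
        \<le> (\<integral>\<^sup>+s. sq_increment f r * (ennreal (4 / s ^ 3) * indicator {r..} s) \<partial>lborel)"
        by (intro nn_integral_mono) (auto simp: indicator_def mult.commute)
      also have "\<dots> = sq_increment f r * ennreal (2 / r\<^sup>2)"
        using 1 by (simp add: nn_integral_cmult nn_integral_inverse_cube)
      also have "ennreal (2 / r\<^sup>2) = 2 * ennreal (1 / r\<^sup>2)"
        using ennreal_mult[of 2 "1 / r\<^sup>2"] by simp
      finally show ?thesis using 1 by (simp add: ac_simps)
    next
      case 2
      have "sq_increment f 0 = 0" by (simp add: sq_increment_def)
      then show ?thesis using 2 by simp
    next
      case 3
      then have "(\<integral>\<^sup>+s. ennreal (4 / s ^ 3) * (sq_increment f r * (if 0 \<le> r \<and> r \<le> s then 1 else 0)) * indicator {0<..<w} s \<partial>lborel)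
        = (\<integral>\<^sup>+(s::real). 0 \<partial>lborel)"
        by (intro nn_integral_cong) (auto simp: indicator_def)
      then show ?thesis by simp
    qed
  qed
  also have "\<dots> = 2 * increment_energy w f"
    unfolding increment_energy_def by (subst nn_integral_cmult) auto
  finally show ?thesis .
qed

text \<open>
  On \<open>r \<le> 2 s\<close> the weight \<open>1 / r\<^sup>2\<close> of the energy is at
  least \<open>1 / (4 s\<^sup>2)\<close>.
\<close>
lemma square_mean2_diff_le:
  assumes f: "loc_int f" and s: "s > 0" "2 * s < w"
  shows "(\<integral>\<^sup>+x. ennreal ((mean2 f x s - f x)\<^sup>2) \<partial>lborel) \<le> ennreal (4 * s) * increment_energy w f"
proof -
  have [measurable]: "f \<in> borel_measurable borel" using f by (simp_all add: measurable_primitive loc_int_measurable)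
  have "(\<integral>\<^sup>+r\<in>{0..2 * s}. sq_increment f r \<partial>lborel)
     \<le> (\<integral>\<^sup>+r. ennreal (4 * s\<^sup>2) * (ennreal (1 / r\<^sup>2) * sq_increment f r * indicator {0<..<w} r) \<partial>lborel)"
  proof (rule nn_integral_mono)
    fix r
    have "sq_increment f 0 = 0" by (simp add: sq_increment_def)
    moreover have "1 * sq_increment f r \<le> ennreal (4 * s\<^sup>2) * (ennreal (1 / r\<^sup>2) * sq_increment f r)" if "0 < r" "r \<le> 2 * s"
    proof -
      have "r\<^sup>2 \<le> 4 * s\<^sup>2" using power_mono[of r "2 * s" 2] that by (simp add: power_mult_distrib)
      then have "1 * sq_increment f r \<le> ennreal (4 * s\<^sup>2 * (1 / r\<^sup>2)) * sq_increment f r"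
        using that by (intro mult_right_mono) (auto simp: field_simps)
      also have "\<dots> = ennreal (4 * s\<^sup>2) * (ennreal (1 / r\<^sup>2) * sq_increment f r)"
        by (subst ennreal_mult) (auto simp: mult.assoc)
      finally show ?thesis .
    qed
    ultimately show "sq_increment f r * indicator {0..2 * s} r
        \<le> ennreal (4 * s\<^sup>2) * (ennreal (1 / r\<^sup>2) * sq_increment f r * indicator {0<..<w} r)"
      using s by (cases "r = 0"; cases "0 < r \<and> r \<le> 2 * s")
        (auto simp: indicator_def)
  qed
  also have "\<dots> = ennreal (4 * s\<^sup>2) * increment_energy w f"
    unfolding increment_energy_def by (subst nn_integral_cmult) auto
  finally have "(\<integral>\<^sup>+x. ennreal ((mean2 f x s - f x)\<^sup>2) \<partial>lborel) \<le> ennreal (1 / s) * (ennreal (4 * s\<^sup>2) * increment_energy w f)"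
    by (intro order_trans[OF square_mean2_diff[OF f s(1)]] mult_left_mono) auto
  also have "\<dots> = ennreal (1 / s * (4 * s\<^sup>2)) * increment_energy w f"
    by (subst ennreal_mult) (use s in \<open>auto simp: mult.assoc\<close>)
  also have "1 / s * (4 * s\<^sup>2) = 4 * s" using s by (simp add: power2_eq_square)
  finally show ?thesis .
qed

lemma borel_measurable_fst_snd[measurable]:
  "fst \<in> borel_measurable (borel :: (real \<times> real) measure)"
  "snd \<in> borel_measurable (borel :: (real \<times> real) measure)"
  by (rule borel_measurable_continuous_onI, rule continuous_on_fst[OF continuous_on_id])
    (rule borel_measurable_continuous_onI, rule continuous_on_snd[OF continuous_on_id])

text \<open>Tonelli for a horizontal strip.\<close>
lemma nn_integral_strip:
  assumes [measurable]: "(g :: real \<times> real \<Rightarrow> ennreal) \<in> borel_measurable borel" "J \<in> sets borel"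
  shows "(\<integral>\<^sup>+p. g p * indicator {p. snd p \<in> J} p \<partial>lborel) = (\<integral>\<^sup>+z. (\<integral>\<^sup>+x. g (x, z) \<partial>lborel) * indicator J z \<partial>lborel)"
proof -
  have m: "(\<lambda>p. g p * indicator J (snd p)) \<in> borel_measurable (borel \<Otimes>\<^sub>M borel)"
    unfolding borel_prod by measurable
  have i: "indicator {p. snd p \<in> J} p = (indicator J (snd p) :: ennreal)" for p :: "real \<times> real"
    by (simp add: indicator_def)
  have "(\<integral>\<^sup>+p. g p * indicator {p. snd p \<in> J} p \<partial>lborel) = (\<integral>\<^sup>+p. g p * indicator J (snd p) \<partial>(lborel \<Otimes>\<^sub>M lborel))"
    unfolding lborel_prod i ..
  also have "\<dots> = (\<integral>\<^sup>+z. (\<integral>\<^sup>+x. g (x, z) * indicator J (snd (x, z)) \<partial>lborel) \<partial>lborel)"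
    using m by (intro lborel_pair.nn_integral_snd[symmetric]) (simp cong: measurable_cong_sets)
  also have "\<dots> = (\<integral>\<^sup>+z. (\<integral>\<^sup>+x. g (x, z) \<partial>lborel) * indicator J z \<partial>lborel)"
    unfolding snd_conv by (intro nn_integral_cong nn_integral_multc) measurable
  finally show ?thesis .
qed

lemma measurable_integral_sq_increment:
  assumes [measurable]: "f \<in> borel_measurable borel"
  shows "(\<lambda>s. \<integral>\<^sup>+r\<in>{0..s}. sq_increment f r \<partial>lborel) \<in> borel_measurable borel"
proof -
  have "indicator {0..s} r = (if 0 \<le> r \<and> r \<le> s then 1 else 0 :: ennreal)" for r s :: real
    by (simp add: indicator_def)
  moreover have "(\<lambda>s. \<integral>\<^sup>+r. sq_increment f r * (if 0 \<le> r \<and> r \<le> s then 1 else 0) \<partial>lborel) \<in> borel_measurable borel"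
    by measurable
  ultimately show ?thesis by presburger
qed

text \<open>
  With \<open>\<kappa> = w / h\<close>, the depths \<open>0 < - z < h\<close> correspond to the
  scales \<open>0 < s < w\<close>, so that the means only involve increments that the truncated
  energy sees.
\<close>
lemma lift_energy:
  assumes f: "loc_int f" and "h > 0" "w > 0"
  defines "\<kappa> \<equiv> w / h"
  shows "(\<integral>\<^sup>+p\<in>{p. snd p \<in> {-h<..<0}}. ennreal ((norm (lift_grad \<kappa> f p))\<^sup>2) \<partial>lborel)
    \<le> ennreal ((1 + 2 * \<kappa>\<^sup>2) / \<kappa>) * increment_energy w f"
proof -
  have \<kappa>: "\<kappa> > 0" using \<open>h > 0\<close> \<open>w > 0\<close> by (simp add: \<kappa>_def)
  note [measurable] = loc_int_measurable[OF f] measurable_primitive[OF f]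
    measurable_primitive[OF loc_int_primitive[OF f]]
  have mm[measurable]: "(\<lambda>p. mean2_dx f (fst p) (snd p)) \<in> borel_measurable borel"
    "(\<lambda>p. mean2_ds f (fst p) (snd p)) \<in> borel_measurable borel"
    unfolding mean2_dx_def mean2_ds_def by measurable
  have split: "(\<integral>\<^sup>+s. ennreal (1 / s\<^sup>2) * D s * indicator {0<..<w} s
      + ennreal (\<kappa>\<^sup>2) * (ennreal (4 / s ^ 3) * G s * indicator {0<..<w} s) \<partial>lborel)
    = (\<integral>\<^sup>+s. ennreal (1 / s\<^sup>2) * D s * indicator {0<..<w} s \<partial>lborel)
      + ennreal (\<kappa>\<^sup>2) * (\<integral>\<^sup>+s. ennreal (4 / s ^ 3) * G s * indicator {0<..<w} s \<partial>lborel)"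
    if [measurable]: "D \<in> borel_measurable borel" "G \<in> borel_measurable borel" for D G :: "real \<Rightarrow> ennreal"
    by (simp add: nn_integral_add nn_integral_cmult)
  define H where "H s = (\<integral>\<^sup>+x. ennreal ((mean2_dx f x s)\<^sup>2) \<partial>lborel) +
     ennreal (\<kappa>\<^sup>2) * (\<integral>\<^sup>+x. ennreal ((mean2_ds f x s)\<^sup>2) \<partial>lborel)" for s
  have mH[measurable]: "H \<in> borel_measurable borel"
    unfolding H_def mean2_dx_def mean2_ds_def by measurable
  have n: "ennreal ((norm (lift_grad \<kappa> f (x, z)))\<^sup>2) =
      ennreal ((mean2_dx f x (- \<kappa> * z))\<^sup>2) + ennreal (\<kappa>\<^sup>2) * ennreal ((mean2_ds f x (- \<kappa> * z))\<^sup>2)" for x z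
    by (simp add: lift_grad_def norm_Pair power_mult_distrib ennreal_mult)
  have "(\<integral>\<^sup>+p\<in>{p. snd p \<in> {-h<..<0}}. ennreal ((norm (lift_grad \<kappa> f p))\<^sup>2) \<partial>lborel)
    = (\<integral>\<^sup>+z. (\<integral>\<^sup>+x. ennreal ((norm (lift_grad \<kappa> f (x, z)))\<^sup>2) \<partial>lborel) * indicator {-h<..<0} z \<partial>lborel)"
    by (rule nn_integral_strip) (unfold lift_grad_def mean2_dx_def mean2_ds_def, measurable)
  also have "\<dots> = (\<integral>\<^sup>+z. H (0 + (- \<kappa>) * z) * indicator {0<..<w} (0 + (- \<kappa>) * z) \<partial>lborel)"
  proof (intro nn_integral_cong arg_cong2[where f="(*)"])
    fix z
    show "(\<integral>\<^sup>+x. ennreal ((norm (lift_grad \<kappa> f (x, z)))\<^sup>2) \<partial>lborel) = H (0 + (- \<kappa>) * z)"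
      unfolding n H_def mean2_dx_def mean2_ds_def by (simp add: nn_integral_add nn_integral_cmult)
    have "0 < - \<kappa> * z \<longleftrightarrow> z < 0" using \<kappa> by (simp add: mult_less_0_iff)
    moreover have "w = \<kappa> * h" using \<open>h > 0\<close> by (simp add: \<kappa>_def)
    then have "- \<kappa> * z < w \<longleftrightarrow> - h < z"
      using \<kappa> mult_less_cancel_left_pos[of \<kappa> "- z" h] by simp linarith
    ultimately show "indicator {-h<..<0} z = (indicator {0<..<w} (0 + (- \<kappa>) * z) :: ennreal)"
      by (auto simp: indicator_def)
  qed
  also have "\<dots> = ennreal (1 / \<kappa>) * (ennreal \<kappa> * \<dots>)"
    using \<kappa> by (simp add: mult.assoc[symmetric] flip: ennreal_mult)
  also have "ennreal \<kappa> * (\<integral>\<^sup>+z. H (0 + (- \<kappa>) * z) * indicator {0<..<w} (0 + (- \<kappa>) * z) \<partial>lborel)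
      = (\<integral>\<^sup>+s. H s * indicator {0<..<w} s \<partial>lborel)"
    using \<kappa> by (subst nn_integral_real_affine[of "\<lambda>s. H s * indicator {0<..<w} s" "- \<kappa>" 0]) auto
  finally have energy_H: "(\<integral>\<^sup>+p\<in>{p. snd p \<in> {-h<..<0}}. ennreal ((norm (lift_grad \<kappa> f p))\<^sup>2) \<partial>lborel)
    = ennreal (1 / \<kappa>) * (\<integral>\<^sup>+s. H s * indicator {0<..<w} s \<partial>lborel)" .
  have "(\<integral>\<^sup>+s. H s * indicator {0<..<w} s \<partial>lborel) \<le> (\<integral>\<^sup>+s. ennreal (1 / s\<^sup>2) * sq_increment f s * indicator {0<..<w} s
     + ennreal (\<kappa>\<^sup>2) * (ennreal (4 / s ^ 3) * (\<integral>\<^sup>+r\<in>{0..s}. sq_increment f r \<partial>lborel) * indicator {0<..<w} s) \<partial>lborel)"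
  proof (rule nn_integral_mono)
    fix s
    show "H s * indicator {0<..<w} s \<le> ennreal (1 / s\<^sup>2) * sq_increment f s * indicator {0<..<w} s
     + ennreal (\<kappa>\<^sup>2) * (ennreal (4 / s ^ 3) * (\<integral>\<^sup>+r\<in>{0..s}. sq_increment f r \<partial>lborel) * indicator {0<..<w} s)"
    proof (cases "s \<in> {0<..<w}")
      case True
      then have "H s \<le> ennreal (1 / s\<^sup>2) * sq_increment f s
        + ennreal (\<kappa>\<^sup>2) * (ennreal (4 / s ^ 3) * (\<integral>\<^sup>+r\<in>{0..s}. sq_increment f r \<partial>lborel))"
        unfolding H_def by (intro add_mono mult_left_mono square_mean2_dx square_mean2_ds f) auto
      then show ?thesis using True by simp
    qed simp
  qed
  also have "\<dots> = increment_energy w f + ennreal (\<kappa>\<^sup>2) *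
      (\<integral>\<^sup>+s\<in>{0<..<w}. ennreal (4 / s ^ 3) * (\<integral>\<^sup>+r\<in>{0..s}. sq_increment f r \<partial>lborel) \<partial>lborel)"
    unfolding increment_energy_def
    using loc_int_measurable[OF f]
    by (intro split[of "sq_increment f" "\<lambda>s. \<integral>\<^sup>+r\<in>{0..s}. sq_increment f r \<partial>lborel"]
        measurable_sq_increment measurable_integral_sq_increment)
  also have "\<dots> \<le> increment_energy w f + ennreal (\<kappa>\<^sup>2) * (2 * increment_energy w f)"
    by (intro add_mono mult_left_mono averaged_sq_increment_le) auto
  also have "\<dots> = ennreal (1 + 2 * \<kappa>\<^sup>2) * increment_energy w f"
  proof -
    have "ennreal (1 + 2 * \<kappa>\<^sup>2) = 1 + ennreal (\<kappa>\<^sup>2) * 2"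
      using ennreal_plus[of 1 "\<kappa>\<^sup>2 * 2"] ennreal_mult[of "\<kappa>\<^sup>2" 2] by (simp add: mult.commute)
    then show ?thesis by (simp only: distrib_right mult_1_left mult.assoc)
  qed
  finally have "(\<integral>\<^sup>+p\<in>{p. snd p \<in> {-h<..<0}}. ennreal ((norm (lift_grad \<kappa> f p))\<^sup>2) \<partial>lborel)
    \<le> ennreal (1 / \<kappa>) * (ennreal (1 + 2 * \<kappa>\<^sup>2) * increment_energy w f)"
    unfolding energy_H by (intro mult_left_mono) simp_all
  also have "\<dots> = ennreal (1 / \<kappa> * (1 + 2 * \<kappa>\<^sup>2)) * increment_energy w f"
    by (subst ennreal_mult) (use \<kappa> in \<open>auto simp: mult.assoc\<close>)
  finally show ?thesis by simp
qed

section \<open>Gagliardo energies: folding and the local Poincare inequality\<close>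

lemma gagliardo_mono:
  assumes "A \<subseteq> B" "w \<le> w'"
  shows "gagliardo w A f \<le> gagliardo w' B f"
  unfolding gagliardo_def
  by (intro nn_integral_mono mult_left_mono) (use assms in \<open>auto simp: indicator_def\<close>)

lemma gagliardo_remove_point:
  assumes [measurable]: "f \<in> borel_measurable borel" "A \<in> sets borel"
  shows "gagliardo w A f = gagliardo w (A - {p}) f"
proof -
  have ne: "AE y in lborel. y \<noteq> p"
    by (rule AE_lborel_singleton)
  show ?thesis
    unfolding gagliardo_def
  proof (rule nn_integral_cong_AE)
    show "AE x in lborel. (\<integral>\<^sup>+y. ennreal ((f x - f y)\<^sup>2 / (x - y)\<^sup>2) *
       indicator {(x, y). x \<in> A \<and> y \<in> A \<and> \<bar>x - y\<bar> < w} (x, y) \<partial>lborel) =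
      (\<integral>\<^sup>+y. ennreal ((f x - f y)\<^sup>2 / (x - y)\<^sup>2) *
       indicator {(x, y). x \<in> A - {p} \<and> y \<in> A - {p} \<and> \<bar>x - y\<bar> < w} (x, y) \<partial>lborel)"
      using ne
    proof eventually_elim
      case (elim x)
      show ?case
      proof (rule nn_integral_cong_AE)
        show "AE y in lborel. ennreal ((f x - f y)\<^sup>2 / (x - y)\<^sup>2) *
           indicator {(x, y). x \<in> A \<and> y \<in> A \<and> \<bar>x - y\<bar> < w} (x, y) =
          ennreal ((f x - f y)\<^sup>2 / (x - y)\<^sup>2) *
           indicator {(x, y). x \<in> A - {p} \<and> y \<in> A - {p} \<and> \<bar>x - y\<bar> < w} (x, y)"
          using ne by eventually_elim (use elim in \<open>auto simp: indicator_def\<close>)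
      qed
    qed
  qed
qed

text \<open>
  A map that does not increase distances does not decrease the kernel; the hypothesis
  \<open>push\<close>, applied in each variable, bounds the multiplicity of \<open>R\<close>.
\<close>
lemma gagliardo_comp_le:
  fixes R :: "real \<Rightarrow> real" and c :: ennreal
  assumes [measurable]: "f \<in> borel_measurable borel" "R \<in> borel_measurable borel" "A \<in> sets borel" "B \<in> sets borel"
    and push: "\<And>h. h \<in> borel_measurable borel \<Longrightarrow> (\<integral>\<^sup>+x\<in>A. h (R x) \<partial>lborel) \<le> c * (\<integral>\<^sup>+x\<in>B. h x \<partial>lborel)"
    and lip: "\<And>x y. x \<in> A \<Longrightarrow> y \<in> A \<Longrightarrow> \<bar>R x - R y\<bar> \<le> \<bar>x - y\<bar>"
    and into: "\<And>x. x \<in> A \<Longrightarrow> R x \<in> B"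
  shows "gagliardo w A (\<lambda>x. f (R x)) \<le> c * (c * gagliardo w B f)"
proof -
  define k where "k u v = ennreal ((f u - f v)\<^sup>2 / (u - v)\<^sup>2) * (if u \<in> B \<and> v \<in> B \<and> \<bar>u - v\<bar> < w then 1 else 0)" for u v
  have [measurable]: "(\<lambda>p. k (fst p) (snd p)) \<in> borel_measurable (borel \<Otimes>\<^sub>M borel)"
    unfolding k_def by measurable
  have [measurable]: "k u \<in> borel_measurable borel" for u
    unfolding k_def[abs_def] by measurable
  have gB: "gagliardo w B f = (\<integral>\<^sup>+u. (\<integral>\<^sup>+v. k u v \<partial>lborel) \<partial>lborel)"
    unfolding gagliardo_def k_def by (intro nn_integral_cong) (auto simp: indicator_def)
  have "gagliardo w A (\<lambda>x. f (R x)) \<le> (\<integral>\<^sup>+x\<in>A. (\<integral>\<^sup>+y\<in>A. k (R x) (R y) \<partial>lborel) \<partial>lborel)"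
    unfolding gagliardo_def
  proof (rule nn_integral_mono)
    fix x
    show "(\<integral>\<^sup>+y. ennreal ((f (R x) - f (R y))\<^sup>2 / (x - y)\<^sup>2) *
       indicator {(x, y). x \<in> A \<and> y \<in> A \<and> \<bar>x - y\<bar> < w} (x, y) \<partial>lborel)
      \<le> (\<integral>\<^sup>+y\<in>A. k (R x) (R y) \<partial>lborel) * indicator A x"
    proof (cases "x \<in> A")
      case True
      have "ennreal ((f (R x) - f (R y))\<^sup>2 / (x - y)\<^sup>2) \<le> k (R x) (R y)" if y: "y \<in> A" "\<bar>x - y\<bar> < w" for y
      proof (cases "R x = R y")
        case False
        have l: "\<bar>R x - R y\<bar> \<le> \<bar>x - y\<bar>" using lip True y by blast
        have "(f (R x) - f (R y))\<^sup>2 / (x - y)\<^sup>2 \<le> (f (R x) - f (R y))\<^sup>2 / (R x - R y)\<^sup>2"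
          using l False by (intro divide_left_mono mult_pos_pos) (auto simp: abs_le_square_iff)
        then show ?thesis using l True y into by (auto simp: k_def intro: ennreal_leI)
      qed simp
      then show ?thesis using True
        by (auto intro!: nn_integral_mono simp: indicator_def)
    qed simp
  qed
  also have "\<dots> \<le> (\<integral>\<^sup>+x\<in>A. c * (\<integral>\<^sup>+v. k (R x) v \<partial>lborel) \<partial>lborel)"
  proof (intro nn_integral_mono mult_right_mono)
    fix x
    have "(\<integral>\<^sup>+y\<in>A. k (R x) (R y) \<partial>lborel) \<le> c * (\<integral>\<^sup>+v\<in>B. k (R x) v \<partial>lborel)"
      by (rule push) measurable
    also have "(\<integral>\<^sup>+v\<in>B. k (R x) v \<partial>lborel) = (\<integral>\<^sup>+v. k (R x) v \<partial>lborel)"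
      by (intro nn_integral_cong) (simp add: k_def indicator_def)
    finally show "(\<integral>\<^sup>+y\<in>A. k (R x) (R y) \<partial>lborel) \<le> c * (\<integral>\<^sup>+v. k (R x) v \<partial>lborel)" .
  qed simp
  also have "\<dots> \<le> c * (\<integral>\<^sup>+u\<in>B. c * (\<integral>\<^sup>+v. k u v \<partial>lborel) \<partial>lborel)"
    by (rule push) measurable
  also have "(\<integral>\<^sup>+u\<in>B. c * (\<integral>\<^sup>+v. k u v \<partial>lborel) \<partial>lborel) = (\<integral>\<^sup>+u. c * (\<integral>\<^sup>+v. k u v \<partial>lborel) \<partial>lborel)"
    by (intro nn_integral_cong) (simp add: k_def indicator_def)
  also have "\<dots> = c * gagliardo w B f"
    unfolding gB by (rule nn_integral_cmult) measurable
  finally show ?thesis .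
qed

text \<open>
  The identity part covers \<open>B\<close> once, and the reflected part has Jacobian
  \<open>\<sigma>\<close>.
\<close>
lemma nn_integral_fold_le:
  fixes h :: "real \<Rightarrow> ennreal"
  assumes [measurable]: "h \<in> borel_measurable borel" "B \<in> sets borel" and \<sigma>: "\<sigma> > 0"
    and into: "\<And>x. x \<in> A - B \<Longrightarrow> p - \<sigma> * (x - p) \<in> B"
  shows "(\<integral>\<^sup>+x\<in>A. h (if x \<in> B then x else p - \<sigma> * (x - p)) \<partial>lborel) \<le> ennreal (1 + 1 / \<sigma>) * (\<integral>\<^sup>+x\<in>B. h x \<partial>lborel)"
proof -
  let ?k = "\<lambda>x. h x * indicator B x"
  have "(\<integral>\<^sup>+x\<in>A. h (if x \<in> B then x else p - \<sigma> * (x - p)) \<partial>lborel) \<le> (\<integral>\<^sup>+x. ?k x + ?k ((p + \<sigma> * p) + (- \<sigma>) * x) \<partial>lborel)"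
  proof (rule nn_integral_mono)
    fix x
    have e: "(p + \<sigma> * p) + (- \<sigma>) * x = p - \<sigma> * (x - p)" by (simp add: algebra_simps)
    show "h (if x \<in> B then x else p - \<sigma> * (x - p)) * indicator A x \<le> ?k x + ?k ((p + \<sigma> * p) + (- \<sigma>) * x)"
      unfolding e using into[of x] by (auto simp: indicator_def)
  qed
  also have "\<dots> = (\<integral>\<^sup>+x. ?k x \<partial>lborel) + (\<integral>\<^sup>+x. ?k ((p + \<sigma> * p) + (- \<sigma>) * x) \<partial>lborel)"
    by (rule nn_integral_add) measurable
  also have "(\<integral>\<^sup>+x. ?k ((p + \<sigma> * p) + (- \<sigma>) * x) \<partial>lborel) = ennreal (1 / \<sigma>) * (ennreal \<sigma> * (\<integral>\<^sup>+x. ?k ((p + \<sigma> * p) + (- \<sigma>) * x) \<partial>lborel))"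
    using \<sigma> by (simp add: mult.assoc[symmetric] flip: ennreal_mult)
  also have "ennreal \<sigma> * (\<integral>\<^sup>+x. ?k ((p + \<sigma> * p) + (- \<sigma>) * x) \<partial>lborel) = (\<integral>\<^sup>+x. ?k x \<partial>lborel)"
    using \<sigma> nn_integral_real_affine[of ?k "- \<sigma>" "p + \<sigma> * p"] by simp
  also have "(\<integral>\<^sup>+x. ?k x \<partial>lborel) + ennreal (1 / \<sigma>) * (\<integral>\<^sup>+x. ?k x \<partial>lborel) = ennreal (1 + 1 / \<sigma>) * (\<integral>\<^sup>+x. ?k x \<partial>lborel)"
    using \<sigma> by (subst ennreal_plus) (simp_all add: distrib_right)
  finally show ?thesis .
qed

text \<open>
  The fold is the identity on \<open>B\<close> and a contracted reflection at \<open>p\<close>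
  outside.  A point of \<open>B\<close> and a reflected point are on the same side of
  \<open>p\<close>, so they are not farther from each other than before the reflection.
\<close>
lemma gagliardo_fold_le:
  assumes f[measurable]: "f \<in> borel_measurable borel" and [measurable]: "A \<in> sets borel" "B \<in> sets borel"
    and \<sigma>: "0 < \<sigma>" "\<sigma> \<le> 1"
    and into: "\<And>x. x \<in> A - B \<Longrightarrow> p - \<sigma> * (x - p) \<in> B"
    and sides: "((\<forall>x\<in>B. x \<le> p) \<and> (\<forall>x\<in>A - B. p \<le> x)) \<or> ((\<forall>x\<in>B. p \<le> x) \<and> (\<forall>x\<in>A - B. x \<le> p))"
  shows "gagliardo w A (\<lambda>x. f (if x \<in> B then x else p - \<sigma> * (x - p)))
    \<le> ennreal ((1 + 1 / \<sigma>)\<^sup>2) * gagliardo w B f"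
proof -
  let ?R = "\<lambda>x. if x \<in> B then x else p - \<sigma> * (x - p)"
  have s1: "\<bar>\<sigma> * t\<bar> \<le> \<bar>t\<bar>" for t
    using \<sigma> mult_right_mono[of "\<bar>\<sigma>\<bar>" 1 "\<bar>t\<bar>"] by (simp add: abs_mult)
  have mixed: "\<bar>x - (p - \<sigma> * (y - p))\<bar> \<le> \<bar>x - y\<bar>" if "x \<in> B" "y \<in> A - B" for x y
    using sides
  proof (elim disjE conjE)
    assume "\<forall>x\<in>B. x \<le> p" "\<forall>x\<in>A - B. p \<le> x"
    then have "x \<le> p" "p \<le> y" using that by auto
    moreover have "0 \<le> \<sigma> * (y - p)" "\<sigma> * (y - p) \<le> y - p"
      using \<sigma> calculation by (auto intro: mult_left_le_one_le)
    ultimately show ?thesis by (auto simp: abs_if)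
  next
    assume "\<forall>x\<in>B. p \<le> x" "\<forall>x\<in>A - B. x \<le> p"
    then have "p \<le> x" "y \<le> p" using that by auto
    moreover have "0 \<le> \<sigma> * (p - y)" "\<sigma> * (p - y) \<le> p - y"
      using \<sigma> calculation by (auto intro: mult_left_le_one_le)
    moreover have "\<sigma> * (y - p) = - (\<sigma> * (p - y))" by (simp add: algebra_simps)
    ultimately show ?thesis by (auto simp: abs_if)
  qed
  have "gagliardo w A (\<lambda>x. f (?R x)) \<le> ennreal (1 + 1 / \<sigma>) * (ennreal (1 + 1 / \<sigma>) * gagliardo w B f)"
  proof (rule gagliardo_comp_le)
    fix x y assume "x \<in> A" "y \<in> A"
    then show "\<bar>?R x - ?R y\<bar> \<le> \<bar>x - y\<bar>"
      using mixed[of x y] mixed[of y x] s1[of "x - y"]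
      by (cases "x \<in> B"; cases "y \<in> B") (auto simp: algebra_simps abs_minus_commute)
  qed (use into in \<open>auto intro!: nn_integral_fold_le \<sigma>\<close>)
  also have "\<dots> = ennreal ((1 + 1 / \<sigma>)\<^sup>2) * gagliardo w B f"
    using \<sigma> by (simp add: power2_eq_square ennreal_mult mult.assoc)
  finally show ?thesis .
qed

lemma square_sum_le:
  fixes a :: "nat \<Rightarrow> real"
  shows "(\<Sum>k<n. a k)\<^sup>2 \<le> real n * (\<Sum>k<n. (a k)\<^sup>2)"
  using Cauchy_Schwarz_ineq_sum[of "\<lambda>_. 1" a "{..<n}"] by simp

text \<open>
  To go from \<open>x\<close> to \<open>y\<close>, take \<open>n\<close> equal steps of length
  less than \<open>w\<close>.  With \<open>t = (y - x) / n\<close> as new variable, the step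
  number \<open>k\<close> is a translation by \<open>k t\<close>, and its end points stay in the
  interval by convexity, so each step contributes at most the truncated energy.
\<close>
lemma local_poincare:
  assumes [measurable]: "f \<in> borel_measurable borel" and "a < b" and "w > 0" and n: "b - a \<le> real n * w" 
  shows "(\<integral>\<^sup>+x\<in>{a<..<b}. (\<integral>\<^sup>+y\<in>{a<..<b}. ennreal ((f x - f y)\<^sup>2) \<partial>lborel) \<partial>lborel)
    \<le> ennreal (real n ^ 3 * w\<^sup>2) * gagliardo w {a<..<b} f"
proof -
  have n0: "n > 0" using assms by (cases n) auto
  define J where "J x = (if a < x \<and> x < b then 1 else 0 :: ennreal)" for x
  have [measurable]: "J \<in> borel_measurable borel" unfolding J_def[abs_def] by measurable
  have iJ: "indicator {a<..<b} x = J x" for x by (simp add: J_def indicator_def)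
  define G where "G = (\<integral>\<^sup>+x. (\<integral>\<^sup>+t. ennreal ((f x - f (x + t))\<^sup>2) * J x * J (x + t) * (if \<bar>t\<bar> < w then 1 else 0) \<partial>lborel) \<partial>lborel)"
  have G: "G \<le> ennreal (w\<^sup>2) * gagliardo w {a<..<b} f"
  proof -
    have "G \<le> (\<integral>\<^sup>+x. ennreal (w\<^sup>2) * (\<integral>\<^sup>+y. ennreal ((f x - f y)\<^sup>2 / (x - y)\<^sup>2) *
        indicator {(x, y). x \<in> {a<..<b} \<and> y \<in> {a<..<b} \<and> \<bar>x - y\<bar> < w} (x, y) \<partial>lborel) \<partial>lborel)"
      unfolding G_def
    proof (rule nn_integral_mono)
      fix x
      let ?q = "\<lambda>y. ennreal ((f x - f y)\<^sup>2 / (x - y)\<^sup>2) *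
        (if a < x \<and> x < b \<and> a < y \<and> y < b \<and> \<bar>x - y\<bar> < w then 1 else 0)"
      have mq: "(\<lambda>y. ennreal (w\<^sup>2) * ?q y) \<in> borel_measurable borel" by measurable
      have "(\<integral>\<^sup>+t. ennreal ((f x - f (x + t))\<^sup>2) * J x * J (x + t) * (if \<bar>t\<bar> < w then 1 else 0) \<partial>lborel)
        \<le> (\<integral>\<^sup>+t. ennreal (w\<^sup>2) * ?q (t + x) \<partial>lborel)"
      proof (rule nn_integral_mono)
        fix t
        have "(f x - f (x + t))\<^sup>2 \<le> w\<^sup>2 * ((f x - f (x + t))\<^sup>2 / t\<^sup>2)" if t: "\<bar>t\<bar> < w"
        proof (cases "t = 0")
          case False
          have "t\<^sup>2 \<le> w\<^sup>2" using t by (simp add: abs_le_square_iff[symmetric])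
          then have "t\<^sup>2 * (f x - f (x + t))\<^sup>2 \<le> w\<^sup>2 * (f x - f (x + t))\<^sup>2" by (rule mult_right_mono) simp
          then show ?thesis using False by (simp add: field_simps)
        qed simp
        then show "ennreal ((f x - f (x + t))\<^sup>2) * J x * J (x + t) * (if \<bar>t\<bar> < w then 1 else 0) \<le> ennreal (w\<^sup>2) * ?q (t + x)"
          by (auto simp: J_def add.commute ennreal_mult[symmetric] simp del: times_divide_eq_right intro!: ennreal_leI)
      qed
      also have "\<dots> = (\<integral>\<^sup>+y. ennreal (w\<^sup>2) * ?q y \<partial>lborel)"
        by (rule nn_integral_shift[OF mq])
      also have "\<dots> = ennreal (w\<^sup>2) * (\<integral>\<^sup>+y. ?q y \<partial>lborel)"
        by (rule nn_integral_cmult) measurable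
      also have "(\<integral>\<^sup>+y. ?q y \<partial>lborel) = (\<integral>\<^sup>+y. ennreal ((f x - f y)\<^sup>2 / (x - y)\<^sup>2) *
        indicator {(x, y). x \<in> {a<..<b} \<and> y \<in> {a<..<b} \<and> \<bar>x - y\<bar> < w} (x, y) \<partial>lborel)"
        by (intro nn_integral_cong) (auto simp: indicator_def)
      finally show "(\<integral>\<^sup>+t. ennreal ((f x - f (x + t))\<^sup>2) * J x * J (x + t) * (if \<bar>t\<bar> < w then 1 else 0) \<partial>lborel)
        \<le> ennreal (w\<^sup>2) * (\<integral>\<^sup>+y. ennreal ((f x - f y)\<^sup>2 / (x - y)\<^sup>2) *
        indicator {(x, y). x \<in> {a<..<b} \<and> y \<in> {a<..<b} \<and> \<bar>x - y\<bar> < w} (x, y) \<partial>lborel)" .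
    qed
    also have "\<dots> = ennreal (w\<^sup>2) * gagliardo w {a<..<b} f"
      unfolding gagliardo_def
      by (rule nn_integral_cmult) (simp add: indicator_def case_prod_beta' of_bool_def)
    finally show ?thesis .
  qed
  have step: "(\<integral>\<^sup>+x. (\<integral>\<^sup>+y. J x * J y * ennreal ((f (x + real k * ((y - x) / real n)) - f (x + real (Suc k) * ((y - x) / real n)))\<^sup>2) \<partial>lborel) \<partial>lborel)
    \<le> ennreal (real n) * G" if k: "k < n" for k
  proof -
    let ?F = "\<lambda>x t. J x * J (x + real n * t) * ennreal ((f (x + real k * t) - f (x + real (Suc k) * t))\<^sup>2)"
    have "(\<integral>\<^sup>+y. J x * J y * ennreal ((f (x + real k * ((y - x) / real n)) - f (x + real (Suc k) * ((y - x) / real n)))\<^sup>2) \<partial>lborel)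
      = ennreal (real n) * (\<integral>\<^sup>+t. ?F x t \<partial>lborel)" for x
      by (subst nn_integral_real_affine[where c="real n" and t=x])
        (use n0 in simp_all)
    then have "(\<integral>\<^sup>+x. (\<integral>\<^sup>+y. J x * J y * ennreal ((f (x + real k * ((y - x) / real n)) - f (x + real (Suc k) * ((y - x) / real n)))\<^sup>2) \<partial>lborel) \<partial>lborel)
      = ennreal (real n) * (\<integral>\<^sup>+x. (\<integral>\<^sup>+t. ?F x t \<partial>lborel) \<partial>lborel)"
      by (simp add: nn_integral_cmult)
    moreover
    have s1: "(\<integral>\<^sup>+x. (\<integral>\<^sup>+t. ?F x t \<partial>lborel) \<partial>lborel) = (\<integral>\<^sup>+t. (\<integral>\<^sup>+x. ?F x t \<partial>lborel) \<partial>lborel)"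
      by (subst lborel_pair.Fubini') auto
    have s2: "(\<integral>\<^sup>+t. (\<integral>\<^sup>+x. ?F x t \<partial>lborel) \<partial>lborel)
      \<le> (\<integral>\<^sup>+t. (\<integral>\<^sup>+x. ennreal ((f x - f (x + t))\<^sup>2) * J x * J (x + t) * (if \<bar>t\<bar> < w then 1 else 0) \<partial>lborel) \<partial>lborel)"
    proof (rule nn_integral_mono)
      fix t
      let ?H = "\<lambda>x. ennreal ((f x - f (x + t))\<^sup>2) * J x * J (x + t) * (if \<bar>t\<bar> < w then 1 else 0)"
      have mH: "?H \<in> borel_measurable borel" by measurable
      have "(\<integral>\<^sup>+x. ?F x t \<partial>lborel) \<le> (\<integral>\<^sup>+x. ?H (x + real k * t) \<partial>lborel)"
      proof (rule nn_integral_mono)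
        fix x
        have *: "J (x + real k * t) = 1 \<and> J (x + real k * t + t) = 1 \<and> \<bar>t\<bar> < w" if J1: "J x * J (x + real n * t) \<noteq> 0"
        proof -
          have x: "a < x" "x < b" "a < x + real n * t" "x + real n * t < b"
            using J1 by (auto simp: J_def split: if_splits)
          have conv: "a < x + real m * t \<and> x + real m * t < b" if "m \<le> n" for m
          proof (cases "t \<ge> 0")
            case True
            then have "0 \<le> real m * t" "real m * t \<le> real n * t" using that by (auto intro: mult_right_mono)
            then show ?thesis using x by linarith
          next
            case False
            then have "0 \<ge> real m * t" "real m * t \<ge> real n * t"
              using that by (auto intro: mult_right_mono_neg simp: mult_nonneg_nonpos)
            then show ?thesis using x by linarith
          qed
          have "\<bar>real n * t\<bar> < b - a" using x by (auto simp: abs_if)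
          then have "real n * \<bar>t\<bar> < real n * w" using n by (simp add: abs_mult)
          then have "\<bar>t\<bar> < w" using n0 by simp
          then show ?thesis
            using conv[of k] conv[of "Suc k"] k by (simp add: J_def algebra_simps)
        qed
        moreover have J01: "J x * J (x + real n * t) = 0 \<or> J x * J (x + real n * t) = 1" by (simp add: J_def)
        moreover have e: "x + real (Suc k) * t = x + real k * t + t" by (simp add: algebra_simps)
        ultimately show "?F x t \<le> ?H (x + real k * t)"
        proof (cases "J x * J (x + real n * t) = 0")
          case False
          then have J1: "J x * J (x + real n * t) = 1" using J01 by blast
          from False have H1: "J (x + real k * t) = 1" "J (x + real k * t + t) = 1" "(\<bar>t\<bar> < w) = True"
            using *[OF False] by simp_all
          show ?thesis unfolding e J1 H1 by simp
        next
          case True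
          show ?thesis unfolding True by simp
        qed
      qed
      also have "\<dots> = (\<integral>\<^sup>+x. ?H x \<partial>lborel)"
        by (rule nn_integral_shift[OF mH])
      finally show "(\<integral>\<^sup>+x. ?F x t \<partial>lborel) \<le> (\<integral>\<^sup>+x. ?H x \<partial>lborel)" .
    qed
    have s3: "(\<integral>\<^sup>+t. (\<integral>\<^sup>+x. ennreal ((f x - f (x + t))\<^sup>2) * J x * J (x + t) * (if \<bar>t\<bar> < w then 1 else 0) \<partial>lborel) \<partial>lborel) = G"
      unfolding G_def by (rule lborel_pair.Fubini') measurable
    have "(\<integral>\<^sup>+x. (\<integral>\<^sup>+t. ?F x t \<partial>lborel) \<partial>lborel) \<le> G"
      unfolding s1 using s2 unfolding s3 .
    ultimately show ?thesis by (simp only: mult_left_mono zero_le)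
  qed
  have "(\<integral>\<^sup>+x\<in>{a<..<b}. (\<integral>\<^sup>+y\<in>{a<..<b}. ennreal ((f x - f y)\<^sup>2) \<partial>lborel) \<partial>lborel)
    = (\<integral>\<^sup>+x. (\<integral>\<^sup>+y. J x * J y * ennreal ((f x - f y)\<^sup>2) \<partial>lborel) \<partial>lborel)"
    unfolding iJ by (intro nn_integral_cong, subst nn_integral_multc[symmetric])
      (auto simp: ac_simps)
  also have "\<dots> \<le> (\<integral>\<^sup>+x. (\<integral>\<^sup>+y. (\<Sum>k<n. ennreal (real n) * (J x * J y * ennreal ((f (x + real k * ((y - x) / real n)) - f (x + real (Suc k) * ((y - x) / real n)))\<^sup>2))) \<partial>lborel) \<partial>lborel)"
  proof (intro nn_integral_mono)
    fix x y
    let ?d = "\<lambda>k. f (x + real k * ((y - x) / real n)) - f (x + real (Suc k) * ((y - x) / real n))"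
    have "(\<Sum>k<n. ?d k) = f (x + real 0 * ((y - x) / real n)) - f (x + real n * ((y - x) / real n))"
      by (rule sum_lessThan_telescope'[where f="\<lambda>k. f (x + real k * ((y - x) / real n))"])
    then have "(f x - f y)\<^sup>2 = (\<Sum>k<n. ?d k)\<^sup>2" using n0 by simp
    also have "\<dots> \<le> real n * (\<Sum>k<n. (?d k)\<^sup>2)" by (rule square_sum_le)
    finally have "ennreal ((f x - f y)\<^sup>2) \<le> ennreal (real n * (\<Sum>k<n. (?d k)\<^sup>2))" by (rule ennreal_leI)
    also have "\<dots> = ennreal (real n) * (\<Sum>k<n. ennreal ((?d k)\<^sup>2))"
      by (simp add: ennreal_mult sum_nonneg sum_ennreal)
    finally have "J x * J y * ennreal ((f x - f y)\<^sup>2) \<le> J x * J y * (ennreal (real n) * (\<Sum>k<n. ennreal ((?d k)\<^sup>2)))"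
      by (rule mult_left_mono) simp
    also have "\<dots> = (\<Sum>k<n. ennreal (real n) * (J x * J y * ennreal ((?d k)\<^sup>2)))"
      by (simp only: sum_distrib_left mult.assoc mult.left_commute)
    finally show "J x * J y * ennreal ((f x - f y)\<^sup>2) \<le> (\<Sum>k<n. ennreal (real n) * (J x * J y * ennreal ((?d k)\<^sup>2)))" .
  qed
  also have "\<dots> = (\<Sum>k<n. ennreal (real n) * (\<integral>\<^sup>+x. (\<integral>\<^sup>+y. J x * J y * ennreal ((f (x + real k * ((y - x) / real n)) - f (x + real (Suc k) * ((y - x) / real n)))\<^sup>2) \<partial>lborel) \<partial>lborel))"
  proof -
    have "(\<integral>\<^sup>+x. (\<integral>\<^sup>+y. (\<Sum>k<n. c * F k x y) \<partial>lborel) \<partial>lborel) = (\<Sum>k<n. c * (\<integral>\<^sup>+x. (\<integral>\<^sup>+y. F k x y \<partial>lborel) \<partial>lborel))"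
      if [measurable]: "\<And>k. (\<lambda>(x, y). F k x y) \<in> borel_measurable (borel \<Otimes>\<^sub>M borel)"
      for F :: "nat \<Rightarrow> real \<Rightarrow> real \<Rightarrow> ennreal" and c
      by (simp add: nn_integral_sum nn_integral_cmult)
    from this[of "\<lambda>k x y. J x * J y * ennreal ((f (x + real k * ((y - x) / real n)) - f (x + real (Suc k) * ((y - x) / real n)))\<^sup>2)" "ennreal (real n)"]
    show ?thesis by measurable
  qed
  also have "\<dots> \<le> (\<Sum>k<n. ennreal (real n) * (ennreal (real n) * G))"
    using step by (intro sum_mono mult_left_mono) auto
  also have "\<dots> = ennreal (real n ^ 3) * G"
    by (simp add: ennreal_mult power3_eq_cube mult.assoc ennreal_of_nat_eq_real_of_nat)
  also have "\<dots> \<le> ennreal (real n ^ 3) * (ennreal (w\<^sup>2) * gagliardo w {a<..<b} f)"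
    using G by (rule mult_left_mono) simp
  also have "\<dots> = ennreal (real n ^ 3 * w\<^sup>2) * gagliardo w {a<..<b} f"
    by (simp add: ennreal_mult mult.assoc)
  finally show ?thesis .
qed

lemma average_eq_integral:
  assumes f: "loc_int f" and "u < v"
  shows "average {u<..<v} f = integral {u..v} f / (v - u)"
proof -
  have "set_integrable lebesgue {u..v} f" using f by (simp add: loc_int_def)
  then have "set_integrable lebesgue {u<..<v} f"
    by (rule set_integrable_subset) auto
  then have "(LINT x:{u<..<v}|lebesgue. f x) = integral {u<..<v} f"
    by (rule set_lebesgue_integral_eq_integral)
  also have "\<dots> = integral {u..v} f"
    by (simp add: integral_open_interval_real)
  finally show ?thesis using assms by (simp add: average_def)
qed

lemma loc_int_const: "loc_int (\<lambda>x. c)"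
  by (rule continuous_imp_loc_int) (rule continuous_on_const)

text \<open>Jensen for the square.\<close>
lemma square_dist_average_le:
  assumes f: "loc_int f" and "u < v"
  shows "ennreal ((c - average {u<..<v} f)\<^sup>2)
    \<le> ennreal (1 / (v - u)) * (\<integral>\<^sup>+y\<in>{u<..<v}. ennreal ((c - f y)\<^sup>2) \<partial>lborel)"
proof -
  have [measurable]: "f \<in> borel_measurable borel" using f by (rule loc_int_measurable)
  let ?L = "v - u"
  let ?g = "\<lambda>t. c - f (u + t)"
  have g: "loc_int ?g" by (rule loc_int_diff[OF loc_int_const loc_int_shift[OF f]])
  have "integral {0..?L} ?g = c * ?L - integral {0..?L} (\<lambda>t. f (u + t))"
    using \<open>u < v\<close> by (subst Henstock_Kurzweil_Integration.integral_diff)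
      (simp_all add: loc_int_integrable[OF loc_int_shift[OF f]] integrable_const_ivl)
  also have "integral {0..?L} (\<lambda>t. f (u + t)) = integral {u..v} f"
    using integral_shift_real_ivl[where a=u and b=v and c=u and f=f] by (simp add: add.commute)
  finally have "c - average {u<..<v} f = integral {0..?L} ?g / ?L"
    using \<open>u < v\<close> by (simp add: average_eq_integral[OF assms] field_simps)
  then have "ennreal ((c - average {u<..<v} f)\<^sup>2) = ennreal (1 / ?L\<^sup>2) * ennreal ((integral {0..?L} ?g)\<^sup>2)"
    by (simp add: power_divide flip: ennreal_mult)
  also have "\<dots> \<le> ennreal (1 / ?L\<^sup>2) * (ennreal ?L * (\<integral>\<^sup>+t\<in>{0..?L}. ennreal ((?g t)\<^sup>2) \<partial>lborel))"
    using \<open>u < v\<close> by (intro mult_left_mono square_integral_le g) auto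
  also have "(\<integral>\<^sup>+t\<in>{0..?L}. ennreal ((?g t)\<^sup>2) \<partial>lborel) = (\<integral>\<^sup>+y\<in>{u..v}. ennreal ((c - f y)\<^sup>2) \<partial>lborel)"
  proof -
    have m: "(\<lambda>y. ennreal ((c - f y)\<^sup>2) * indicator {u..v} y) \<in> borel_measurable borel" by measurable
    have "(\<integral>\<^sup>+t\<in>{0..?L}. ennreal ((?g t)\<^sup>2) \<partial>lborel) = (\<integral>\<^sup>+t. ennreal ((c - f (t + u))\<^sup>2) * indicator {u..v} (t + u) \<partial>lborel)"
      by (intro nn_integral_cong) (auto simp: indicator_def add.commute)
    also have "\<dots> = (\<integral>\<^sup>+y\<in>{u..v}. ennreal ((c - f y)\<^sup>2) \<partial>lborel)"
      by (rule nn_integral_shift[OF m])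
    finally show ?thesis .
  qed
  also have "\<dots> = (\<integral>\<^sup>+y\<in>{u<..<v}. ennreal ((c - f y)\<^sup>2) \<partial>lborel)"
  proof (rule nn_integral_cong_AE)
    have "AE y in lborel. y \<noteq> u" "AE y in lborel. y \<noteq> v" by (rule AE_lborel_singleton)+
    then show "AE y in lborel. ennreal ((c - f y)\<^sup>2) * indicator {u..v} y = ennreal ((c - f y)\<^sup>2) * indicator {u<..<v} y"
      by eventually_elim (auto simp: indicator_def)
  qed
  also have "ennreal (1 / ?L\<^sup>2) * (ennreal ?L * (\<integral>\<^sup>+y\<in>{u<..<v}. ennreal ((c - f y)\<^sup>2) \<partial>lborel))
     = ennreal (1 / ?L\<^sup>2 * ?L) * (\<integral>\<^sup>+y\<in>{u<..<v}. ennreal ((c - f y)\<^sup>2) \<partial>lborel)"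
    by (subst ennreal_mult) (use \<open>u < v\<close> in \<open>auto simp: mult.assoc\<close>)
  also have "1 / ?L\<^sup>2 * ?L = 1 / ?L" using \<open>u < v\<close> by (simp add: power2_eq_square)
  finally show ?thesis .
qed

text \<open>
  A constant for the mean square distance to the average over any subinterval, although the
  energy only compares points at distance less than \<open>w\<close>.
\<close>
lemma poincare_average:
  assumes "a \<le> u" "u < v" "v \<le> b" "w > 0"
  obtains C :: real where "C \<ge> 0" "\<And>f. loc_int f \<Longrightarrow>
    (\<integral>\<^sup>+x\<in>{a<..<b}. ennreal ((f x - average {u<..<v} f)\<^sup>2) \<partial>lborel) \<le> ennreal C * gagliardo w {a<..<b} f"
proof -
  \<comment> \<open>The least number of steps that brings the length of a step down to \<open>w\<close>.\<close>
  define n where "n = nat \<lceil>(b - a) / w\<rceil>"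
  have n: "b - a \<le> real n * w"
  proof -
    have "(b - a) / w \<le> real n" unfolding n_def by linarith
    then show ?thesis using \<open>w > 0\<close> by (simp add: field_simps)
  qed
  have "(\<integral>\<^sup>+x\<in>{a<..<b}. ennreal ((f x - average {u<..<v} f)\<^sup>2) \<partial>lborel)
    \<le> ennreal (1 / (v - u) * (real n ^ 3 * w\<^sup>2)) * gagliardo w {a<..<b} f" if f: "loc_int f" for f
  proof -
    have [measurable]: "f \<in> borel_measurable borel" using f by (rule loc_int_measurable)
    have "(\<integral>\<^sup>+x\<in>{a<..<b}. ennreal ((f x - average {u<..<v} f)\<^sup>2) \<partial>lborel)
      \<le> (\<integral>\<^sup>+x\<in>{a<..<b}. ennreal (1 / (v - u)) * (\<integral>\<^sup>+y\<in>{a<..<b}. ennreal ((f x - f y)\<^sup>2) \<partial>lborel) \<partial>lborel)"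
    proof (intro nn_integral_mono mult_right_mono)
      fix x
      have "ennreal ((f x - average {u<..<v} f)\<^sup>2)
        \<le> ennreal (1 / (v - u)) * (\<integral>\<^sup>+y\<in>{u<..<v}. ennreal ((f x - f y)\<^sup>2) \<partial>lborel)"
        using f assms(2) by (rule square_dist_average_le)
      also have "\<dots> \<le> ennreal (1 / (v - u)) * (\<integral>\<^sup>+y\<in>{a<..<b}. ennreal ((f x - f y)\<^sup>2) \<partial>lborel)"
        using assms by (intro mult_left_mono nn_integral_mono) (auto simp: indicator_def)
      finally show "ennreal ((f x - average {u<..<v} f)\<^sup>2)
        \<le> ennreal (1 / (v - u)) * (\<integral>\<^sup>+y\<in>{a<..<b}. ennreal ((f x - f y)\<^sup>2) \<partial>lborel)" .
    qed simp
    also have "\<dots> = ennreal (1 / (v - u)) * (\<integral>\<^sup>+x\<in>{a<..<b}. (\<integral>\<^sup>+y\<in>{a<..<b}. ennreal ((f x - f y)\<^sup>2) \<partial>lborel) \<partial>lborel)"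
      by (simp add: nn_integral_cmult mult.assoc)
    also have "\<dots> \<le> ennreal (1 / (v - u)) * (ennreal (real n ^ 3 * w\<^sup>2) * gagliardo w {a<..<b} f)"
      using assms n by (intro mult_left_mono local_poincare) auto
    also have "\<dots> = ennreal (1 / (v - u) * (real n ^ 3 * w\<^sup>2)) * gagliardo w {a<..<b} f"
      by (subst ennreal_mult) (use assms in \<open>auto simp: mult.assoc\<close>)
    finally show ?thesis .
  qed
  then show ?thesis using that[of "1 / (v - u) * (real n ^ 3 * w\<^sup>2)"] assms by simp
qed

section \<open>Filling a gap between two intervals\<close>

text \<open>
  In the gap, a linear transition from the reflection of the left data at \<open>p\<close> to
  that of the right data at \<open>q\<close>; small \<open>\<sigma>\<close> makes the
  reflections use only data close to the gap.
\<close>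
definition fill_gap :: "real \<Rightarrow> real \<Rightarrow> real \<Rightarrow> (real \<Rightarrow> real) \<Rightarrow> real \<Rightarrow> real" where
  "fill_gap p q \<sigma> f x = (if x \<le> p \<or> q \<le> x then f x
     else (q - x) / (q - p) * f (p - \<sigma> * (x - p)) + (x - p) / (q - p) * f (q - \<sigma> * (x - q)))"

lemma fill_gap_outside: "x \<le> p \<or> q \<le> x \<Longrightarrow> fill_gap p q \<sigma> f x = f x"
  by (simp add: fill_gap_def)

lemma fill_gap_diff: "fill_gap p q \<sigma> (\<lambda>x. f x - g x) = (\<lambda>x. fill_gap p q \<sigma> f x - fill_gap p q \<sigma> g x)"
  by (rule ext) (simp add: fill_gap_def right_diff_distrib)

lemma loc_int_affine:
  assumes f: "loc_int f" and c: "c \<noteq> 0"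
  shows "loc_int (\<lambda>x. f (t + c * x))"
  unfolding loc_int_iff
proof (intro conjI allI)
  have [measurable]: "f \<in> borel_measurable borel" using f by (rule loc_int_measurable)
  show "(\<lambda>x. f (t + c * x)) \<in> borel_measurable borel" by measurable
  fix a b
  let ?l = "min (t + c * a) (t + c * b)" and ?r = "max (t + c * a) (t + c * b)"
  let ?k = "\<lambda>y. ennreal \<bar>f y\<bar> * indicator {?l..?r} y"
  have "(\<integral>\<^sup>+x\<in>{a..b}. ennreal \<bar>f (t + c * x)\<bar> \<partial>lborel) \<le> (\<integral>\<^sup>+x. ?k (t + c * x) \<partial>lborel)"
  proof (rule nn_integral_mono)
    fix x
    have "t + c * x \<in> {?l..?r}" if "x \<in> {a..b}"
      using that mult_left_mono[of a x c] mult_left_mono[of x b c]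
        mult_left_mono_neg[of a x c] mult_left_mono_neg[of x b c]
      by (cases "c \<ge> 0") (auto simp: min_def max_def)
    then show "ennreal \<bar>f (t + c * x)\<bar> * indicator {a..b} x \<le> ?k (t + c * x)"
      by (auto simp: indicator_def)
  qed
  also have "\<dots> = ennreal (1 / \<bar>c\<bar>) * (ennreal \<bar>c\<bar> * (\<integral>\<^sup>+x. ?k (t + c * x) \<partial>lborel))"
    using c by (simp add: mult.assoc[symmetric] flip: ennreal_mult)
  also have "\<dots> = ennreal (1 / \<bar>c\<bar>) * (\<integral>\<^sup>+y. ?k y \<partial>lborel)"
    using c by (subst nn_integral_real_affine[of ?k c t]) auto
  also have "\<dots> < \<infinity>"
    using f by (auto simp: loc_int_iff ennreal_mult_less_top)
  finally show "(\<integral>\<^sup>+x\<in>{a..b}. ennreal \<bar>f (t + c * x)\<bar> \<partial>lborel) < \<infinity>" .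
qed

lemma loc_int_fill_gap:
  assumes f: "loc_int f" and "p < q" "\<sigma> > 0"
  shows "loc_int (fill_gap p q \<sigma> f)"
  unfolding loc_int_iff
proof (intro conjI allI)
  have [measurable]: "f \<in> borel_measurable borel" using f by (rule loc_int_measurable)
  show "fill_gap p q \<sigma> f \<in> borel_measurable borel"
    unfolding fill_gap_def[abs_def] by measurable
  fix a b
  have e: "p - \<sigma> * (x - p) = (p + \<sigma> * p) + (- \<sigma>) * x" "q - \<sigma> * (x - q) = (q + \<sigma> * q) + (- \<sigma>) * x" for x
    by (simp_all add: algebra_simps)
  have l: "loc_int (\<lambda>x. f (p - \<sigma> * (x - p)))" "loc_int (\<lambda>x. f (q - \<sigma> * (x - q)))"
    unfolding e using assms by (intro loc_int_affine[OF f]; simp)+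
  have "(\<integral>\<^sup>+x\<in>{a..b}. ennreal \<bar>fill_gap p q \<sigma> f x\<bar> \<partial>lborel)
    \<le> (\<integral>\<^sup>+x. (ennreal \<bar>f x\<bar> * indicator {a..b} x + ennreal \<bar>f (p - \<sigma> * (x - p))\<bar> * indicator {a..b} x)
       + ennreal \<bar>f (q - \<sigma> * (x - q))\<bar> * indicator {a..b} x \<partial>lborel)"
  proof (rule nn_integral_mono)
    fix x
    have "\<bar>fill_gap p q \<sigma> f x\<bar> \<le> \<bar>f x\<bar> + \<bar>f (p - \<sigma> * (x - p))\<bar> + \<bar>f (q - \<sigma> * (x - q))\<bar>"
    proof (cases "x \<le> p \<or> q \<le> x")
      case False
      have "\<bar>(q - x) / (q - p) * y\<bar> \<le> \<bar>y\<bar>" "\<bar>(x - p) / (q - p) * y\<bar> \<le> \<bar>y\<bar>" for y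
      proof -
        have "\<bar>(q - x) / (q - p)\<bar> \<le> 1" "\<bar>(x - p) / (q - p)\<bar> \<le> 1" using False by auto
        then show "\<bar>(q - x) / (q - p) * y\<bar> \<le> \<bar>y\<bar>" "\<bar>(x - p) / (q - p) * y\<bar> \<le> \<bar>y\<bar>"
          unfolding abs_mult by (intro mult_left_le_one_le; simp)+
      qed
      note b = this
      let ?A = "(q - x) / (q - p) * f (p - \<sigma> * (x - p))" and ?B = "(x - p) / (q - p) * f (q - \<sigma> * (x - q))"
      have "fill_gap p q \<sigma> f x = ?A + ?B" using False by (simp add: fill_gap_def)
      moreover have "\<bar>F\<bar> \<le> c + a + b" if "F = A + B" "\<bar>A\<bar> \<le> a" "\<bar>B\<bar> \<le> b" "0 \<le> c" for F A B a b c :: real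
        using that by linarith
      ultimately show ?thesis using b abs_ge_zero by blast
    qed (simp add: fill_gap_def)
    then have "ennreal \<bar>fill_gap p q \<sigma> f x\<bar> \<le> ennreal \<bar>f x\<bar> + ennreal \<bar>f (p - \<sigma> * (x - p))\<bar> + ennreal \<bar>f (q - \<sigma> * (x - q))\<bar>"
      by (simp add: ennreal_leI flip: ennreal_plus)
    then show "ennreal \<bar>fill_gap p q \<sigma> f x\<bar> * indicator {a..b} x
      \<le> (ennreal \<bar>f x\<bar> * indicator {a..b} x + ennreal \<bar>f (p - \<sigma> * (x - p))\<bar> * indicator {a..b} x)
       + ennreal \<bar>f (q - \<sigma> * (x - q))\<bar> * indicator {a..b} x"
      by (simp add: indicator_def)
  qed
  also have "\<dots> = ((\<integral>\<^sup>+x\<in>{a..b}. ennreal \<bar>f x\<bar> \<partial>lborel) + (\<integral>\<^sup>+x\<in>{a..b}. ennreal \<bar>f (p - \<sigma> * (x - p))\<bar> \<partial>lborel))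
      + (\<integral>\<^sup>+x\<in>{a..b}. ennreal \<bar>f (q - \<sigma> * (x - q))\<bar> \<partial>lborel)"
    by (simp add: nn_integral_add)
  also have "\<dots> < \<infinity>"
    using f l by (auto simp: loc_int_iff)
  finally show "(\<integral>\<^sup>+x\<in>{a..b}. ennreal \<bar>fill_gap p q \<sigma> f x\<bar> \<partial>lborel) < \<infinity>" .
qed

text \<open>
  The case distinction follows the positions of \<open>x \<le> y\<close> relative to the gap; as
  they are closer than its length, they are not on opposite sides of it.  When only one of them
  is in the gap, the data from the far side have there a weight of at most \<open>\<bar>x -
  y\<bar> / (q - p)\<close>, since this weight vanishes at the end of the gap that lies between
  them.
\<close>
lemma fill_gap_increment_le:
  fixes f :: "real \<Rightarrow> real"
  defines "L \<equiv> \<lambda>p \<sigma> x. f (if x \<le> p then x else p - \<sigma> * (x - p))"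
    and "R \<equiv> \<lambda>q \<sigma> x. f (if q \<le> x then x else q - \<sigma> * (x - q))"
  assumes "p < q" "\<bar>x - y\<bar> < q - p"
  shows "(fill_gap p q \<sigma> f x - fill_gap p q \<sigma> f y)\<^sup>2 \<le>
    3 * ((if x < q \<and> y < q then (L p \<sigma> x - L p \<sigma> y)\<^sup>2 else 0) + (if p < x \<and> p < y then (R q \<sigma> x - R q \<sigma> y)\<^sup>2 else 0)
      + ((x - y) / (q - p))\<^sup>2 * ((if p < x \<and> x < q then (L p \<sigma> x - R q \<sigma> x)\<^sup>2 else 0)
        + (if p < y \<and> y < q then (L p \<sigma> y - R q \<sigma> y)\<^sup>2 else 0)))"
    (is "?lhs x y \<le> ?rhs x y")
proof -
  let ?F = "fill_gap p q \<sigma> f" and ?L = "L p \<sigma>" and ?R = "R q \<sigma>"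
  have FL: "?F x = ?L x" if "x \<le> p" for x using that by (simp add: fill_gap_def L_def)
  have FR: "?F x = ?R x" if "q \<le> x" for x using that by (simp add: fill_gap_def R_def)
  have FM: "?F x = (1 - (x - p) / (q - p)) * ?L x + (x - p) / (q - p) * ?R x" if "p < x" "x < q" for x
  proof -
    have "(q - x) / (q - p) = 1 - (x - p) / (q - p)" using \<open>p < q\<close> by (simp add: field_simps)
    then show ?thesis using that by (simp add: fill_gap_def L_def R_def)
  qed
  have tri: "(a + b + c)\<^sup>2 \<le> 3 * (a\<^sup>2 + b\<^sup>2 + c\<^sup>2)" for a b c :: real
  proof -
    have "3 * (a\<^sup>2 + b\<^sup>2 + c\<^sup>2) - (a + b + c)\<^sup>2 = (a - b)\<^sup>2 + (b - c)\<^sup>2 + (a - c)\<^sup>2"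
      by (simp add: power2_eq_square algebra_simps)
    moreover have "0 \<le> (a - b)\<^sup>2 + (b - c)\<^sup>2 + (a - c)\<^sup>2" by simp
    ultimately show ?thesis by linarith
  qed
  have damp: "(t * a)\<^sup>2 \<le> s\<^sup>2 * a\<^sup>2" if "\<bar>t\<bar> \<le> \<bar>s\<bar>" for t s a :: real
    using that by (simp add: power_mult_distrib abs_le_square_iff mult_right_mono)
  have damp1: "(t * a)\<^sup>2 \<le> a\<^sup>2" if "\<bar>t\<bar> \<le> 1" for t a :: real
    using damp[of t 1 a] that by simp
  have main: "?lhs x y \<le> ?rhs x y" if xy: "x \<le> y" "y - x < q - p" for x y
  proof -
    have nn: "0 \<le> ((x - y) / (q - p))\<^sup>2 * z" if "z \<ge> 0" for z using that by simp
    consider "y \<le> p" | "x \<le> p" "p < y" "y < q" | "p < x" "y < q" | "p < x" "x < q" "q \<le> y" | "q \<le> x"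
      using xy by linarith
    then show ?thesis
    proof cases
      case 1
      have "?lhs x y = (?L x - ?L y)\<^sup>2" using 1 xy by (simp add: FL)
      then show ?thesis using 1 xy \<open>p < q\<close> by simp
    next
      case 2
      let ?t = "(y - p) / (q - p)"
      have "?F x - ?F y = (?L x - ?L y) + ?t * (?L y - ?R y) + 0"
        using 2 by (simp add: FL FM algebra_simps)
      then have "?lhs x y \<le> 3 * ((?L x - ?L y)\<^sup>2 + (?t * (?L y - ?R y))\<^sup>2 + 0\<^sup>2)" using tri by metis
      also have "(?t * (?L y - ?R y))\<^sup>2 \<le> ((x - y) / (q - p))\<^sup>2 * (?L y - ?R y)\<^sup>2"
        using 2 by (intro damp) (simp add: divide_right_mono)
      finally show ?thesis using 2 \<open>p < q\<close> by simp
    next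
      case 3
      let ?t = "(x - p) / (q - p)" and ?s = "(y - p) / (q - p)"
      have ts: "?t - ?s = (x - y) / (q - p)" by (simp add: diff_divide_distrib)
      have "?F x - ?F y = (1 - ?t) * (?L x - ?L y) + ?t * (?R x - ?R y) + (?t - ?s) * (?R y - ?L y)"
        using 3 xy by (simp add: FM algebra_simps)
      then have "?lhs x y \<le> 3 * (((1 - ?t) * (?L x - ?L y))\<^sup>2 + (?t * (?R x - ?R y))\<^sup>2 + ((?t - ?s) * (?R y - ?L y))\<^sup>2)"
        using tri by metis
      also have "\<dots> \<le> 3 * ((?L x - ?L y)\<^sup>2 + (?R x - ?R y)\<^sup>2 + ((x - y) / (q - p))\<^sup>2 * (?R y - ?L y)\<^sup>2)"
      proof -
        have "0 \<le> ?t" "?t \<le> 1" using 3 xy \<open>p < q\<close> by (simp_all add: field_simps)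
        then have t: "\<bar>1 - ?t\<bar> \<le> 1" "\<bar>?t\<bar> \<le> 1" by linarith+
        show ?thesis
          unfolding ts by (intro mult_left_mono add_mono damp1 damp t) simp_all
      qed
      also have "(?R y - ?L y)\<^sup>2 = (?L y - ?R y)\<^sup>2" by (rule power2_commute)
      also have "3 * ((?L x - ?L y)\<^sup>2 + (?R x - ?R y)\<^sup>2 + ((x - y) / (q - p))\<^sup>2 * (?L y - ?R y)\<^sup>2) \<le> ?rhs x y"
        using 3 xy nn[of "(?L x - ?R x)\<^sup>2"] by (simp add: distrib_left)
      finally show ?thesis .
    next
      case 4
      let ?t = "(q - x) / (q - p)"
      have t: "(x - p) / (q - p) = 1 - ?t" using \<open>p < q\<close> by (simp add: field_simps)
      have "?F x - ?F y = (?R x - ?R y) + ?t * (?L x - ?R x) + 0"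
        using 4 unfolding FM[OF 4(1,2)] FR[OF 4(3)] t by (simp add: algebra_simps)
      then have "?lhs x y \<le> 3 * ((?R x - ?R y)\<^sup>2 + (?t * (?L x - ?R x))\<^sup>2 + 0\<^sup>2)" using tri by metis
      also have "(?t * (?L x - ?R x))\<^sup>2 \<le> ((x - y) / (q - p))\<^sup>2 * (?L x - ?R x)\<^sup>2"
        using 4 by (intro damp) (simp add: divide_right_mono)
      finally show ?thesis using 4 \<open>p < q\<close> by simp
    next
      case 5
      have "?lhs x y = (?R x - ?R y)\<^sup>2" using 5 xy by (simp add: FR)
      then show ?thesis using 5 xy \<open>p < q\<close> by simp
    qed
  qed
  show ?thesis
  proof (cases "x \<le> y")
    case True
    then show ?thesis using main[of x y] assms by simp
  next
    case False
    have "?lhs y x \<le> ?rhs y x" using main[of y x] False assms by simp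
    moreover have "?lhs y x = ?lhs x y" by (rule power2_commute)
    moreover have "?rhs y x = ?rhs x y"
    proof -
      have e: "(?L y - ?L x)\<^sup>2 = (?L x - ?L y)\<^sup>2" "(?R y - ?R x)\<^sup>2 = (?R x - ?R y)\<^sup>2"
        "((y - x) / (q - p))\<^sup>2 = ((x - y) / (q - p))\<^sup>2"
        by (simp_all add: power_divide power2_commute)
      show ?thesis unfolding e by (simp only: conj_commute add.commute)
    qed
    ultimately show ?thesis by simp
  qed
qed

text \<open>A product of measurable factors in place of the indicator of a relation.\<close>
lemma gagliardo_eq_product:
  assumes "A \<in> sets borel"
  shows "gagliardo w A f = (\<integral>\<^sup>+x. (\<integral>\<^sup>+y. ennreal ((f x - f y)\<^sup>2 / (x - y)\<^sup>2) *
     (indicator A x * indicator A y * (if \<bar>x - y\<bar> < w then 1 else 0)) \<partial>lborel) \<partial>lborel)"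
  unfolding gagliardo_def by (intro nn_integral_cong) (auto simp: indicator_def)

lemma gagliardo_cong:
  assumes "\<And>x. x \<in> A \<Longrightarrow> f x = g x"
  shows "gagliardo w A f = gagliardo w A g"
  unfolding gagliardo_def by (intro nn_integral_cong) (use assms in \<open>auto simp: indicator_def\<close>)

lemma nn_integral_near_diagonal:
  assumes [measurable]: "(g :: real \<Rightarrow> ennreal) \<in> borel_measurable borel" and "w > 0"
  shows "(\<integral>\<^sup>+x. (\<integral>\<^sup>+y. g x * (if \<bar>x - y\<bar> < w then 1 else 0) \<partial>lborel) \<partial>lborel) = ennreal (2 * w) * (\<integral>\<^sup>+x. g x \<partial>lborel)"
    and "(\<integral>\<^sup>+x. (\<integral>\<^sup>+y. g y * (if \<bar>x - y\<bar> < w then 1 else 0) \<partial>lborel) \<partial>lborel) = ennreal (2 * w) * (\<integral>\<^sup>+x. g x \<partial>lborel)"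
proof -
  have i: "(\<integral>\<^sup>+y. g x * (if \<bar>x - y\<bar> < w then 1 else 0) \<partial>lborel) = ennreal (2 * w) * g x" for x
  proof -
    have "(\<integral>\<^sup>+y. g x * (if \<bar>x - y\<bar> < w then 1 else 0) \<partial>lborel) = (\<integral>\<^sup>+y. g x * indicator {x - w<..<x + w} y \<partial>lborel)"
      by (intro nn_integral_cong) (auto simp: indicator_def abs_less_iff)
    also have "\<dots> = g x * ennreal (2 * w)"
      using \<open>w > 0\<close> by (simp add: nn_integral_cmult_indicator)
    finally show ?thesis by (simp add: mult.commute)
  qed
  show 1: "(\<integral>\<^sup>+x. (\<integral>\<^sup>+y. g x * (if \<bar>x - y\<bar> < w then 1 else 0) \<partial>lborel) \<partial>lborel) = ennreal (2 * w) * (\<integral>\<^sup>+x. g x \<partial>lborel)"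
    unfolding i by (rule nn_integral_cmult) measurable
  have "(\<integral>\<^sup>+x. (\<integral>\<^sup>+y. g y * (if \<bar>x - y\<bar> < w then 1 else 0) \<partial>lborel) \<partial>lborel)
      = (\<integral>\<^sup>+y. (\<integral>\<^sup>+x. g y * (if \<bar>x - y\<bar> < w then 1 else 0) \<partial>lborel) \<partial>lborel)"
    by (rule lborel_pair.Fubini') measurable
  also have "\<dots> = (\<integral>\<^sup>+y. (\<integral>\<^sup>+x. g y * (if \<bar>y - x\<bar> < w then 1 else 0) \<partial>lborel) \<partial>lborel)"
    by (simp only: abs_minus_commute)
  finally show "(\<integral>\<^sup>+x. (\<integral>\<^sup>+y. g y * (if \<bar>x - y\<bar> < w then 1 else 0) \<partial>lborel) \<partial>lborel) = ennreal (2 * w) * (\<integral>\<^sup>+x. g x \<partial>lborel)"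
    using 1 by simp
qed

text \<open>
  Divide the increment inequality by \<open>(x - y)\<^sup>2\<close> and integrate; the cross
  term does not depend on one of the variables, which ranges over an interval of length \<open>2
  w\<close>.
\<close>
lemma gagliardo_fill_gap_le:
  fixes f :: "real \<Rightarrow> real" and \<alpha> \<beta> :: ereal and \<sigma> :: real
  assumes [measurable]: "f \<in> borel_measurable borel" and "p < q" "0 < w" "w \<le> q - p"
  defines "L \<equiv> \<lambda>x. f (if x \<le> p then x else p - \<sigma> * (x - p))"
    and "R \<equiv> \<lambda>x. f (if q \<le> x then x else q - \<sigma> * (x - q))"
  shows "gagliardo w (einterval \<alpha> \<beta>) (fill_gap p q \<sigma> f) \<le> 3 * (gagliardo w (einterval \<alpha> q) L + gagliardo w (einterval p \<beta>) R
    + ennreal (4 * w / (q - p)\<^sup>2) * (\<integral>\<^sup>+x\<in>{p<..<q}. ennreal ((L x - R x)\<^sup>2) \<partial>lborel))"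
proof -
  have [measurable]: "L \<in> borel_measurable borel" "R \<in> borel_measurable borel"
    unfolding L_def R_def by measurable
  define g where "g x = ennreal ((L x - R x)\<^sup>2) * indicator {p<..<q} x" for x
  have mg[measurable]: "g \<in> borel_measurable borel" unfolding g_def by measurable
  define N where "N x y = (if \<bar>x - y\<bar> < w then 1 else 0 :: ennreal)" for x y
  have mN[measurable]: "(\<lambda>(x, y). N x y) \<in> borel_measurable (borel \<Otimes>\<^sub>M borel)" unfolding N_def by measurable
  let ?c = "ennreal (1 / (q - p)\<^sup>2)"
  define k1 where "k1 x y = ennreal ((L x - L y)\<^sup>2 / (x - y)\<^sup>2) * (indicator (einterval \<alpha> q) x * indicator (einterval \<alpha> q) y * N x y)" for x y
  define k2 where "k2 x y = ennreal ((R x - R y)\<^sup>2 / (x - y)\<^sup>2) * (indicator (einterval p \<beta>) x * indicator (einterval p \<beta>) y * N x y)" for x y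
  have mk[measurable]: "(\<lambda>(x, y). k1 x y) \<in> borel_measurable (borel \<Otimes>\<^sub>M borel)" "(\<lambda>(x, y). k2 x y) \<in> borel_measurable (borel \<Otimes>\<^sub>M borel)"
    unfolding k1_def k2_def by measurable
  have "gagliardo w (einterval \<alpha> \<beta>) (fill_gap p q \<sigma> f)
    \<le> (\<integral>\<^sup>+x. (\<integral>\<^sup>+y. 3 * (k1 x y + k2 x y + ?c * (g x * N x y + g y * N x y)) \<partial>lborel) \<partial>lborel)"
    unfolding gagliardo_def
  proof (intro nn_integral_mono)
    fix x y
    let ?F = "fill_gap p q \<sigma> f"
    show "ennreal ((?F x - ?F y)\<^sup>2 / (x - y)\<^sup>2) * indicator {(x, y). x \<in> einterval \<alpha> \<beta> \<and> y \<in> einterval \<alpha> \<beta> \<and> \<bar>x - y\<bar> < w} (x, y)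
      \<le> 3 * (k1 x y + k2 x y + ?c * (g x * N x y + g y * N x y))"
    proof (cases "x \<in> einterval \<alpha> \<beta> \<and> y \<in> einterval \<alpha> \<beta> \<and> \<bar>x - y\<bar> < w \<and> x \<noteq> y")
      case True
      then have xy: "x \<in> einterval \<alpha> \<beta>" "y \<in> einterval \<alpha> \<beta>" "\<bar>x - y\<bar> < w" "x \<noteq> y" by auto
      let ?l = "if x < q \<and> y < q then (L x - L y)\<^sup>2 else 0" and ?r = "if p < x \<and> p < y then (R x - R y)\<^sup>2 else 0"
      let ?gx = "if p < x \<and> x < q then (L x - R x)\<^sup>2 else 0" and ?gy = "if p < y \<and> y < q then (L y - R y)\<^sup>2 else 0"
      have "(?F x - ?F y)\<^sup>2 \<le> 3 * (?l + ?r + ((x - y) / (q - p))\<^sup>2 * (?gx + ?gy))"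
        unfolding L_def R_def by (rule fill_gap_increment_le) (use assms xy in auto)
      then have "(?F x - ?F y)\<^sup>2 / (x - y)\<^sup>2 \<le> 3 * (?l + ?r + ((x - y) / (q - p))\<^sup>2 * (?gx + ?gy)) / (x - y)\<^sup>2"
        by (rule divide_right_mono) simp
      also have "\<dots> = 3 * (?l / (x - y)\<^sup>2 + ?r / (x - y)\<^sup>2 + 1 / (q - p)\<^sup>2 * (?gx + ?gy))"
        using xy by (simp add: add_divide_distrib power_divide)
      finally have "ennreal ((?F x - ?F y)\<^sup>2 / (x - y)\<^sup>2) \<le> ennreal (3 * (?l / (x - y)\<^sup>2 + ?r / (x - y)\<^sup>2 + 1 / (q - p)\<^sup>2 * (?gx + ?gy)))"
        by (rule ennreal_leI)
      also have "\<dots> = 3 * (ennreal (?l / (x - y)\<^sup>2) + ennreal (?r / (x - y)\<^sup>2) + ?c * (ennreal ?gx + ennreal ?gy))"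
        by (subst ennreal_mult, simp, simp, subst ennreal_plus, simp, simp, subst ennreal_plus, simp, simp,
            subst ennreal_mult, simp, simp, subst ennreal_plus, simp, simp) simp
      finally have le: "ennreal ((?F x - ?F y)\<^sup>2 / (x - y)\<^sup>2)
        \<le> 3 * (ennreal (?l / (x - y)\<^sup>2) + ennreal (?r / (x - y)\<^sup>2) + ?c * (ennreal ?gx + ennreal ?gy))" .
      have b1: "ennreal (?l / (x - y)\<^sup>2) \<le> k1 x y"
        using xy by (auto simp: k1_def N_def einterval_def indicator_def)
      have b2: "ennreal (?r / (x - y)\<^sup>2) \<le> k2 x y"
        using xy by (auto simp: k2_def N_def einterval_def indicator_def)
      have b3: "ennreal ?gx \<le> g x * N x y" "ennreal ?gy \<le> g y * N x y"
        using xy by (auto simp: g_def N_def)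
      have "3 * (ennreal (?l / (x - y)\<^sup>2) + ennreal (?r / (x - y)\<^sup>2) + ?c * (ennreal ?gx + ennreal ?gy))
        \<le> 3 * (k1 x y + k2 x y + ?c * (g x * N x y + g y * N x y))"
        by (intro mult_left_mono add_mono b1 b2 b3) simp_all
      with le have "ennreal ((?F x - ?F y)\<^sup>2 / (x - y)\<^sup>2) \<le> 3 * (k1 x y + k2 x y + ?c * (g x * N x y + g y * N x y))"
        by (rule order_trans)
      then show ?thesis using xy by (simp only: indicator_def mem_Collect_eq case_prod_conv if_True simp_thms of_bool_eq mult_1_right)
    qed auto
  qed
  also have "\<dots> = 3 * ((\<integral>\<^sup>+x. (\<integral>\<^sup>+y. k1 x y \<partial>lborel) \<partial>lborel) + (\<integral>\<^sup>+x. (\<integral>\<^sup>+y. k2 x y \<partial>lborel) \<partial>lborel)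
      + ?c * ((\<integral>\<^sup>+x. (\<integral>\<^sup>+y. g x * N x y \<partial>lborel) \<partial>lborel) + (\<integral>\<^sup>+x. (\<integral>\<^sup>+y. g y * N x y \<partial>lborel) \<partial>lborel)))"
    by (simp add: nn_integral_add nn_integral_cmult)
  also have "(\<integral>\<^sup>+x. (\<integral>\<^sup>+y. k1 x y \<partial>lborel) \<partial>lborel) = gagliardo w (einterval \<alpha> q) L"
    unfolding k1_def N_def by (rule gagliardo_eq_product[symmetric]) simp
  also have "(\<integral>\<^sup>+x. (\<integral>\<^sup>+y. k2 x y \<partial>lborel) \<partial>lborel) = gagliardo w (einterval p \<beta>) R"
    unfolding k2_def N_def by (rule gagliardo_eq_product[symmetric]) simp
  also have "(\<integral>\<^sup>+x. (\<integral>\<^sup>+y. g x * N x y \<partial>lborel) \<partial>lborel) = ennreal (2 * w) * (\<integral>\<^sup>+x. g x \<partial>lborel)"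
    unfolding N_def using mg \<open>0 < w\<close> by (rule nn_integral_near_diagonal)
  also have "(\<integral>\<^sup>+x. (\<integral>\<^sup>+y. g y * N x y \<partial>lborel) \<partial>lborel) = ennreal (2 * w) * (\<integral>\<^sup>+x. g x \<partial>lborel)"
    unfolding N_def using mg \<open>0 < w\<close> by (rule nn_integral_near_diagonal)
  also have "?c * (ennreal (2 * w) * (\<integral>\<^sup>+x. g x \<partial>lborel) + ennreal (2 * w) * (\<integral>\<^sup>+x. g x \<partial>lborel))
      = ennreal (4 * w / (q - p)\<^sup>2) * (\<integral>\<^sup>+x. g x \<partial>lborel)"
  proof -
    have "ennreal (4 * w / (q - p)\<^sup>2) = ?c * ennreal (2 * w) + ?c * ennreal (2 * w)"
      using \<open>0 < w\<close> by (simp add: ennreal_mult[symmetric] ennreal_plus[symmetric] field_simps del: ennreal_plus)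
    then show ?thesis by (simp only: distrib_left distrib_right mult.assoc)
  qed
  finally show ?thesis unfolding g_def .
qed

lemma nn_integral_reflected_le:
  fixes h :: "real \<Rightarrow> ennreal"
  assumes [measurable]: "h \<in> borel_measurable borel" "B \<in> sets borel" and \<sigma>: "\<sigma> > 0"
    and into: "\<And>x. x \<in> A \<Longrightarrow> p - \<sigma> * (x - p) \<in> B"
  shows "(\<integral>\<^sup>+x\<in>A. h (p - \<sigma> * (x - p)) \<partial>lborel) \<le> ennreal (1 / \<sigma>) * (\<integral>\<^sup>+x\<in>B. h x \<partial>lborel)"
proof -
  let ?k = "\<lambda>x. h x * indicator B x"
  have e: "(p + \<sigma> * p) + (- \<sigma>) * x = p - \<sigma> * (x - p)" for x by (simp add: algebra_simps)
  have "(\<integral>\<^sup>+x\<in>A. h (p - \<sigma> * (x - p)) \<partial>lborel) \<le> (\<integral>\<^sup>+x. ?k ((p + \<sigma> * p) + (- \<sigma>) * x) \<partial>lborel)"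
    unfolding e using into by (intro nn_integral_mono) (auto simp: indicator_def)
  also have "\<dots> = ennreal (1 / \<sigma>) * (ennreal \<sigma> * (\<integral>\<^sup>+x. ?k ((p + \<sigma> * p) + (- \<sigma>) * x) \<partial>lborel))"
    using \<sigma> by (simp add: mult.assoc[symmetric] flip: ennreal_mult)
  also have "ennreal \<sigma> * (\<integral>\<^sup>+x. ?k ((p + \<sigma> * p) + (- \<sigma>) * x) \<partial>lborel) = (\<integral>\<^sup>+x. ?k x \<partial>lborel)"
    using \<sigma> nn_integral_real_affine[of ?k "- \<sigma>" "p + \<sigma> * p"] by simp
  finally show ?thesis .
qed

text \<open>
  The folds bound the energies of the two reflections; the mean square of their difference over
  the gap is bounded through the averages of the two sides and the Poincare inequality, used on
  the bounded intervals \<open>(u, p)\<close> and \<open>(q, v')\<close>.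
\<close>
lemma fill_gap_bounded:
  fixes \<alpha> \<beta> :: ereal
  assumes "\<alpha> \<le> ereal u" "u < v" "v \<le> p" "p < q" "q \<le> u'" "u' < v'" "ereal v' \<le> \<beta>" and w: "0 < w" "w \<le> q - p"
  obtains \<sigma> C :: real where "\<sigma> > 0" "C \<ge> 0" "\<And>f. loc_int f \<Longrightarrow>
    gagliardo w (einterval \<alpha> \<beta>) (fill_gap p q \<sigma> f) \<le> ennreal C * (gagliardo w (einterval \<alpha> p) f
      + gagliardo w (einterval q \<beta>) f + ennreal ((average {u<..<v} f - average {u'<..<v'} f)\<^sup>2))"
proof -
  obtain C1 where C1: "C1 \<ge> 0" "\<And>f. loc_int f \<Longrightarrow>
    (\<integral>\<^sup>+x\<in>{u<..<p}. ennreal ((f x - average {u<..<v} f)\<^sup>2) \<partial>lborel) \<le> ennreal C1 * gagliardo w {u<..<p} f"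
    using poincare_average[of u u v p w] assms by auto
  obtain C2 where C2: "C2 \<ge> 0" "\<And>f. loc_int f \<Longrightarrow>
    (\<integral>\<^sup>+x\<in>{q<..<v'}. ennreal ((f x - average {u'<..<v'} f)\<^sup>2) \<partial>lborel) \<le> ennreal C2 * gagliardo w {q<..<v'} f"
    using poincare_average[of q u' v' v' w] assms by auto
  \<comment> \<open>The reflections map the gap into \<open>(u, p)\<close> and \<open>(q, v')\<close>.\<close>
  define \<sigma> where "\<sigma> = min 1 (min ((p - u) / (q - p)) ((v' - q) / (q - p)))"
  have \<sigma>: "0 < \<sigma>" "\<sigma> \<le> 1" using assms by (auto simp: \<sigma>_def)
  have "\<sigma> \<le> (p - u) / (q - p)" "\<sigma> \<le> (v' - q) / (q - p)" by (auto simp: \<sigma>_def)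
  then have \<sigma>r: "\<sigma> * (q - p) \<le> p - u" "\<sigma> * (q - p) \<le> v' - q" using assms by (simp_all add: field_simps)
  have in1: "u < p - \<sigma> * (x - p)" "p - \<sigma> * (x - p) < p" if "p < x" "x < q" for x
  proof -
    have "\<sigma> * (x - p) < \<sigma> * (q - p)" "0 < \<sigma> * (x - p)" using that \<sigma> by auto
    then show "u < p - \<sigma> * (x - p)" "p - \<sigma> * (x - p) < p" using \<sigma>r by auto
  qed
  have in2: "q < q - \<sigma> * (x - q)" "q - \<sigma> * (x - q) < v'" if "p < x" "x < q" for x
  proof -
    have "\<sigma> * (q - x) < \<sigma> * (q - p)" "0 < \<sigma> * (q - x)" using that \<sigma> by auto
    moreover have "\<sigma> * (x - q) = - (\<sigma> * (q - x))" by (simp add: algebra_simps)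
    ultimately show "q < q - \<sigma> * (x - q)" "q - \<sigma> * (x - q) < v'" using \<sigma>r by auto
  qed
  have \<alpha>p: "\<alpha> < ereal p" using assms by (meson ereal_less_eq(3) le_less_trans less_ereal.simps(1) order_less_le_trans)
  have q\<beta>: "ereal q < \<beta>" using assms by (meson le_less_trans less_ereal.simps(1) order_less_le_trans)
  define K1 where "K1 = (1 + 1 / \<sigma>)\<^sup>2"
  define K2 where "K2 = 4 * w / (q - p)\<^sup>2"
  define C where "C = 3 * (K1 + K2 * 3 * (1 / \<sigma> * (C1 + C2) + (q - p)))"
  have K: "K1 \<ge> 0" "K2 \<ge> 0" using w by (auto simp: K1_def K2_def)
  have C0: "C \<ge> 0" using K \<sigma> C1 C2 \<open>p < q\<close> by (simp add: C_def)
  have "gagliardo w (einterval \<alpha> \<beta>) (fill_gap p q \<sigma> f) \<le> ennreal C * (gagliardo w (einterval \<alpha> p) f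
      + gagliardo w (einterval q \<beta>) f + ennreal ((average {u<..<v} f - average {u'<..<v'} f)\<^sup>2))" if f: "loc_int f" for f
  proof -
    have [measurable]: "f \<in> borel_measurable borel" using f by (rule loc_int_measurable)
    let ?L = "\<lambda>x. f (if x \<le> p then x else p - \<sigma> * (x - p))" and ?R = "\<lambda>x. f (if q \<le> x then x else q - \<sigma> * (x - q))"
    let ?c1 = "average {u<..<v} f" and ?c2 = "average {u'<..<v'} f"
    let ?g1 = "gagliardo w (einterval \<alpha> p) f" and ?g2 = "gagliardo w (einterval q \<beta>) f" and ?d = "ennreal ((?c1 - ?c2)\<^sup>2)"
    have L: "gagliardo w (einterval \<alpha> q) ?L \<le> ennreal K1 * ?g1"
    proof -
      let ?B = "einterval \<alpha> q \<inter> {..p}"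
      have "gagliardo w (einterval \<alpha> q) ?L = gagliardo w (einterval \<alpha> q) (\<lambda>x. f (if x \<in> ?B then x else p - \<sigma> * (x - p)))"
        by (rule gagliardo_cong) auto
      also have "\<dots> \<le> ennreal ((1 + 1 / \<sigma>)\<^sup>2) * gagliardo w ?B f"
      proof (rule gagliardo_fold_le)
        fix x assume "x \<in> einterval \<alpha> q - ?B"
        then have "p < x" "x < q" by (auto simp: einterval_def)
        then have "u < p - \<sigma> * (x - p)" "p - \<sigma> * (x - p) < p" using in1 by auto
        then show "p - \<sigma> * (x - p) \<in> ?B"
          using assms by (auto simp: einterval_def intro: le_less_trans)
      qed (use \<sigma> in auto)
      also have "gagliardo w ?B f = gagliardo w (?B - {p}) f" by (rule gagliardo_remove_point) auto
      also have "?B - {p} = einterval \<alpha> p" using \<open>p < q\<close> by (auto simp: einterval_def intro: less_trans)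
      finally show ?thesis by (simp add: K1_def)
    qed
    have R: "gagliardo w (einterval p \<beta>) ?R \<le> ennreal K1 * ?g2"
    proof -
      let ?B = "einterval p \<beta> \<inter> {q..}"
      have "gagliardo w (einterval p \<beta>) ?R = gagliardo w (einterval p \<beta>) (\<lambda>x. f (if x \<in> ?B then x else q - \<sigma> * (x - q)))"
        by (rule gagliardo_cong) auto
      also have "\<dots> \<le> ennreal ((1 + 1 / \<sigma>)\<^sup>2) * gagliardo w ?B f"
      proof (rule gagliardo_fold_le)
        fix x assume "x \<in> einterval p \<beta> - ?B"
        then have "p < x" "x < q" by (auto simp: einterval_def)
        then have "q < q - \<sigma> * (x - q)" "q - \<sigma> * (x - q) < v'" using in2 by auto
        then show "q - \<sigma> * (x - q) \<in> ?B"
          using assms by (auto simp: einterval_def intro: less_le_trans[of _ "ereal v'"])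
      qed (use \<sigma> in auto)
      also have "gagliardo w ?B f = gagliardo w (?B - {q}) f" by (rule gagliardo_remove_point) auto
      also have "?B - {q} = einterval q \<beta>" using \<open>p < q\<close> by (auto simp: einterval_def)
      finally show ?thesis by (simp add: K1_def)
    qed
    have G: "(\<integral>\<^sup>+x\<in>{p<..<q}. ennreal ((?L x - ?R x)\<^sup>2) \<partial>lborel)
      \<le> 3 * (ennreal (1 / \<sigma>) * (ennreal C1 * ?g1) + ennreal (q - p) * ?d + ennreal (1 / \<sigma>) * (ennreal C2 * ?g2))"
    proof -
      let ?a = "\<lambda>x. ennreal ((f (p - \<sigma> * (x - p)) - ?c1)\<^sup>2)" and ?b = "\<lambda>x. ennreal ((f (q - \<sigma> * (x - q)) - ?c2)\<^sup>2)"
      have "(\<integral>\<^sup>+x\<in>{p<..<q}. ennreal ((?L x - ?R x)\<^sup>2) \<partial>lborel)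
        \<le> (\<integral>\<^sup>+x. 3 * (?a x * indicator {p<..<q} x + ?d * indicator {p<..<q} x + ?b x * indicator {p<..<q} x) \<partial>lborel)"
      proof (rule nn_integral_mono)
        fix x
        have tri: "(a - b)\<^sup>2 \<le> 3 * ((a - c)\<^sup>2 + (c - d)\<^sup>2 + (b - d)\<^sup>2)" for a b c d :: real
        proof -
          have "3 * ((a - c)\<^sup>2 + (c - d)\<^sup>2 + (b - d)\<^sup>2) - (a - b)\<^sup>2
            = ((a - c) - (c - d))\<^sup>2 + ((c - d) - (d - b))\<^sup>2 + ((a - c) - (d - b))\<^sup>2"
            by (simp add: power2_eq_square algebra_simps)
          moreover have "0 \<le> ((a - c) - (c - d))\<^sup>2 + ((c - d) - (d - b))\<^sup>2 + ((a - c) - (d - b))\<^sup>2" by simp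
          ultimately show ?thesis by linarith
        qed
        have "ennreal ((f (p - \<sigma> * (x - p)) - f (q - \<sigma> * (x - q)))\<^sup>2) \<le> 3 * (?a x + ?d + ?b x)"
          using ennreal_leI[OF tri[of "f (p - \<sigma> * (x - p))" "f (q - \<sigma> * (x - q))" ?c1 ?c2]]
          by (simp add: ennreal_mult)
        then show "ennreal ((?L x - ?R x)\<^sup>2) * indicator {p<..<q} x
          \<le> 3 * (?a x * indicator {p<..<q} x + ?d * indicator {p<..<q} x + ?b x * indicator {p<..<q} x)"
          by (auto simp: indicator_def)
      qed
      also have "\<dots> = 3 * ((\<integral>\<^sup>+x\<in>{p<..<q}. ?a x \<partial>lborel) + ?d * ennreal (q - p) + (\<integral>\<^sup>+x\<in>{p<..<q}. ?b x \<partial>lborel))"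
        using \<open>p < q\<close> by (simp add: nn_integral_add nn_integral_cmult nn_integral_cmult_indicator)
      also have "\<dots> \<le> 3 * (ennreal (1 / \<sigma>) * (ennreal C1 * ?g1) + ?d * ennreal (q - p) + ennreal (1 / \<sigma>) * (ennreal C2 * ?g2))"
      proof (intro mult_left_mono add_mono order_refl)
        have "(\<integral>\<^sup>+x\<in>{p<..<q}. ?a x \<partial>lborel) \<le> ennreal (1 / \<sigma>) * (\<integral>\<^sup>+x\<in>{u<..<p}. ennreal ((f x - ?c1)\<^sup>2) \<partial>lborel)"
          by (rule nn_integral_reflected_le[where h="\<lambda>x. ennreal ((f x - ?c1)\<^sup>2)"]) (use \<sigma> in1 in auto)
        also have "\<dots> \<le> ennreal (1 / \<sigma>) * (ennreal C1 * ?g1)"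
          by (intro mult_left_mono order_trans[OF C1(2)[OF f]] gagliardo_mono)
            (use assms in \<open>auto simp: einterval_def intro: le_less_trans\<close>)
        finally show "(\<integral>\<^sup>+x\<in>{p<..<q}. ?a x \<partial>lborel) \<le> ennreal (1 / \<sigma>) * (ennreal C1 * ?g1)" .
        have "(\<integral>\<^sup>+x\<in>{p<..<q}. ?b x \<partial>lborel) \<le> ennreal (1 / \<sigma>) * (\<integral>\<^sup>+x\<in>{q<..<v'}. ennreal ((f x - ?c2)\<^sup>2) \<partial>lborel)"
          by (rule nn_integral_reflected_le[where h="\<lambda>x. ennreal ((f x - ?c2)\<^sup>2)"]) (use \<sigma> in2 in auto)
        also have "\<dots> \<le> ennreal (1 / \<sigma>) * (ennreal C2 * ?g2)"
          by (intro mult_left_mono order_trans[OF C2(2)[OF f]] gagliardo_mono)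
            (use assms in \<open>auto simp: einterval_def intro: less_le_trans[of _ "ereal v'"]\<close>)
        finally show "(\<integral>\<^sup>+x\<in>{p<..<q}. ?b x \<partial>lborel) \<le> ennreal (1 / \<sigma>) * (ennreal C2 * ?g2)" .
      qed (simp_all add: zero_le)
      finally show ?thesis by (simp only: mult.commute[of ?d])
    qed
    let ?T = "?g1 + ?g2 + ?d"
    have T: "?g1 \<le> ?T" "?g2 \<le> ?T" "?d \<le> ?T" by (simp_all add: add_increasing add_increasing2)
    have T12: "?g1 + ?g2 \<le> ?T" by simp
    have "gagliardo w (einterval \<alpha> \<beta>) (fill_gap p q \<sigma> f)
      \<le> 3 * (gagliardo w (einterval \<alpha> q) ?L + gagliardo w (einterval p \<beta>) ?R
        + ennreal K2 * (\<integral>\<^sup>+x\<in>{p<..<q}. ennreal ((?L x - ?R x)\<^sup>2) \<partial>lborel))"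
      unfolding K2_def using assms by (intro gagliardo_fill_gap_le) auto
    also have "\<dots> \<le> 3 * (ennreal K1 * ?g1 + ennreal K1 * ?g2
        + ennreal K2 * (3 * (ennreal (1 / \<sigma>) * (ennreal C1 * ?g1) + ennreal (q - p) * ?d + ennreal (1 / \<sigma>) * (ennreal C2 * ?g2))))"
      by (intro mult_left_mono add_mono L R G) auto
    also have "\<dots> \<le> 3 * (ennreal K1 * ?T
        + ennreal K2 * (3 * (ennreal (1 / \<sigma>) * (ennreal C1 * ?T) + ennreal (q - p) * ?T + ennreal (1 / \<sigma>) * (ennreal C2 * ?T))))"
    proof (intro mult_left_mono add_mono T)
      show "ennreal K1 * ?g1 + ennreal K1 * ?g2 \<le> ennreal K1 * ?T"
        unfolding distrib_left[symmetric] using T12 by (rule mult_left_mono) simp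
    qed auto
    also have "\<dots> = ennreal C * ?T"
    proof -
      have "ennreal C = 3 * (ennreal K1 + ennreal K2 * (3 * (ennreal (1 / \<sigma>) * ennreal C1 + ennreal (q - p) + ennreal (1 / \<sigma>) * ennreal C2)))"
      proof -
        define X where "X = 1 / \<sigma> * C1 + (q - p) + 1 / \<sigma> * C2"
        have "C = 3 * (K1 + K2 * (3 * X))"
          by (simp add: C_def X_def algebra_simps add_divide_distrib)
        moreover have "ennreal X = ennreal (1 / \<sigma>) * ennreal C1 + ennreal (q - p) + ennreal (1 / \<sigma>) * ennreal C2"
          unfolding X_def using \<sigma> C1(1) C2(1) \<open>p < q\<close> by (simp add: ennreal_mult del: times_divide_eq_left)
        moreover have "0 \<le> X" using \<sigma> C1(1) C2(1) \<open>p < q\<close> by (simp add: X_def)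
        then have "ennreal (3 * (K1 + K2 * (3 * X))) = 3 * (ennreal K1 + ennreal K2 * (3 * ennreal X))"
          using K by (subst ennreal_mult, simp, simp, subst ennreal_plus, simp, simp,
            subst ennreal_mult, simp, simp, subst ennreal_mult, simp, simp) (simp only: ennreal_numeral)
        ultimately show ?thesis by (simp only:)
      qed
      moreover have "3 * (a * T + b * (3 * (s * (c * T) + l * T + s * (e * T)))) = (3 * (a + b * (3 * (s * c + l + s * e)))) * T"
        for a b c e l s T :: ennreal
        by (simp only: distrib_left distrib_right mult.assoc)
      ultimately show ?thesis by (simp only:)
    qed
    finally show ?thesis .
  qed
  then show ?thesis using that[OF \<sigma>(1) C0] by blast
qed

section \<open>Borel representatives of functions on the free surface\<close>

lemma gagliardo_diff_le:
  assumes [measurable]: "f \<in> borel_measurable borel" "g \<in> borel_measurable borel" "A \<in> sets borel"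
  shows "gagliardo w A (\<lambda>x. f x - g x) \<le> 2 * gagliardo w A f + 2 * gagliardo w A g"
proof -
  define k where "k f x y = ennreal ((f x - f y)\<^sup>2 / (x - y)\<^sup>2) * (if x \<in> A \<and> y \<in> A \<and> \<bar>x - y\<bar> < w then 1 else 0)"
    for f :: "real \<Rightarrow> real" and x y
  have [measurable]: "(\<lambda>(x, y). k f x y) \<in> borel_measurable (borel \<Otimes>\<^sub>M borel)" "(\<lambda>(x, y). k g x y) \<in> borel_measurable (borel \<Otimes>\<^sub>M borel)"
    unfolding k_def by measurable
  have gk: "gagliardo w A f = (\<integral>\<^sup>+x. (\<integral>\<^sup>+y. k f x y \<partial>lborel) \<partial>lborel)" for f
    unfolding gagliardo_def k_def by (intro nn_integral_cong) (auto simp: indicator_def)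
  have "k (\<lambda>x. f x - g x) x y \<le> 2 * k f x y + 2 * k g x y" for x y
  proof (cases "x \<in> A \<and> y \<in> A \<and> \<bar>x - y\<bar> < w")
    case True
    have "(a - b)\<^sup>2 \<le> 2 * a\<^sup>2 + 2 * b\<^sup>2" for a b :: real
      using zero_le_power2[of "a + b"] by (simp add: power2_eq_square algebra_simps)
    from this[of "f x - f y" "g x - g y"]
    have "((f x - g x) - (f y - g y))\<^sup>2 / (x - y)\<^sup>2 \<le> (2 * (f x - f y)\<^sup>2 + 2 * (g x - g y)\<^sup>2) / (x - y)\<^sup>2"
      by (intro divide_right_mono) (simp_all add: algebra_simps)
    then have "ennreal (((f x - g x) - (f y - g y))\<^sup>2 / (x - y)\<^sup>2)
      \<le> ennreal (2 * ((f x - f y)\<^sup>2 / (x - y)\<^sup>2) + 2 * ((g x - g y)\<^sup>2 / (x - y)\<^sup>2))"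
      by (intro ennreal_leI) (simp add: add_divide_distrib)
    then show ?thesis using True by (simp add: k_def ennreal_mult del: times_divide_eq_right)
  next
    case False
    then have "k (\<lambda>x. f x - g x) x y = 0" unfolding k_def by (simp only: if_False mult_zero_right)
    then show ?thesis by simp
  qed
  then have "gagliardo w A (\<lambda>x. f x - g x) \<le> (\<integral>\<^sup>+x. (\<integral>\<^sup>+y. 2 * k f x y + 2 * k g x y \<partial>lborel) \<partial>lborel)"
    unfolding gk by (intro nn_integral_mono)
  also have "\<dots> = 2 * gagliardo w A f + 2 * gagliardo w A g"
    unfolding gk by (simp add: nn_integral_add nn_integral_cmult)
  finally show ?thesis .
qed

lemma gagliardo_cong_AE:
  assumes "AE x in lborel. x \<in> A \<longrightarrow> f x = g x"
  shows "gagliardo w A f = gagliardo w A g"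
  unfolding gagliardo_def
proof (rule nn_integral_cong_AE)
  show "AE x in lborel. (\<integral>\<^sup>+y. ennreal ((f x - f y)\<^sup>2 / (x - y)\<^sup>2) *
     indicator {(x, y). x \<in> A \<and> y \<in> A \<and> \<bar>x - y\<bar> < w} (x, y) \<partial>lborel) =
    (\<integral>\<^sup>+y. ennreal ((g x - g y)\<^sup>2 / (x - y)\<^sup>2) *
     indicator {(x, y). x \<in> A \<and> y \<in> A \<and> \<bar>x - y\<bar> < w} (x, y) \<partial>lborel)"
    using assms
  proof eventually_elim
    case (elim x)
    show ?case
    proof (rule nn_integral_cong_AE)
      show "AE y in lborel. ennreal ((f x - f y)\<^sup>2 / (x - y)\<^sup>2) *
          indicator {(x, y). x \<in> A \<and> y \<in> A \<and> \<bar>x - y\<bar> < w} (x, y) =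
         ennreal ((g x - g y)\<^sup>2 / (x - y)\<^sup>2) *
          indicator {(x, y). x \<in> A \<and> y \<in> A \<and> \<bar>x - y\<bar> < w} (x, y)"
        using assms by eventually_elim (use elim in \<open>auto simp: indicator_def\<close>)
    qed
  qed
qed

text \<open>
  For bounded \<open>J\<close> the truncation is void as soon as \<open>w\<close> exceeds the
  diameter; for the others \<open>w = 1\<close>.
\<close>
lemma Hhalf_sq_eq_gagliardo:
  obtains w where "w \<ge> 1" "\<And>f. Hhalf_sq J f = gagliardo w J f"
proof (cases "bounded J")
  case True
  then obtain B where B: "\<And>x. x \<in> J \<Longrightarrow> \<bar>x\<bar> \<le> B" by (auto simp: bounded_real)
  define w where "w = max 1 (2 * B + 1)"
  have "\<bar>x - y\<bar> < w" if "x \<in> J" "y \<in> J" for x y using B[OF that(1)] B[OF that(2)] by (auto simp: w_def)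
  then have "Hhalf_sq J f = gagliardo w J f" for f
    unfolding Hhalf_sq_def gagliardo_def nn_integral_completion using True
    by (auto intro!: nn_integral_cong simp: indicator_def power2_commute nn_integral_completion)
  then show ?thesis using that[of w] by (simp add: w_def)
next
  case False
  have "Hhalf_sq J f = gagliardo 1 J f" for f
    unfolding Hhalf_sq_def gagliardo_def nn_integral_completion using False
    by (auto intro!: nn_integral_cong simp: indicator_def power2_commute nn_integral_completion abs_less_iff)
  then show ?thesis using that[of 1] by simp
qed

text \<open>
  Lebesgue measurable functions agree almost everywhere with Borel functions, and null sets
  matter neither for the averages nor for the energies.
\<close>
lemma locally_integrable_imp_loc_int_AE:
  fixes g :: "real \<Rightarrow> real"
  assumes g: "locally_integrable_on g UNIV"
  obtains h where "loc_int h" "AE x in lborel. g x = h x"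
proof -
  have gi: "set_integrable lebesgue {a..b} g" for a b
    using g by (auto simp: locally_integrable_on_def)
  have "g \<in> borel_measurable lebesgue"
  proof (rule borel_measurable_LIMSEQ_real)
    show "(\<lambda>n. indicator {- real n..real n} x * g x) \<longlonglongrightarrow> g x" for x
    proof (rule tendsto_eventually)
      show "\<forall>\<^sub>F n in sequentially. indicator {- real n..real n} x * g x = g x"
        using eventually_ge_at_top[of "nat \<lceil>\<bar>x\<bar>\<rceil>"]
        by eventually_elim (auto simp: indicator_def abs_le_iff nat_le_iff ceiling_le_iff)
    qed
    show "(\<lambda>x. indicator {- real n..real n} x * g x) \<in> borel_measurable lebesgue" for n
      using gi[of "- real n" "real n"] by (simp add: set_integrable_def)
  qed
  then obtain h where h: "h \<in> borel_measurable lborel" "AE x in lborel. g x = h x"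
    using completion_ex_borel_measurable_real by blast
  have "set_integrable lebesgue {a..b} h" for a b
  proof -
    have m: "(\<lambda>x. indicator {a..b} x * h x) \<in> borel_measurable lebesgue"
      using h(1) by (intro measurable_completion) simp
    have "AE x in lebesgue. indicator {a..b} x * g x = indicator {a..b} x * h x"
      using AE_completion[OF h(2)] by eventually_elim simp
    from integrable_cong_AE[OF _ m this] show ?thesis
      using gi[of a b] by (auto simp: set_integrable_def)
  qed
  then have "loc_int h" using h(1) by (simp add: loc_int_def)
  then show ?thesis using that h(2) by blast
qed

lemma average_cong_AE:
  assumes h: "loc_int h" and ae: "AE x in lborel. x \<in> {u<..<v} \<longrightarrow> f x = h x"
  shows "average {u<..<v} f = average {u<..<v} h"
proof -
  have m: "(\<lambda>x. indicator {u<..<v} x *\<^sub>R h x) \<in> borel_measurable lebesgue"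
    using loc_int_measurable[OF h] by (intro measurable_completion) simp
  have eq: "AE x in lebesgue. indicator {u<..<v} x *\<^sub>R h x = indicator {u<..<v} x *\<^sub>R f x"
    using AE_completion[OF ae] by eventually_elim (auto simp: indicator_def)
  have "(\<lambda>x. indicator {u<..<v} x *\<^sub>R f x) \<in> borel_measurable lebesgue"
    by (rule borel_measurable_AE[OF m eq])
  then show ?thesis
    unfolding average_def set_lebesgue_integral_def
    using integral_cong_AE[OF m _ eq] by simp
qed

section \<open>The domain below the free surface\<close>

context curved_polygon
begin

lemma xr_mono: "i \<le> j \<Longrightarrow> j \<le> N \<Longrightarrow> xr i \<le> xr j"
proof (induction j rule: dec_induct)
  case (step n)
  have "xr n < xl (Suc n)" using order_surface[of "Suc n"] step by simp
  also have "xl (Suc n) < xr (Suc n)" using order_object[of "Suc n"] step by simp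
  finally have "xr n \<le> xr (Suc n)" by simp
  moreover have "xr i \<le> xr n" using step by simp
  ultimately show ?case by (rule order_trans[rotated])
qed simp

lemma xl_mono: "i \<le> j \<Longrightarrow> 1 \<le> i \<Longrightarrow> j \<le> N + 1 \<Longrightarrow> xl i \<le> xl j"
proof (induction j rule: dec_induct)
  case (step n)
  have "xl n < xr n" using order_object[of n] step by simp
  also have "xr n < xl (Suc n)" using order_surface[of "Suc n"] step by simp
  finally have "xl n \<le> xl (Suc n)" by simp
  moreover have "xl i \<le> xl n" using step by simp
  ultimately show ?case by (rule order_trans[rotated])
qed simp

lemma finite_vertices:
  assumes "j \<in> {1..N}"
  shows "ereal (real_of_ereal (xl j)) = xl j" "ereal (real_of_ereal (xr j)) = xr j"
proof -
  have "xr (j - 1) < xl j" "xl j < xr j" "xr j < xl (j + 1)"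
    using assms order_surface[of j] order_object[of j] order_surface[of "j + 1"] by auto
  then have "\<bar>xl j\<bar> \<noteq> \<infinity>" "\<bar>xr j\<bar> \<noteq> \<infinity>" by auto
  then show "ereal (real_of_ereal (xl j)) = xl j" "ereal (real_of_ereal (xr j)) = xr j"
    by (simp_all add: ereal_real')
qed

lemma surface_part_outside_gap:
  assumes "j \<in> {1..N+1}" "i \<in> {1..N}" "x \<in> surface_part xl xr j"
  shows "ereal x < xl i \<or> xr i < ereal x"
proof (cases "i < j")
  case True
  have "xr i \<le> xr (j - 1)" using xr_mono[of i "j - 1"] True assms by auto
  then show ?thesis using assms by (auto simp: surface_part_def einterval_def intro: le_less_trans)
next
  case False
  have "xl j \<le> xl i" using xl_mono[of j i] False assms by auto
  then show ?thesis using assms by (auto simp: surface_part_def einterval_def intro: less_le_trans)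
qed

lemma Gamma_D_subset: "Gamma_D N xl xr \<subseteq> einterval (xr 0) (xl (N + 1))"
proof
  fix x assume "x \<in> Gamma_D N xl xr"
  then obtain j where j: "j \<in> {1..N+1}" "xr (j - 1) < ereal x" "ereal x < xl j"
    by (auto simp: Gamma_D_def surface_part_def einterval_def)
  have "xr 0 \<le> xr (j - 1)" "xl j \<le> xl (N + 1)"
    using xr_mono[of 0 "j - 1"] xl_mono[of j "N + 1"] j(1) by auto
  with j(2,3) show "x \<in> einterval (xr 0) (xl (N + 1))"
    by (auto simp: einterval_def intro: le_less_trans less_le_trans)
qed

text \<open>
  The open arc is below the surface, and its end points are vertices, which are end points of
  the open intervals of the surface.
\<close>
lemma arc_avoids_surface:
  assumes "j \<in> {1..N}" "x \<in> Gamma_D N xl xr"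
  shows "(x, 0) \<notin> path_image (\<gamma> j)"
proof
  assume "(x, 0) \<in> path_image (\<gamma> j)"
  then obtain t where t: "t \<in> {0..1}" "\<gamma> j t = (x, 0)" by (auto simp: path_image_def)
  obtain i where i: "i \<in> {1..N+1}" "x \<in> surface_part xl xr i" using assms by (auto simp: Gamma_D_def)
  have "t = 0 \<or> t = 1 \<or> t \<in> {0<..<1}" using t(1) by auto
  moreover have "t \<notin> {0<..<1}" using arc_immersed[OF assms(1), of t] t by auto
  ultimately have "x = real_of_ereal (xl j) \<or> x = real_of_ereal (xr j)"
    using arc_start[OF assms(1)] arc_finish[OF assms(1)] t(2) by (auto simp: pathstart_def pathfinish_def)
  then have "ereal x = xl j \<or> ereal x = xr j" using finite_vertices[OF assms(1)] by auto
  moreover have "xl j < xr j" using order_object[OF assms(1)] .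
  ultimately show False
    using surface_part_outside_gap[OF i(1) assms(1) i(2)] by auto
qed

text \<open>
  The arcs and the part of the bottom over \<open>[c, d]\<close> form a compact set that does
  not meet the segment, so a thin rectangle below the segment avoids the whole frontier.  Being
  connected and near a frontier point, it lies in \<open>\<Omega>\<close>.
\<close>
lemma rectangle_below_surface:
  assumes "c < d" and sub: "{c..d} \<subseteq> Gamma_D N xl xr"
  shows "\<exists>\<delta>>0. {c<..<d} \<times> {-\<delta><..<0} \<subseteq> \<Omega>"
proof -
  let ?K = "{c..d} \<times> {0::real}"
  define C where "C = (\<Union>j\<in>{1..N}. path_image (\<gamma> j)) \<union> (\<lambda>x. (x, b x)) ` {c..d}"
  have inb: "{c..d} \<subseteq> einterval (xr 0) (xl (N + 1))" using sub Gamma_D_subset by blast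
  have "continuous_on (einterval (xr 0) (xl (N + 1))) b"
    using bottom_smooth Ck_on.simps(1) unfolding smooth_on_def by metis
  then have cb: "continuous_on {c..d} b" using inb by (rule continuous_on_subset)
  have "compact (path_image (\<gamma> j))" if "j \<in> {1..N}" for j
    using arc[OF that] by (intro compact_path_image arc_imp_path)
  then have "compact C"
    unfolding C_def using cb by (intro compact_Un compact_UN compact_continuous_image continuous_on_Pair continuous_on_id) auto
  moreover have "?K \<inter> C = {}"
  proof -
    have "b x \<noteq> 0" if "x \<in> {c..d}" for x
    proof
      assume "b x = 0"
      then have "(x, 0) \<in> Gamma_b N xl xr b" using that inb by (force simp: Gamma_b_def)
      moreover have "(x, 0) \<in> Gamma_top N xl xr \<gamma>" using that sub by (auto simp: Gamma_top_def)
      ultimately show False using top_bottom_disjoint by blast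
    qed
    then have "(x, 0) \<notin> C" if "x \<in> {c..d}" for x
      using that arc_avoids_surface[of _ x] sub by (auto simp: C_def)
    then show ?thesis by (simp add: disjoint_iff mem_Times_iff)
  qed
  ultimately have "\<exists>\<delta>>0. \<forall>p\<in>?K. \<forall>q\<in>C. \<delta> \<le> dist p q"
    by (intro separate_compact_closed compact_Times compact_Icc compact_sing compact_imp_closed)
  then obtain \<delta> where \<delta>: "\<delta> > 0" "\<And>p q. p \<in> ?K \<Longrightarrow> q \<in> C \<Longrightarrow> \<delta> \<le> dist p q"
    by blast
  let ?R = "{c<..<d} \<times> {-\<delta><..<0}"
  have RC: "p \<notin> C" if "p \<in> ?R" for p
  proof
    assume "p \<in> C"
    then have "\<delta> \<le> dist (fst p, 0) p" using \<delta>(2)[of "(fst p, 0)" p] that by auto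
    then show False using that by (auto simp: dist_Pair_Pair dist_real_def)
  qed
  have Rf: "?R \<inter> frontier \<Omega> = {}"
  proof (rule equals0I)
    fix p assume "p \<in> ?R \<inter> frontier \<Omega>"
    then have p: "p \<in> ?R" "p \<in> Gamma_top N xl xr \<gamma> \<union> Gamma_b N xl xr b \<union> finite_ends N xl xr"
      using boundary by auto
    have "p \<notin> Gamma_top N xl xr \<gamma>"
    proof
      assume "p \<in> Gamma_top N xl xr \<gamma>"
      then have "\<exists>j\<in>{1..N}. p \<in> \<gamma> j ` {0<..<1}"
        using p(1) by (auto simp: Gamma_top_def vertices_def)
      then obtain j t where jt: "j \<in> {1..N}" "t \<in> {0<..<1}" "p = \<gamma> j t" by blast
      then have "p \<in> path_image (\<gamma> j)" by (auto simp: path_image_def)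
      then have "p \<in> C" using jt(1) unfolding C_def by blast
      then show False using RC[OF p(1)] by blast
    qed
    moreover have "p \<notin> Gamma_b N xl xr b"
    proof
      assume "p \<in> Gamma_b N xl xr b"
      then have "p \<in> C" using p(1) by (auto simp: C_def Gamma_b_def)
      then show False using RC[OF p(1)] by blast
    qed
    moreover have "p \<notin> finite_ends N xl xr" using p(1) by (auto simp: finite_ends_def)
    ultimately show False using p(2) by blast
  qed
  let ?m = "((c + d) / 2, 0)"
  have "(c + d) / 2 \<in> {c..d}" using \<open>c < d\<close> by simp
  then have "(c + d) / 2 \<in> Gamma_D N xl xr" using sub by (rule subsetD[rotated])
  then have "?m \<in> Gamma_top N xl xr \<gamma>" by (simp add: Gamma_top_def)
  then have "?m \<in> closure \<Omega>" using boundary by (auto simp: frontier_def)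
  moreover have "min \<delta> ((d - c) / 2) > 0" using \<delta>(1) \<open>c < d\<close> by simp
  ultimately obtain p where p: "p \<in> \<Omega>" "dist p ?m < min \<delta> ((d - c) / 2)"
    by (meson closure_approachable)
  have "\<bar>fst p - (c + d) / 2\<bar> < (d - c) / 2" "\<bar>snd p\<bar> < \<delta>"
    using p(2) dist_fst_le[of p ?m] dist_snd_le[of p ?m] by (auto simp: dist_real_def)
  moreover have "snd p < 0" using p(1) finite_depth by auto
  ultimately have "p \<in> ?R" by (cases p) (auto simp: abs_less_iff field_simps)
  moreover have "connected ?R" by (intro connected_Times) auto
  ultimately have "?R \<subseteq> \<Omega>"
    using connected_Int_frontier[of ?R \<Omega>] Rf p(1) by blast
  then show ?thesis using \<delta>(1) by blast
qed

end

section \<open>Extending a function on the free surface to the line\<close>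

text \<open>
  A linear operator on \<open>V\<close> that preserves the values on \<open>A\<close>; energy
  bounds are stated separately.
\<close>
definition bounded_extension ::
  "(real \<Rightarrow> real) set \<Rightarrow> real set \<Rightarrow> ((real \<Rightarrow> real) \<Rightarrow> real \<Rightarrow> real) \<Rightarrow> bool" where
  "bounded_extension V A T \<longleftrightarrow> (\<forall>f\<in>V. T f \<in> V \<and> (\<forall>x\<in>A. T f x = f x)) \<and>
     (\<forall>f\<in>V. \<forall>g\<in>V. T (\<lambda>x. f x - g x) = (\<lambda>x. T f x - T g x))"

lemma bounded_extension_comp:
  assumes "bounded_extension V A T" "bounded_extension V B S"
  shows "bounded_extension V (A \<inter> B) (\<lambda>f. S (T f))"
  using assms unfolding bounded_extension_def by simp

lemma bounded_extension_subset:
  "bounded_extension V A T \<Longrightarrow> B \<subseteq> A \<Longrightarrow> bounded_extension V B T"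
  unfolding bounded_extension_def by blast

lemma bounded_extension_fill_gap:
  assumes "p < q" "\<sigma> > 0"
  shows "bounded_extension (Collect loc_int) (- {p<..<q}) (fill_gap p q \<sigma>)"
  unfolding bounded_extension_def
  using assms by (auto simp: loc_int_fill_gap fill_gap_diff fill_gap_outside)

lemma average_diff:
  assumes "loc_int f" "loc_int g" "u < v"
  shows "average {u<..<v} (\<lambda>x. f x - g x) = average {u<..<v} f - average {u<..<v} g"
  using assms by (simp add: average_eq_integral loc_int_diff Henstock_Kurzweil_Integration.integral_diff
      loc_int_integrable diff_divide_distrib)

lemma average_cong:
  assumes "loc_int g" "\<And>x. x \<in> {u<..<v} \<Longrightarrow> f x = g x"
  shows "average {u<..<v} f = average {u<..<v} g"
  by (rule average_cong_AE) (use assms in auto)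

lemma average_const: "u < v \<Longrightarrow> average {u<..<v} (\<lambda>x. c) = c"
  by (simp add: average_eq_integral loc_int_const)

lemma loc_int_glue:
  assumes "loc_int f" "loc_int g" "A \<in> sets borel"
  shows "loc_int (\<lambda>x. if x \<in> A then f x else g x)"
  unfolding loc_int_iff
proof (intro conjI allI)
  have [measurable]: "f \<in> borel_measurable borel" "g \<in> borel_measurable borel" "A \<in> sets borel"
    using assms by (auto simp: loc_int_def)
  show "(\<lambda>x. if x \<in> A then f x else g x) \<in> borel_measurable borel" by measurable
  fix a b
  have "(\<integral>\<^sup>+t\<in>{a..b}. ennreal \<bar>if t \<in> A then f t else g t\<bar> \<partial>lborel)
    \<le> (\<integral>\<^sup>+t. ennreal \<bar>f t\<bar> * indicator {a..b} t + ennreal \<bar>g t\<bar> * indicator {a..b} t \<partial>lborel)"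
    by (intro nn_integral_mono) (auto simp: indicator_def)
  also have "\<dots> = (\<integral>\<^sup>+t\<in>{a..b}. ennreal \<bar>f t\<bar> \<partial>lborel) + (\<integral>\<^sup>+t\<in>{a..b}. ennreal \<bar>g t\<bar> \<partial>lborel)"
    by (rule nn_integral_add) auto
  also have "\<dots> < \<infinity>" using assms by (auto simp: loc_int_iff)
  finally show "(\<integral>\<^sup>+t\<in>{a..b}. ennreal \<bar>if t \<in> A then f t else g t\<bar> \<partial>lborel) < \<infinity>" .
qed

lemma gagliardo_const: "gagliardo w A (\<lambda>x. c) = 0"
  by (simp add: gagliardo_def)

lemma einterval_infinite: "einterval (-\<infinity>) \<infinity> = UNIV"
  by (auto simp: einterval_def)

text \<open>
  At a finite left end \<open>a\<close>, put on \<open>x \<le> a - 1\<close> the average of the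
  function over \<open>(u, v)\<close> and fill the gap \<open>(a - 1, a)\<close>: a constant has
  no energy, and the two averages agree.
\<close>
lemma extend_left:
  fixes \<alpha> \<beta> :: ereal
  assumes "\<alpha> \<le> ereal u" "u < v" "ereal v \<le> \<beta>" "0 < w" "w \<le> 1" "\<alpha> \<noteq> \<infinity>"
  obtains T C where "bounded_extension (Collect loc_int) (einterval \<alpha> \<beta>) T" "C \<ge> 0"
    "\<And>f. loc_int f \<Longrightarrow> gagliardo w (einterval (-\<infinity>) \<beta>) (T f) \<le> ennreal C * gagliardo w (einterval \<alpha> \<beta>) f"
proof (cases "\<alpha> = -\<infinity>")
  case True
  show ?thesis
    by (rule that[of "\<lambda>f. f" 1]) (auto simp: True bounded_extension_def)
next
  case False
  then obtain a where a: "\<alpha> = ereal a" using assms by (cases \<alpha>) auto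
  define S where "S f = (\<lambda>x. if x \<in> {..a - 1} then average {u<..<v} f else f x)" for f :: "real \<Rightarrow> real"
  obtain \<sigma> C where \<sigma>: "\<sigma> > 0" "C \<ge> 0" "\<And>f. loc_int f \<Longrightarrow>
    gagliardo w (einterval (-\<infinity>) \<beta>) (fill_gap (a - 1) a \<sigma> f) \<le> ennreal C * (gagliardo w (einterval (-\<infinity>) (a - 1)) f
      + gagliardo w (einterval a \<beta>) f + ennreal ((average {a - 3<..<a - 2} f - average {u<..<v} f)\<^sup>2))"
    using fill_gap_bounded[of "-\<infinity>" "a - 3" "a - 2" "a - 1" a u v \<beta> w] assms a by auto
  have lS: "loc_int (S f)" if "loc_int f" for f
    unfolding S_def using loc_int_const that by (rule loc_int_glue) simp
  have S: "bounded_extension (Collect loc_int) {a - 1<..} S"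
    unfolding bounded_extension_def using assms(2) lS by (auto simp: S_def average_diff)
  have ext: "bounded_extension (Collect loc_int) (einterval \<alpha> \<beta>) (\<lambda>f. fill_gap (a - 1) a \<sigma> (S f))"
    by (rule bounded_extension_subset[OF bounded_extension_comp[OF S bounded_extension_fill_gap]])
      (use \<sigma> a in \<open>auto simp: einterval_def\<close>)
  have "gagliardo w (einterval (-\<infinity>) \<beta>) (fill_gap (a - 1) a \<sigma> (S f)) \<le> ennreal C * gagliardo w (einterval \<alpha> \<beta>) f"
    if f: "loc_int f" for f
  proof -
    have "gagliardo w (einterval (-\<infinity>) (a - 1)) (S f) = gagliardo w (einterval (-\<infinity>) (a - 1)) (\<lambda>x. average {u<..<v} f)"
      by (rule gagliardo_cong) (auto simp: S_def einterval_def)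
    then have 1: "gagliardo w (einterval (-\<infinity>) (a - 1)) (S f) = 0" by (simp add: gagliardo_const)
    have 2: "gagliardo w (einterval a \<beta>) (S f) = gagliardo w (einterval \<alpha> \<beta>) f"
      unfolding a by (rule gagliardo_cong) (auto simp: S_def einterval_def)
    have 3: "average {u<..<v} (S f) = average {u<..<v} f"
      by (rule average_cong[OF f]) (use assms a in \<open>auto simp: S_def\<close>)
    have "average {a - 3<..<a - 2} (S f) = average {a - 3<..<a - 2} (\<lambda>x. average {u<..<v} f)"
      by (rule average_cong[OF loc_int_const]) (auto simp: S_def)
    then have 4: "average {a - 3<..<a - 2} (S f) = average {u<..<v} f" by (simp add: average_const)
    show ?thesis using \<sigma>(3)[OF lS[OF f]] unfolding 1 2 3 4 by simp
  qed
  then show ?thesis using that[OF ext \<sigma>(2)] by blast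
qed

text \<open>The mirror image of \<open>extend_left\<close>.\<close>
lemma extend_right:
  fixes \<alpha> \<beta> :: ereal
  assumes "\<alpha> \<le> ereal u" "u < v" "ereal v \<le> \<beta>" "0 < w" "w \<le> 1" "\<beta> \<noteq> -\<infinity>"
  obtains T C where "bounded_extension (Collect loc_int) (einterval \<alpha> \<beta>) T" "C \<ge> 0"
    "\<And>f. loc_int f \<Longrightarrow> gagliardo w (einterval \<alpha> \<infinity>) (T f) \<le> ennreal C * gagliardo w (einterval \<alpha> \<beta>) f"
proof (cases "\<beta> = \<infinity>")
  case True
  show ?thesis
    by (rule that[of "\<lambda>f. f" 1]) (auto simp: True bounded_extension_def)
next
  case False
  then obtain a where a: "\<beta> = ereal a" using assms by (cases \<beta>) auto
  define S where "S f = (\<lambda>x. if x \<in> {a + 1..} then average {u<..<v} f else f x)" for f :: "real \<Rightarrow> real"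
  obtain \<sigma> C where \<sigma>: "\<sigma> > 0" "C \<ge> 0" "\<And>f. loc_int f \<Longrightarrow>
    gagliardo w (einterval \<alpha> \<infinity>) (fill_gap a (a + 1) \<sigma> f) \<le> ennreal C * (gagliardo w (einterval \<alpha> a) f
      + gagliardo w (einterval (a + 1) \<infinity>) f + ennreal ((average {u<..<v} f - average {a + 2<..<a + 3} f)\<^sup>2))"
    using fill_gap_bounded[of \<alpha> u v a "a + 1" "a + 2" "a + 3" \<infinity> w] assms a by auto
  have lS: "loc_int (S f)" if "loc_int f" for f
    unfolding S_def using loc_int_const that by (rule loc_int_glue) simp
  have S: "bounded_extension (Collect loc_int) {..<a + 1} S"
    unfolding bounded_extension_def using assms(2) lS by (auto simp: S_def average_diff)
  have ext: "bounded_extension (Collect loc_int) (einterval \<alpha> \<beta>) (\<lambda>f. fill_gap a (a + 1) \<sigma> (S f))"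
    by (rule bounded_extension_subset[OF bounded_extension_comp[OF S bounded_extension_fill_gap]])
      (use \<sigma> a in \<open>auto simp: einterval_def\<close>)
  have "gagliardo w (einterval \<alpha> \<infinity>) (fill_gap a (a + 1) \<sigma> (S f)) \<le> ennreal C * gagliardo w (einterval \<alpha> \<beta>) f"
    if f: "loc_int f" for f
  proof -
    have "gagliardo w (einterval (a + 1) \<infinity>) (S f) = gagliardo w (einterval (a + 1) \<infinity>) (\<lambda>x. average {u<..<v} f)"
      by (rule gagliardo_cong) (auto simp: S_def einterval_def)
    then have 1: "gagliardo w (einterval (a + 1) \<infinity>) (S f) = 0" by (simp add: gagliardo_const)
    have 2: "gagliardo w (einterval \<alpha> a) (S f) = gagliardo w (einterval \<alpha> \<beta>) f"
      unfolding a by (rule gagliardo_cong) (auto simp: S_def einterval_def)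
    have 3: "average {u<..<v} (S f) = average {u<..<v} f"
      by (rule average_cong[OF f]) (use assms a in \<open>auto simp: S_def\<close>)
    have "average {a + 2<..<a + 3} (S f) = average {a + 2<..<a + 3} (\<lambda>x. average {u<..<v} f)"
      by (rule average_cong[OF loc_int_const]) (auto simp: S_def)
    then have 4: "average {a + 2<..<a + 3} (S f) = average {u<..<v} f" by (simp add: average_const)
    show ?thesis using \<sigma>(3)[OF lS[OF f]] unfolding 1 2 3 4 by simp
  qed
  then show ?thesis using that[OF ext \<sigma>(2)] by blast
qed

context curved_polygon
begin

text \<open>
  By induction, after \<open>k\<close> gaps the function is extended to an interval.  The values
  on the averaging intervals have not changed, so the averages on both sides of the next gap are
  still those of \<open>f\<close>.
\<close>
lemma extend_over_gaps:
  fixes u v :: "nat \<Rightarrow> real"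
  assumes uv: "\<And>j. j \<in> {1..N+1} \<Longrightarrow> u j < v j" "\<And>j. j \<in> {1..N+1} \<Longrightarrow> {u j<..<v j} \<subseteq> surface_part xl xr j"
    and bounds: "\<And>j. j \<in> {1..N+1} \<Longrightarrow> xr (j - 1) \<le> ereal (u j) \<and> ereal (v j) \<le> xl j"
    and w: "0 < w" "\<And>j. j \<in> {1..N} \<Longrightarrow> w \<le> real_of_ereal (xr j) - real_of_ereal (xl j)"
    and k: "k \<le> N"
  shows "\<exists>T C. bounded_extension (Collect loc_int) (Gamma_D N xl xr) T \<and> C \<ge> 0 \<and>
    (\<forall>f. loc_int f \<longrightarrow> gagliardo w (einterval (xr 0) (xl (k + 1))) (T f)
      \<le> ennreal C * ((\<Sum>j=1..k+1. gagliardo w (surface_part xl xr j) f) +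
         (\<Sum>j=1..k. ennreal ((average {u j<..<v j} f - average {u (j+1)<..<v (j+1)} f)\<^sup>2))))"
  using k
proof (induction k)
  case 0
  have "bounded_extension (Collect loc_int) (Gamma_D N xl xr) (\<lambda>f. f)"
    by (auto simp: bounded_extension_def)
  then show ?case
    by (intro exI[of _ "\<lambda>f. f"] exI[of _ 1]) (simp add: surface_part_def)
next
  case (Suc k)
  from Suc.IH[OF Suc_leD[OF Suc.prems]]
  obtain T C where T: "bounded_extension (Collect loc_int) (Gamma_D N xl xr) T" "C \<ge> 0"
    "\<And>f. loc_int f \<Longrightarrow> gagliardo w (einterval (xr 0) (xl (k + 1))) (T f)
      \<le> ennreal C * ((\<Sum>j=1..k+1. gagliardo w (surface_part xl xr j) f) +
         (\<Sum>j=1..k. ennreal ((average {u j<..<v j} f - average {u (j+1)<..<v (j+1)} f)\<^sup>2)))"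
    by (elim exE conjE) blast
  let ?j = "Suc k"
  have j: "?j \<in> {1..N}" using Suc.prems by simp
  define p where "p = real_of_ereal (xl ?j)"
  define q where "q = real_of_ereal (xr ?j)"
  have pq: "ereal p = xl ?j" "ereal q = xr ?j" using finite_vertices[OF j] by (simp_all add: p_def q_def)
  have "ereal p < ereal q" using order_object[OF j] pq by simp
  then have "p < q" by simp
  have b1: "xr k \<le> ereal (u ?j)" "ereal (v ?j) \<le> ereal p"
    using bounds[of ?j] j pq by auto
  have b2: "ereal q \<le> ereal (u (Suc ?j))" "ereal (v (Suc ?j)) \<le> xl (Suc ?j)"
    using bounds[of "Suc ?j"] j pq by auto
  have "xr 0 \<le> xr k" using xr_mono[of 0 k] Suc.prems by simp
  then have "xr 0 \<le> ereal (u ?j)" using b1(1) by (rule order_trans)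
  moreover have "u ?j < v ?j" "u (Suc ?j) < v (Suc ?j)" using uv(1) j by auto
  ultimately obtain \<sigma> C' where \<sigma>: "\<sigma> > 0" "C' \<ge> 0" "\<And>f. loc_int f \<Longrightarrow>
    gagliardo w (einterval (xr 0) (xl (Suc ?j))) (fill_gap p q \<sigma> f) \<le> ennreal C' * (gagliardo w (einterval (xr 0) p) f
      + gagliardo w (einterval q (xl (Suc ?j))) f
      + ennreal ((average {u ?j<..<v ?j} f - average {u (Suc ?j)<..<v (Suc ?j)} f)\<^sup>2))"
    using fill_gap_bounded[of "xr 0" "u ?j" "v ?j" p q "u (Suc ?j)" "v (Suc ?j)" "xl (Suc ?j)" w]
      b1 b2 \<open>p < q\<close> w(1) w(2)[OF j] by (auto simp: p_def q_def)
  have "Gamma_D N xl xr \<subseteq> - {p<..<q}"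
  proof
    fix x assume "x \<in> Gamma_D N xl xr"
    then obtain i where "i \<in> {1..N+1}" "x \<in> surface_part xl xr i" by (auto simp: Gamma_D_def)
    then have "ereal x < ereal p \<or> ereal q < ereal x" unfolding pq using surface_part_outside_gap j by blast
    then show "x \<in> - {p<..<q}" by auto
  qed
  then have ext: "bounded_extension (Collect loc_int) (Gamma_D N xl xr) (\<lambda>f. fill_gap p q \<sigma> (T f))"
    by (intro bounded_extension_subset[OF bounded_extension_comp[OF T(1) bounded_extension_fill_gap[OF \<open>p < q\<close> \<sigma>(1)]]]) auto
  have "gagliardo w (einterval (xr 0) (xl (Suc k + 1))) (fill_gap p q \<sigma> (T f))
    \<le> ennreal (C' * (C + 1)) * ((\<Sum>j=1..Suc k+1. gagliardo w (surface_part xl xr j) f) +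
         (\<Sum>j=1..Suc k. ennreal ((average {u j<..<v j} f - average {u (j+1)<..<v (j+1)} f)\<^sup>2)))"
    if f: "loc_int f" for f
  proof -
    have lT: "loc_int (T f)" and Tf: "\<And>x. x \<in> Gamma_D N xl xr \<Longrightarrow> T f x = f x"
      using T(1) f by (auto simp: bounded_extension_def)
    have TS: "T f x = f x" if "i \<in> {1..N+1}" "x \<in> surface_part xl xr i" for i x
      using that by (intro Tf) (auto simp: Gamma_D_def)
    have g2: "gagliardo w (einterval q (xl (Suc ?j))) (T f) = gagliardo w (surface_part xl xr (Suc ?j)) f"
      unfolding surface_part_def pq diff_Suc_1
      by (rule gagliardo_cong) (use TS[of "Suc ?j"] j in \<open>auto simp: surface_part_def\<close>)
    have av: "average {u i<..<v i} (T f) = average {u i<..<v i} f" if "i \<in> {1..N+1}" for i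
      by (rule average_cong[OF f]) (use TS[OF that] uv(2)[OF that] in auto)
    have a1: "average {u ?j<..<v ?j} (T f) = average {u ?j<..<v ?j} f"
      "average {u (Suc ?j)<..<v (Suc ?j)} (T f) = average {u (Suc ?j)<..<v (Suc ?j)} f"
      using j by (auto intro!: av)
    define Gk where "Gk = (\<Sum>j=1..k+1. gagliardo w (surface_part xl xr j) f)"
    define Dk where "Dk = (\<Sum>j=1..k. ennreal ((average {u j<..<v j} f - average {u (j+1)<..<v (j+1)} f)\<^sup>2))"
    define g d where "g = gagliardo w (surface_part xl xr (Suc ?j)) f"
      and "d = ennreal ((average {u ?j<..<v ?j} f - average {u (Suc ?j)<..<v (Suc ?j)} f)\<^sup>2)"
    have "gagliardo w (einterval (xr 0) (xl (Suc ?j))) (fill_gap p q \<sigma> (T f))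
      \<le> ennreal C' * (gagliardo w (einterval (xr 0) p) (T f) + g + d)"
      using \<sigma>(3)[OF lT] by (simp add: g2 a1 g_def d_def)
    also have "\<dots> \<le> ennreal C' * (ennreal C * (Gk + Dk) + g + d)"
      using T(3)[OF f] by (intro mult_left_mono add_mono order_refl) (simp_all add: pq Gk_def Dk_def)
    also have "\<dots> \<le> ennreal C' * (ennreal (C + 1) * ((Gk + g) + (Dk + d)))"
    proof (rule mult_left_mono)
      have "ennreal C * (Gk + Dk) + (g + d) \<le> (ennreal C * ((Gk + Dk) + (g + d))) + ((Gk + Dk) + (g + d))"
      proof (rule add_mono[OF mult_left_mono])
        show "Gk + Dk \<le> (Gk + Dk) + (g + d)" by (rule add_increasing2) simp_all
        show "g + d \<le> (Gk + Dk) + (g + d)" by (rule add_increasing) simp_all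
      qed simp
      also have "\<dots> = ennreal (C + 1) * ((Gk + g) + (Dk + d))"
        using \<open>C \<ge> 0\<close> by (simp add: distrib_right distrib_left add_ac)
      finally show "ennreal C * (Gk + Dk) + g + d \<le> ennreal (C + 1) * ((Gk + g) + (Dk + d))"
        by (simp add: add.assoc)
    qed simp
    also have "\<dots> = ennreal (C' * (C + 1)) * ((Gk + g) + (Dk + d))"
      using \<open>C \<ge> 0\<close> \<sigma>(2) by (subst ennreal_mult) (auto simp: mult.assoc)
    finally show ?thesis by (simp add: Gk_def Dk_def g_def d_def)
  qed
  moreover have "C' * (C + 1) \<ge> 0" using \<open>C \<ge> 0\<close> \<sigma>(2) by simp
  ultimately show ?case using ext by blast
qed

end

section \<open>Vertical translations in the mean square\<close>

text \<open>
  By Scheffe the squared norms converge in mean, and \<open>\<bar>F - f\<bar>\<^sup>2 \<le> 4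
  \<bar>f\<bar>\<^sup>2 + 2 \<bar>\<bar>F\<bar>\<^sup>2 - \<bar>f\<bar>\<^sup>2\<bar>\<close>:
  the excess over the last term is dominated.
\<close>
lemma L2_convergence_from_norms:
  fixes f :: "'a \<Rightarrow> 'b::euclidean_space"
  assumes [measurable]: "\<And>n. F n \<in> borel_measurable M" "f \<in> borel_measurable M"
    and lim: "AE x in M. (\<lambda>n. F n x) \<longlonglongrightarrow> f x"
    and fin: "(\<integral>\<^sup>+x. ennreal ((norm (f x))\<^sup>2) \<partial>M) < \<infinity>" "\<And>n. (\<integral>\<^sup>+x. ennreal ((norm (F n x))\<^sup>2) \<partial>M) < \<infinity>"
    and norms: "(\<lambda>n. \<integral>\<^sup>+x. ennreal ((norm (F n x))\<^sup>2) \<partial>M) \<longlonglongrightarrow> (\<integral>\<^sup>+x. ennreal ((norm (f x))\<^sup>2) \<partial>M)"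
  shows "(\<lambda>n. \<integral>\<^sup>+x. ennreal ((norm (F n x - f x))\<^sup>2) \<partial>M) \<longlonglongrightarrow> 0"
proof -
  let ?e = "\<lambda>n x. norm ((norm (F n x))\<^sup>2 - (norm (f x))\<^sup>2)"
  have e: "(\<lambda>n. \<integral>\<^sup>+x. ?e n x \<partial>M) \<longlonglongrightarrow> 0"
  proof (rule Scheffe_lemma1)
    show "integrable M (\<lambda>x. (norm (F n x))\<^sup>2)" for n
      using fin(2)[of n] by (intro integrableI_bounded) auto
    show "integrable M (\<lambda>x. (norm (f x))\<^sup>2)"
      using fin(1) by (intro integrableI_bounded) auto
    show "AE x in M. (\<lambda>n. (norm (F n x))\<^sup>2) \<longlonglongrightarrow> (norm (f x))\<^sup>2"
      using lim by eventually_elim (intro tendsto_intros)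
    show "limsup (\<lambda>n. \<integral>\<^sup>+ x. norm ((norm (F n x))\<^sup>2) \<partial>M) \<le> (\<integral>\<^sup>+ x. norm ((norm (f x))\<^sup>2) \<partial>M)"
      using lim_imp_Limsup[OF _ norms] by simp
  qed
  \<comment> \<open>The part of the error that the convergence of the norms does not control.\<close>
  let ?k = "\<lambda>n x. max 0 ((norm (F n x - f x))\<^sup>2 - 2 * ?e n x)"
  have k: "(\<lambda>n. \<integral>\<^sup>+x. ennreal (?k n x) \<partial>M) \<longlonglongrightarrow> (\<integral>\<^sup>+x. 0 \<partial>M)"
  proof (rule nn_integral_dominated_convergence[where w="\<lambda>x. 4 * ennreal ((norm (f x))\<^sup>2)"])
    show "(\<integral>\<^sup>+x. 4 * ennreal ((norm (f x))\<^sup>2) \<partial>M) < \<infinity>"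
      using fin(1) by (simp add: nn_integral_cmult ennreal_mult_less_top)
    show "AE x in M. ennreal (?k n x) \<le> 4 * ennreal ((norm (f x))\<^sup>2)" for n
    proof (rule AE_I2)
      fix x
      have "(norm (F n x - f x))\<^sup>2 \<le> (norm (F n x) + norm (f x))\<^sup>2"
        by (intro power_mono norm_triangle_ineq4) simp
      also have "\<dots> \<le> 2 * (norm (F n x))\<^sup>2 + 2 * (norm (f x))\<^sup>2"
        using zero_le_power2[of "norm (F n x) - norm (f x)"] by (simp add: power2_eq_square algebra_simps)
      finally have le: "(norm (F n x - f x))\<^sup>2 \<le> 2 * (norm (F n x))\<^sup>2 + 2 * (norm (f x))\<^sup>2" .
      have "(norm (F n x - f x))\<^sup>2 - 2 * ?e n x \<le> 4 * (norm (f x))\<^sup>2"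
      proof -
        have "x - 2 * \<bar>a - b\<bar> \<le> 4 * b" if "x \<le> 2 * a + 2 * b" for x a b :: real using that by (cases "a \<le> b") auto
        from this[OF le] show ?thesis unfolding real_norm_def .
      qed
      then have "?k n x \<le> 4 * (norm (f x))\<^sup>2" by simp
      then have "ennreal (?k n x) \<le> ennreal (4 * (norm (f x))\<^sup>2)" by (rule ennreal_leI)
      then show "ennreal (?k n x) \<le> 4 * ennreal ((norm (f x))\<^sup>2)" by (simp add: ennreal_mult)
    qed
    show "AE x in M. (\<lambda>n. ennreal (?k n x)) \<longlonglongrightarrow> 0"
      using lim
    proof eventually_elim
      case (elim x)
      have "(\<lambda>n. ?k n x) \<longlonglongrightarrow> max 0 ((norm (f x - f x))\<^sup>2 - 2 * norm ((norm (f x))\<^sup>2 - (norm (f x))\<^sup>2))"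
        by (intro tendsto_intros elim)
      then have "(\<lambda>n. ?k n x) \<longlonglongrightarrow> 0" by simp
      from tendsto_ennrealI[OF this] show ?case by simp
    qed
  qed auto
  have "(\<lambda>n. (\<integral>\<^sup>+x. ennreal (?k n x) \<partial>M) + 2 * (\<integral>\<^sup>+x. ?e n x \<partial>M)) \<longlonglongrightarrow> 0 + 2 * 0"
    using k e by (intro tendsto_add ennreal_tendsto_cmult) auto
  then have up: "(\<lambda>n. (\<integral>\<^sup>+x. ennreal (?k n x) \<partial>M) + 2 * (\<integral>\<^sup>+x. ?e n x \<partial>M)) \<longlonglongrightarrow> 0" by simp
  have le: "(\<integral>\<^sup>+x. ennreal ((norm (F n x - f x))\<^sup>2) \<partial>M) \<le> (\<integral>\<^sup>+x. ennreal (?k n x) \<partial>M) + 2 * (\<integral>\<^sup>+x. ?e n x \<partial>M)" for n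
  proof -
    have "(\<integral>\<^sup>+x. ennreal ((norm (F n x - f x))\<^sup>2) \<partial>M) \<le> (\<integral>\<^sup>+x. ennreal (?k n x) + 2 * ennreal (?e n x) \<partial>M)"
    proof (rule nn_integral_mono)
      fix x
      have "ennreal ((norm (F n x - f x))\<^sup>2) \<le> ennreal (?k n x + 2 * ?e n x)" by (rule ennreal_leI) simp
      also have "\<dots> = ennreal (?k n x) + 2 * ennreal (?e n x)"
        by (subst ennreal_plus) (simp_all add: ennreal_mult)
      finally show "ennreal ((norm (F n x - f x))\<^sup>2) \<le> ennreal (?k n x) + 2 * ennreal (?e n x)" .
    qed
    also have "\<dots> = (\<integral>\<^sup>+x. ennreal (?k n x) \<partial>M) + 2 * (\<integral>\<^sup>+x. ?e n x \<partial>M)"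
      by (subst nn_integral_add) (simp_all add: nn_integral_cmult)
    finally show ?thesis .
  qed
  show ?thesis
    by (rule tendsto_sandwich[OF _ _ tendsto_const up]) (use le in auto)
qed

lemma nn_integral_translate:
  fixes g :: "'a::euclidean_space \<Rightarrow> ennreal"
  assumes [measurable]: "g \<in> borel_measurable borel"
  shows "(\<integral>\<^sup>+p. g (c + p) \<partial>lborel) = (\<integral>\<^sup>+p. g p \<partial>lborel)"
proof -
  have "(\<integral>\<^sup>+p. g p \<partial>lborel) = (\<integral>\<^sup>+p. g p \<partial>distr lborel borel ((+) c))" by (simp only: lborel_distr_plus)
  also have "\<dots> = (\<integral>\<^sup>+p. g (c + p) \<partial>lborel)" by (rule nn_integral_distr) auto
  finally show ?thesis by simp
qed

lemma AE_snd_neq: "AE p in (lborel :: (real \<times> real) measure). snd p \<noteq> c"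
proof -
  have "negligible {p :: real \<times> real. p \<bullet> (0, 1) = c}"
    by (rule negligible_standard_hyperplane) (simp add: Basis_prod_def)
  moreover have "{p :: real \<times> real. p \<bullet> (0, 1) = c} = {p. snd p = c}" by (auto simp: inner_prod_def)
  ultimately have "{p :: real \<times> real. snd p = c} \<in> null_sets lebesgue"
    by (simp add: negligible_iff_null_sets)
  then have "AE p in (lebesgue :: (real \<times> real) measure). snd p \<noteq> c"
    using AE_not_in by fastforce
  then show ?thesis by (simp add: AE_completion_iff)
qed

text \<open>
  Translates of a continuous function converge pointwise, and the norm of a translate is the
  norm over the translated rectangle, which converges too.  The rectangle of height \<open>2
  \<delta>\<close> contains all the translated ones.
\<close>
lemma vertical_shift_tendsto_L2:
  fixes g :: "real \<times> real \<Rightarrow> 'b::euclidean_space"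
  assumes cont: "continuous_on {p. snd p < 0} g" and \<delta>: "\<delta> > 0"
    and fin: "(\<integral>\<^sup>+p\<in>{c<..<d} \<times> {-2 * \<delta><..<0}. ennreal ((norm (g p))\<^sup>2) \<partial>lborel) < \<infinity>"
    and \<epsilon>: "\<And>n. 0 < \<epsilon> n" "\<And>n. \<epsilon> n < \<delta>" "\<epsilon> \<longlonglongrightarrow> 0"
  shows "(\<integral>\<^sup>+p\<in>{c<..<d} \<times> {-\<delta><..<0}. ennreal ((norm (g (fst p, snd p - \<epsilon> n)))\<^sup>2) \<partial>lborel) < \<infinity>"
    and "(\<lambda>n. \<integral>\<^sup>+p\<in>{c<..<d} \<times> {-\<delta><..<0}. ennreal ((norm (g (fst p, snd p - \<epsilon> n) - g p))\<^sup>2) \<partial>lborel) \<longlonglongrightarrow> 0"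
proof -
  let ?H = "{p :: real \<times> real. snd p < 0}" and ?R = "{c<..<d} \<times> {-\<delta><..<0}" and ?Q = "{c<..<d} \<times> {-2 * \<delta><..<0}"
  have [measurable]: "?H \<in> sets borel" "?R \<in> sets borel" "?Q \<in> sets borel"
    by (auto intro!: borel_open open_Times open_Collect_less continuous_intros)
  define g0 where "g0 p = indicator ?H p *\<^sub>R g p" for p
  have mg0[measurable]: "g0 \<in> borel_measurable borel"
    unfolding g0_def using cont by (intro borel_measurable_continuous_on_indicator) auto
  define F where "F n p = indicator ?R p *\<^sub>R g0 ((0, - \<epsilon> n) + p)" for n p
  define f where "f p = indicator ?R p *\<^sub>R g0 p" for p
  define q where "q p = ennreal ((norm (g0 p))\<^sup>2) * indicator ?Q p" for p
  have mq: "q \<in> borel_measurable borel" unfolding q_def by measurable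
  have q: "(\<integral>\<^sup>+p. q p \<partial>lborel) < \<infinity>"
  proof -
    have "(\<integral>\<^sup>+p. q p \<partial>lborel) = (\<integral>\<^sup>+p\<in>?Q. ennreal ((norm (g p))\<^sup>2) \<partial>lborel)"
      by (intro nn_integral_cong) (auto simp: q_def g0_def indicator_def)
    then show ?thesis using fin by simp
  qed
  let ?Rn = "\<lambda>n. (\<lambda>p. (0, \<epsilon> n) + p) -` ?R"
  have mRn[measurable]: "?Rn n \<in> sets borel" for n
    using measurable_sets[of "\<lambda>p. (0, \<epsilon> n) + p" borel borel ?R] by simp
  have RnQ: "?Rn n \<subseteq> ?Q" for n using \<epsilon>(1,2)[of n] by (auto simp: less_le_not_le)
  have nF: "(\<integral>\<^sup>+p. ennreal ((norm (F n p))\<^sup>2) \<partial>lborel) = (\<integral>\<^sup>+p. q p * indicator (?Rn n) p \<partial>lborel)" for n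
  proof -
    have "(\<integral>\<^sup>+p. ennreal ((norm (F n p))\<^sup>2) \<partial>lborel)
      = (\<integral>\<^sup>+p. ennreal ((norm (F n ((0, \<epsilon> n) + p)))\<^sup>2) \<partial>lborel)"
      by (rule nn_integral_translate[symmetric]) (unfold F_def, measurable)
    also have "\<dots> = (\<integral>\<^sup>+p. q p * indicator (?Rn n) p \<partial>lborel)"
    proof (rule nn_integral_cong)
      fix p :: "real \<times> real"
      have "(0, - \<epsilon> n) + ((0, \<epsilon> n) + p) = p" by (cases p) simp
      then show "ennreal ((norm (F n ((0, \<epsilon> n) + p)))\<^sup>2) = q p * indicator (?Rn n) p"
        using RnQ[of n] by (auto simp: F_def q_def indicator_def)
    qed
    finally show ?thesis .
  qed
  have nf: "(\<integral>\<^sup>+p. ennreal ((norm (f p))\<^sup>2) \<partial>lborel) = (\<integral>\<^sup>+p. q p * indicator ?R p \<partial>lborel)"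
    using \<delta> by (intro nn_integral_cong) (auto simp: f_def q_def indicator_def)
  have finF: "(\<integral>\<^sup>+p. ennreal ((norm (F n p))\<^sup>2) \<partial>lborel) < \<infinity>" for n
  proof -
    have "(\<integral>\<^sup>+p. q p * indicator (?Rn n) p \<partial>lborel) \<le> (\<integral>\<^sup>+p. q p \<partial>lborel)"
      by (intro nn_integral_mono) (auto simp: indicator_def)
    then show ?thesis unfolding nF using q by (rule le_less_trans)
  qed
  have finf: "(\<integral>\<^sup>+p. ennreal ((norm (f p))\<^sup>2) \<partial>lborel) < \<infinity>"
  proof -
    have "(\<integral>\<^sup>+p. q p * indicator ?R p \<partial>lborel) \<le> (\<integral>\<^sup>+p. q p \<partial>lborel)"
      by (intro nn_integral_mono) (auto simp: indicator_def)
    then show ?thesis unfolding nf using q by (rule le_less_trans)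
  qed
  have Fg: "F n p = indicator ?R p *\<^sub>R g (fst p, snd p - \<epsilon> n)" for n p
    using \<epsilon>(1)[of n] by (cases p) (auto simp: F_def g0_def indicator_def)
  have fg: "f p = indicator ?R p *\<^sub>R g p" for p
    by (auto simp: f_def g0_def indicator_def)
  have eqF: "(\<integral>\<^sup>+p\<in>?R. ennreal ((norm (g (fst p, snd p - \<epsilon> n)))\<^sup>2) \<partial>lborel) = (\<integral>\<^sup>+p. ennreal ((norm (F n p))\<^sup>2) \<partial>lborel)" for n
    unfolding Fg by (intro nn_integral_cong) (simp add: indicator_def)
  show "(\<integral>\<^sup>+p\<in>?R. ennreal ((norm (g (fst p, snd p - \<epsilon> n)))\<^sup>2) \<partial>lborel) < \<infinity>" for n
    unfolding eqF by (rule finF)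
  have "(\<lambda>n. \<integral>\<^sup>+p. ennreal ((norm (F n p - f p))\<^sup>2) \<partial>lborel) \<longlonglongrightarrow> 0"
  proof (rule L2_convergence_from_norms)
    show "F n \<in> borel_measurable lborel" for n unfolding F_def by measurable
    show "f \<in> borel_measurable lborel" unfolding f_def by measurable
    show "AE p in lborel. (\<lambda>n. F n p) \<longlonglongrightarrow> f p"
    proof (rule AE_I2)
      fix p
      show "(\<lambda>n. F n p) \<longlonglongrightarrow> f p"
      proof (cases "p \<in> ?R")
        case True
        then have p: "p \<in> ?H" by auto
        have "(\<lambda>n. (fst p, snd p - \<epsilon> n)) \<longlonglongrightarrow> (fst p, snd p - 0)"
          by (intro tendsto_intros \<epsilon>(3))
        moreover have "isCont g p"
        proof -
          have "open ?H" by (intro open_Collect_less continuous_intros)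
          then have "\<forall>p\<in>?H. isCont g p" using continuous_on_eq_continuous_at[of ?H g] cont by blast
          then show ?thesis using p by (rule bspec)
        qed
        ultimately have "(\<lambda>n. g (fst p, snd p - \<epsilon> n)) \<longlonglongrightarrow> g p"
          using isCont_tendsto_compose by fastforce
        then show ?thesis using True by (simp add: Fg fg)
      qed (simp add: Fg fg)
    qed
    have "(\<lambda>n. \<integral>\<^sup>+p. q p * indicator (?Rn n) p \<partial>lborel) \<longlonglongrightarrow> (\<integral>\<^sup>+p. q p * indicator ?R p \<partial>lborel)"
    proof (rule nn_integral_dominated_convergence[where w=q])
      show "AE p in lborel. (\<lambda>n. q p * indicator (?Rn n) p) \<longlonglongrightarrow> q p * indicator ?R p"
        using AE_snd_neq[of "- \<delta>"]
      proof eventually_elim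
        case (elim p)
        have "\<forall>\<^sub>F n in sequentially. q p * indicator (?Rn n) p = q p * indicator ?R p"
        proof (cases "p \<in> ?Q")
          case True
          then have "snd p < 0" by auto
          have 1: "\<forall>\<^sub>F n in sequentially. \<epsilon> n < - snd p"
            using order_tendstoD(2)[OF \<epsilon>(3)] \<open>snd p < 0\<close> by simp
          have 2: "\<forall>\<^sub>F n in sequentially. - \<delta> < snd p \<or> \<epsilon> n < - \<delta> - snd p"
          proof (cases "- \<delta> < snd p")
            case False
            then have "0 < - \<delta> - snd p" using elim by simp
            then show ?thesis using order_tendstoD(2)[OF \<epsilon>(3)] by (auto elim: eventually_mono)
          qed simp
          from 1 2 show ?thesis
          proof eventually_elim
            case (elim n)
            have "p \<in> ?Rn n \<longleftrightarrow> p \<in> ?R"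
              using elim True \<epsilon>(1)[of n] by (cases p) auto
            then show ?case by (simp add: indicator_def)
          qed
        qed (simp add: q_def)
        then show ?case by (rule tendsto_eventually)
      qed
    qed (use mq q in \<open>auto simp: indicator_def\<close>)
    then show "(\<lambda>n. \<integral>\<^sup>+p. ennreal ((norm (F n p))\<^sup>2) \<partial>lborel) \<longlonglongrightarrow> (\<integral>\<^sup>+p. ennreal ((norm (f p))\<^sup>2) \<partial>lborel)"
      unfolding nF nf .
  qed (use finF finf in auto)
  moreover have "(\<integral>\<^sup>+p\<in>?R. ennreal ((norm (g (fst p, snd p - \<epsilon> n) - g p))\<^sup>2) \<partial>lborel) = (\<integral>\<^sup>+p. ennreal ((norm (F n p - f p))\<^sup>2) \<partial>lborel)" for n
    unfolding Fg fg by (intro nn_integral_cong) (simp add: indicator_def)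
  ultimately show "(\<lambda>n. \<integral>\<^sup>+p\<in>?R. ennreal ((norm (g (fst p, snd p - \<epsilon> n) - g p))\<^sup>2) \<partial>lborel) \<longlonglongrightarrow> 0"
    by simp
qed

section \<open>The trace of the lift\<close>

lemma lift_diff:
  assumes f: "loc_int f" and g: "loc_int g"
  shows "lift \<kappa> (\<lambda>x. f x - g x) = (\<lambda>p. lift \<kappa> f p - lift \<kappa> g p)"
proof -
  have P: "primitive (\<lambda>x. f x - g x) = (\<lambda>x. primitive f x - primitive g x)" if "loc_int f" "loc_int g" for f g
    using that by (intro ext) (simp add: primitive_def Henstock_Kurzweil_Integration.integral_diff loc_int_integrable)
  have alg: "((a - a') - 2 * (b - b') + (c - c')) / t = (a - 2 * b + c) / t - (a' - 2 * b' + c') / t"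
    for a a' b b' c c' t :: real
    by (simp add: diff_divide_distrib[symmetric] algebra_simps)
  show ?thesis
    unfolding lift_def mean2_def P[OF f g] P[OF loc_int_primitive[OF f] loc_int_primitive[OF g]] alg ..
qed

lemma C1_gradient_lift:
  assumes "loc_int f" "\<kappa> > 0"
  shows "C1_gradient {p. snd p < 0} (lift \<kappa> f) (lift_grad \<kappa> f)"
  unfolding C1_gradient_def using lift_has_derivative[OF assms] continuous_on_lift_grad[OF assms] by simp

lemma C1_gradient_vertical_shift:
  assumes "C1_gradient {p. snd p < 0} \<phi> G"
  shows "C1_gradient {p. snd p < \<epsilon>} (\<lambda>p. \<phi> (fst p, snd p - \<epsilon>)) (\<lambda>p. G (fst p, snd p - \<epsilon>))"
  unfolding C1_gradient_def
proof (intro conjI ballI)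
  fix p :: "real \<times> real" assume "p \<in> {p. snd p < \<epsilon>}"
  then have D: "(\<phi> has_derivative (\<lambda>v. G (fst p, snd p - \<epsilon>) \<bullet> v)) (at (fst p, snd p - \<epsilon>))"
    using assms by (simp add: C1_gradient_def)
  have "((\<lambda>p. (fst p, snd p - \<epsilon>)) has_derivative (\<lambda>v. (fst v, snd v - 0))) (at p)"
    by (intro has_derivative_Pair has_derivative_diff has_derivative_fst has_derivative_snd
        has_derivative_ident has_derivative_const)
  from has_derivative_compose[OF this D]
  show "((\<lambda>p. \<phi> (fst p, snd p - \<epsilon>)) has_derivative (\<lambda>v. G (fst p, snd p - \<epsilon>) \<bullet> v)) (at p)" by simp
next
  have "continuous_on {p. snd p < 0} G" using assms by (simp add: C1_gradient_def)
  then show "continuous_on {p. snd p < \<epsilon>} (\<lambda>p. G (fst p, snd p - \<epsilon>))"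
    by (rule continuous_on_compose2) (auto intro!: continuous_intros)
qed

lemma square_le_twice: "(a :: real)\<^sup>2 \<le> 2 * (a - b)\<^sup>2 + 2 * b\<^sup>2"
  using zero_le_power2[of "a - 2 * b"] by (simp add: power2_eq_square algebra_simps)

lemma nn_square_le_twice: "ennreal ((a :: real)\<^sup>2) \<le> 2 * ennreal ((a - b)\<^sup>2) + 2 * ennreal (b\<^sup>2)"
proof -
  have "ennreal (a\<^sup>2) \<le> ennreal (2 * (a - b)\<^sup>2 + 2 * b\<^sup>2)" by (rule ennreal_leI) (rule square_le_twice)
  also have "\<dots> = 2 * ennreal ((a - b)\<^sup>2) + 2 * ennreal (b\<^sup>2)"
    by (subst ennreal_plus) (simp_all add: ennreal_mult)
  finally show ?thesis .
qed

lemma measurable_lift: "loc_int f \<Longrightarrow> lift \<kappa> f \<in> borel_measurable borel"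
proof -
  assume f: "loc_int f"
  note [measurable] = measurable_primitive[OF loc_int_primitive[OF f]]
  show ?thesis unfolding lift_def[abs_def] mean2_def by measurable
qed

text \<open>
  The difference between the lift and \<open>f\<close> is square integrable in \<open>x\<close>,
  uniformly in the depth.  At a fixed depth the lift is bounded on \<open>[c, d]\<close>, so
  \<open>f\<close> is square integrable there, and then so is the lift.
\<close>
lemma lift_square_integrable_on_rectangle:
  assumes f: "loc_int f" and fin: "increment_energy w f < \<infinity>" and \<kappa>: "\<kappa> > 0" and "c < d"
    and l: "0 < l" "2 * \<kappa> * l < w"
  shows "(\<integral>\<^sup>+p\<in>{c<..<d} \<times> {-l<..<0}. ennreal ((norm (lift \<kappa> f p))\<^sup>2) \<partial>lborel) < \<infinity>"
proof -
  note [measurable] = loc_int_measurable[OF f] measurable_lift[OF f]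
  let ?J = "increment_energy w f"
  have diff: "(\<integral>\<^sup>+x. ennreal ((lift \<kappa> f (x, z) - f x)\<^sup>2) \<partial>lborel) \<le> ennreal (4 * (\<kappa> * l)) * ?J" if z: "z \<in> {-l<..<0}" for z
  proof -
    have "- \<kappa> * z > 0" using \<kappa> z by (simp add: mult_pos_neg)
    moreover have zl: "- \<kappa> * z \<le> \<kappa> * l" using mult_left_mono[of "- z" l \<kappa>] \<kappa> z by simp
    moreover have "2 * (- \<kappa> * z) < w" using zl l by linarith
    ultimately have "(\<integral>\<^sup>+x. ennreal ((lift \<kappa> f (x, z) - f x)\<^sup>2) \<partial>lborel) \<le> ennreal (4 * (- \<kappa> * z)) * ?J"
      using square_mean2_diff_le[OF f, of "- \<kappa> * z" w] by (simp add: lift_def)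
    also have "\<dots> \<le> ennreal (4 * (\<kappa> * l)) * ?J"
      using zl by (intro mult_right_mono ennreal_leI) auto
    finally show ?thesis .
  qed
  let ?z = "- l / 2"
  have z: "?z \<in> {-l<..<0}" using l by auto
  have "continuous_on {c..d} (\<lambda>x. lift \<kappa> f (x, ?z))"
    using C1_gradient_continuous[OF C1_gradient_lift[OF f \<kappa>]]
    by (rule continuous_on_compose2) (use l in \<open>auto intro!: continuous_intros\<close>)
  then have "bounded ((\<lambda>x. lift \<kappa> f (x, ?z)) ` {c..d})"
    by (intro compact_imp_bounded compact_continuous_image) auto
  then obtain B where "\<forall>y\<in>(\<lambda>x. lift \<kappa> f (x, ?z)) ` {c..d}. \<bar>y\<bar> \<le> B" by (auto simp only: bounded_real)
  then have B: "\<bar>lift \<kappa> f (x, ?z)\<bar> \<le> B" if "x \<in> {c..d}" for x using that by blast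
  have fL2: "(\<integral>\<^sup>+x\<in>{c<..<d}. ennreal ((f x)\<^sup>2) \<partial>lborel) < \<infinity>"
  proof -
    have "(\<integral>\<^sup>+x\<in>{c<..<d}. ennreal ((f x)\<^sup>2) \<partial>lborel)
      \<le> (\<integral>\<^sup>+x. 2 * ennreal ((lift \<kappa> f (x, ?z) - f x)\<^sup>2) + 2 * (ennreal (B\<^sup>2) * indicator {c<..<d} x) \<partial>lborel)"
    proof (rule nn_integral_mono)
      fix x
      have "ennreal ((lift \<kappa> f (x, ?z))\<^sup>2) \<le> ennreal (B\<^sup>2)" if "x \<in> {c<..<d}"
        using B[of x] that by (intro ennreal_leI) (simp add: abs_le_square_iff[symmetric])
      note lB = this
      show "ennreal ((f x)\<^sup>2) * indicator {c<..<d} x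
        \<le> 2 * ennreal ((lift \<kappa> f (x, ?z) - f x)\<^sup>2) + 2 * (ennreal (B\<^sup>2) * indicator {c<..<d} x)"
      proof (cases "x \<in> {c<..<d}")
        case True
        have "ennreal ((f x)\<^sup>2) \<le> 2 * ennreal ((f x - lift \<kappa> f (x, ?z))\<^sup>2) + 2 * ennreal ((lift \<kappa> f (x, ?z))\<^sup>2)"
          by (rule nn_square_le_twice)
        also have "\<dots> \<le> 2 * ennreal ((f x - lift \<kappa> f (x, ?z))\<^sup>2) + 2 * ennreal (B\<^sup>2)"
          by (intro add_left_mono mult_left_mono lB[OF True]) (rule zero_le)
        finally show ?thesis using True by (simp add: power2_commute)
      qed simp
    qed
    also have "\<dots> = 2 * (\<integral>\<^sup>+x. ennreal ((lift \<kappa> f (x, ?z) - f x)\<^sup>2) \<partial>lborel) + 2 * (ennreal (B\<^sup>2) * ennreal (d - c))"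
      using \<open>c < d\<close> by (simp add: nn_integral_add nn_integral_cmult nn_integral_cmult_indicator)
    also have "\<dots> < \<infinity>"
      using le_less_trans[OF diff[OF z]] fin by (auto simp: ennreal_mult_less_top ennreal_add_eq_top less_top)
    finally show ?thesis .
  qed
  define M where "M = 2 * (ennreal (4 * (\<kappa> * l)) * ?J) + 2 * (\<integral>\<^sup>+x\<in>{c<..<d}. ennreal ((f x)\<^sup>2) \<partial>lborel)"
  have M: "M < \<infinity>" using fin fL2 by (simp add: M_def ennreal_mult_less_top)
  define g where "g p = ennreal ((norm (lift \<kappa> f p))\<^sup>2) * indicator {c<..<d} (fst p)" for p
  have mg: "g \<in> borel_measurable borel" unfolding g_def by measurable
  have "(\<integral>\<^sup>+p\<in>{c<..<d} \<times> {-l<..<0}. ennreal ((norm (lift \<kappa> f p))\<^sup>2) \<partial>lborel)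
    = (\<integral>\<^sup>+p. g p * indicator {p. snd p \<in> {-l<..<0}} p \<partial>lborel)"
    by (intro nn_integral_cong) (auto simp: g_def indicator_def)
  also have "\<dots> = (\<integral>\<^sup>+z. (\<integral>\<^sup>+x. g (x, z) \<partial>lborel) * indicator {-l<..<0} z \<partial>lborel)"
    by (rule nn_integral_strip[OF mg]) simp
  also have "\<dots> \<le> (\<integral>\<^sup>+z. M * indicator {-l<..<0} z \<partial>lborel)"
  proof (rule nn_integral_mono)
    fix z
    have "(\<integral>\<^sup>+x. g (x, z) \<partial>lborel) \<le> M" if z: "z \<in> {-l<..<0}"
    proof -
      have "(\<integral>\<^sup>+x. g (x, z) \<partial>lborel) \<le> (\<integral>\<^sup>+x. 2 * ennreal ((lift \<kappa> f (x, z) - f x)\<^sup>2) + 2 * (ennreal ((f x)\<^sup>2) * indicator {c<..<d} x) \<partial>lborel)"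
      proof (rule nn_integral_mono)
        fix x
        show "g (x, z) \<le> 2 * ennreal ((lift \<kappa> f (x, z) - f x)\<^sup>2) + 2 * (ennreal ((f x)\<^sup>2) * indicator {c<..<d} x)"
          using nn_square_le_twice[of "lift \<kappa> f (x, z)" "f x"] by (cases "x \<in> {c<..<d}") (auto simp: g_def)
      qed
      also have "\<dots> = 2 * (\<integral>\<^sup>+x. ennreal ((lift \<kappa> f (x, z) - f x)\<^sup>2) \<partial>lborel) + 2 * (\<integral>\<^sup>+x\<in>{c<..<d}. ennreal ((f x)\<^sup>2) \<partial>lborel)"
        by (simp add: nn_integral_add nn_integral_cmult)
      also have "\<dots> \<le> M"
        unfolding M_def by (intro add_mono mult_left_mono diff z order_refl) (rule zero_le)
      finally show ?thesis .
    qed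
    then show "(\<integral>\<^sup>+x. g (x, z) \<partial>lborel) * indicator {-l<..<0} z \<le> M * indicator {-l<..<0} z"
      by (cases "z \<in> {-l<..<0}") auto
  qed
  also have "\<dots> = M * ennreal l" using l by (simp add: nn_integral_cmult_indicator)
  also have "\<dots> < \<infinity>" using M by (simp add: ennreal_mult_less_top)
  finally show ?thesis .
qed

text \<open>
  The approximating functions are the vertical translates of the lift.  They are defined up to
  the surface because the lift is defined in the half-plane below it, and on the surface they
  are means of \<open>f\<close> at scale \<open>\<kappa> \<epsilon>\<close>.
\<close>
lemma has_trace_lift:
  assumes f: "loc_int f" and fin: "increment_energy w f < \<infinity>" and wh: "w > 0" "h > 0"
    and rect: "\<And>c d. c < d \<Longrightarrow> {c..d} \<subseteq> A \<Longrightarrow> \<exists>\<delta>>0. {c<..<d} \<times> {-\<delta><..<0} \<subseteq> \<Omega>"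
    and ae: "AE x in lborel. x \<in> A \<longrightarrow> f x = \<tau> x"
  shows "has_trace \<Omega> A (lift (w / h) f) \<tau>"
  unfolding has_trace_def
proof (intro allI impI)
  fix c d :: real assume cd: "c < d \<and> {c..d} \<subseteq> A"
  define \<kappa> where "\<kappa> = w / h"
  have \<kappa>: "\<kappa> > 0" using wh by (simp add: \<kappa>_def)
  let ?\<phi> = "lift \<kappa> f" and ?G = "lift_grad \<kappa> f"
  note C1 = C1_gradient_lift[OF f \<kappa>]
  obtain \<delta>0 where \<delta>0: "\<delta>0 > 0" "{c<..<d} \<times> {-\<delta>0<..<0} \<subseteq> \<Omega>" using rect cd by blast
  \<comment> \<open>The translates live in depth less than \<open>2 \<delta>\<close>, where \<open>\<delta> \<le> h / 8\<close> gives scales \<open>s\<close> with \<open>2 s < w\<close>.\<close>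
  define \<delta> where "\<delta> = min \<delta>0 (h / 8)"
  have \<delta>: "\<delta> > 0" "\<delta> \<le> \<delta>0" "8 * \<delta> \<le> h" using \<delta>0 wh by (auto simp: \<delta>_def)
  define \<epsilon> where "\<epsilon> n = \<delta> / (real n + 2)" for n
  have \<epsilon>: "0 < \<epsilon> n" "\<epsilon> n < \<delta>" for n
    using \<delta>(1) divide_strict_left_mono[of 1 "real n + 2" \<delta>] by (simp_all add: \<epsilon>_def add_nonneg_pos)
  have \<epsilon>0: "\<epsilon> \<longlonglongrightarrow> 0"
  proof -
    have "(\<lambda>n. \<delta> * inverse (real (n + 2))) \<longlonglongrightarrow> \<delta> * 0"
      by (intro tendsto_intros LIMSEQ_ignore_initial_segment lim_inverse_n)
    then show ?thesis by (simp add: \<epsilon>_def[abs_def] divide_inverse add.commute)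
  qed
  let ?R = "{c<..<d} \<times> {-\<delta><..<0}" and ?Q = "{c<..<d} \<times> {-2 * \<delta><..<0}"
  have R: "open ?R" "?R \<subseteq> \<Omega>" "?R \<subseteq> {p. snd p < 0}"
    using \<delta>0 \<delta> by (auto intro: open_Times)
  have finG: "(\<integral>\<^sup>+p\<in>?Q. ennreal ((norm (?G p))\<^sup>2) \<partial>lborel) < \<infinity>"
  proof -
    have "(\<integral>\<^sup>+p\<in>?Q. ennreal ((norm (?G p))\<^sup>2) \<partial>lborel)
      \<le> (\<integral>\<^sup>+p\<in>{p. snd p \<in> {-h<..<0}}. ennreal ((norm (?G p))\<^sup>2) \<partial>lborel)"
      using \<delta> by (intro nn_integral_mono) (auto simp: indicator_def)
    also have "\<dots> \<le> ennreal ((1 + 2 * \<kappa>\<^sup>2) / \<kappa>) * increment_energy w f"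
      unfolding \<kappa>_def using f wh(2,1) by (rule lift_energy)
    also have "\<dots> < \<infinity>" using fin by (simp add: ennreal_mult_less_top)
    finally show ?thesis .
  qed
  have "\<kappa> * (4 * \<delta>) \<le> \<kappa> * (h / 2)" using \<kappa> \<delta> by (intro mult_left_mono) auto
  also have "\<dots> < w" using wh by (simp add: \<kappa>_def)
  finally have \<kappa>\<delta>: "2 * \<kappa> * (2 * \<delta>) < w" by (simp add: mult_ac)
  have fin\<phi>: "(\<integral>\<^sup>+p\<in>?Q. ennreal ((norm (?\<phi> p))\<^sup>2) \<partial>lborel) < \<infinity>"
    using lift_square_integrable_on_rectangle[OF f fin \<kappa>, of c d "2 * \<delta>"] cd \<delta>(1) \<kappa>\<delta> by simp
  define u where "u n p = ?\<phi> (fst p, snd p - \<epsilon> n)" for n p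
  define Gu where "Gu n p = ?G (fst p, snd p - \<epsilon> n)" for n p
  have cG: "continuous_on {p. snd p < 0} ?G" using C1 by (simp add: C1_gradient_def)
  have C1u: "C1_gradient {p. snd p < \<epsilon> n} (u n) (Gu n)" for n
    using C1_gradient_vertical_shift[OF C1, of "\<epsilon> n"] by (simp add: u_def[abs_def] Gu_def[abs_def])
  have C1uR: "C1_gradient ?R (u n) (Gu n)" for n
    by (rule C1_gradient_subset[OF C1u]) (use \<epsilon>(1)[of n] in auto)
  have C1R: "C1_gradient ?R ?\<phi> ?G" using C1 R(3) by (rule C1_gradient_subset)
  have GuL2: "(\<integral>\<^sup>+p\<in>?R. ennreal ((norm (Gu n p))\<^sup>2) \<partial>lborel) < \<infinity>"
    and Gu0: "(\<lambda>n. \<integral>\<^sup>+p\<in>?R. ennreal ((norm (Gu n p - ?G p))\<^sup>2) \<partial>lborel) \<longlonglongrightarrow> 0" for n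
    using vertical_shift_tendsto_L2[OF cG \<delta>(1) finG \<epsilon> \<epsilon>0] by (simp_all add: Gu_def)
  have "\<exists>u. (\<forall>n. continuous_on (closure ?R) (u n) \<and> u n \<in> H1dot ?R) \<and>
      (\<lambda>n. \<integral>\<^sup>+p\<in>?R. ennreal ((u n p - ?\<phi> p)\<^sup>2) \<partial>lebesgue) \<longlonglongrightarrow> 0 \<and>
      (\<lambda>n. H1dot_seminorm ?R (\<lambda>p. u n p - ?\<phi> p)) \<longlonglongrightarrow> 0 \<and>
      (\<lambda>n. \<integral>\<^sup>+x\<in>{c<..<d}. ennreal ((u n (x, 0) - \<tau> x)\<^sup>2) \<partial>lebesgue) \<longlonglongrightarrow> 0"
  proof (intro exI[of _ u] conjI allI)
    fix n
    have "closure ?R \<subseteq> {c..d} \<times> {-\<delta>..0}"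
      by (rule closure_minimal) (auto intro: closed_Times)
    also have "\<dots> \<subseteq> {p. snd p < \<epsilon> n}" using \<epsilon>(1)[of n] by auto
    finally show "continuous_on (closure ?R) (u n)"
      using C1_gradient_continuous[OF C1u[of n]] by (rule continuous_on_subset[rotated])
    show "u n \<in> H1dot ?R" using R(1) C1uR GuL2 by (rule C1_gradient_imp_H1dot(1))
  next
    have "continuous_on {p. snd p < 0} ?\<phi>" by (rule C1_gradient_continuous[OF C1])
    from vertical_shift_tendsto_L2(2)[OF this \<delta>(1) fin\<phi> \<epsilon> \<epsilon>0]
    show "(\<lambda>n. \<integral>\<^sup>+p\<in>?R. ennreal ((u n p - ?\<phi> p)\<^sup>2) \<partial>lebesgue) \<longlonglongrightarrow> 0"
      by (simp add: u_def nn_integral_completion)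
  next
    have s: "ennreal ((H1dot_seminorm ?R (\<lambda>p. u n p - ?\<phi> p))\<^sup>2) = (\<integral>\<^sup>+p\<in>?R. ennreal ((norm (Gu n p - ?G p))\<^sup>2) \<partial>lborel)"
      if "(\<integral>\<^sup>+p\<in>?R. ennreal ((norm (Gu n p - ?G p))\<^sup>2) \<partial>lborel) < \<infinity>" for n
      using R(1) C1_gradient_diff[OF C1uR C1R] that by (rule C1_gradient_imp_H1dot(2))
    have "\<forall>\<^sub>F n in sequentially. (\<integral>\<^sup>+p\<in>?R. ennreal ((norm (Gu n p - ?G p))\<^sup>2) \<partial>lborel) < \<infinity>"
      using order_tendstoD(2)[OF Gu0, of \<infinity>] by simp
    then have ev: "\<forall>\<^sub>F n in sequentially. (\<integral>\<^sup>+p\<in>?R. ennreal ((norm (Gu n p - ?G p))\<^sup>2) \<partial>lborel)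
        = ennreal ((H1dot_seminorm ?R (\<lambda>p. u n p - ?\<phi> p))\<^sup>2)"
      by eventually_elim (simp add: s)
    have lim0: "(\<lambda>n. ennreal ((H1dot_seminorm ?R (\<lambda>p. u n p - ?\<phi> p))\<^sup>2)) \<longlonglongrightarrow> ennreal 0"
      using Lim_transform_eventually[OF Gu0 ev] by simp
    have "(\<lambda>n. (H1dot_seminorm ?R (\<lambda>p. u n p - ?\<phi> p))\<^sup>2) \<longlonglongrightarrow> 0"
      using tendsto_enn2real[OF lim0] by simp
    from tendsto_real_sqrt[OF this]
    show "(\<lambda>n. H1dot_seminorm ?R (\<lambda>p. u n p - ?\<phi> p)) \<longlonglongrightarrow> 0"
      by (simp add: tendsto_rabs_zero_iff)
  next
    let ?J = "increment_energy w f"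
    have le: "(\<integral>\<^sup>+x\<in>{c<..<d}. ennreal ((u n (x, 0) - \<tau> x)\<^sup>2) \<partial>lebesgue) \<le> ennreal (4 * (\<kappa> * \<epsilon> n)) * ?J" for n
    proof -
      have "(\<integral>\<^sup>+x\<in>{c<..<d}. ennreal ((u n (x, 0) - \<tau> x)\<^sup>2) \<partial>lebesgue)
        = (\<integral>\<^sup>+x\<in>{c<..<d}. ennreal ((u n (x, 0) - f x)\<^sup>2) \<partial>lborel)"
        unfolding nn_integral_completion
      proof (rule nn_integral_cong_AE)
        show "AE x in lborel. ennreal ((u n (x, 0) - \<tau> x)\<^sup>2) * indicator {c<..<d} x
          = ennreal ((u n (x, 0) - f x)\<^sup>2) * indicator {c<..<d} x"
          using ae by eventually_elim (use cd in \<open>auto simp: indicator_def subset_iff\<close>)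
      qed
      also have "\<dots> \<le> (\<integral>\<^sup>+x. ennreal ((mean2 f x (\<kappa> * \<epsilon> n) - f x)\<^sup>2) \<partial>lborel)"
        by (intro nn_integral_mono) (auto simp: indicator_def u_def lift_def)
      also have "\<dots> \<le> ennreal (4 * (\<kappa> * \<epsilon> n)) * ?J"
      proof (rule square_mean2_diff_le[OF f])
        show "0 < \<kappa> * \<epsilon> n" using \<kappa> \<epsilon>(1) by simp
        have "\<kappa> * \<epsilon> n < \<kappa> * \<delta>" using \<kappa> \<epsilon>(2)[of n] by simp
        moreover have "0 < \<kappa> * \<delta>" using \<kappa> \<delta>(1) by simp
        ultimately show "2 * (\<kappa> * \<epsilon> n) < w" using \<kappa>\<delta> by (simp add: mult_ac)
      qed
      finally show ?thesis .
    qed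
    have "(\<lambda>n. ennreal (4 * (\<kappa> * \<epsilon> n))) \<longlonglongrightarrow> ennreal (4 * (\<kappa> * 0))"
      by (intro tendsto_ennrealI tendsto_intros \<epsilon>0)
    then have "(\<lambda>n. ?J * ennreal (4 * (\<kappa> * \<epsilon> n))) \<longlonglongrightarrow> ?J * 0"
      using fin by (intro ennreal_tendsto_cmult) simp_all
    then have "(\<lambda>n. ennreal (4 * (\<kappa> * \<epsilon> n)) * ?J) \<longlonglongrightarrow> 0" by (simp add: mult.commute)
    from tendsto_sandwich[OF _ _ tendsto_const this, of "\<lambda>n. \<integral>\<^sup>+x\<in>{c<..<d}. ennreal ((u n (x, 0) - \<tau> x)\<^sup>2) \<partial>lebesgue"]
    show "(\<lambda>n. \<integral>\<^sup>+x\<in>{c<..<d}. ennreal ((u n (x, 0) - \<tau> x)\<^sup>2) \<partial>lebesgue) \<longlonglongrightarrow> 0"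
      using le by simp
  qed
  then show "\<exists>\<delta>>0. let R = {c<..<d} \<times> {- \<delta><..<0} in R \<subseteq> \<Omega> \<and>
          (\<exists>u. (\<forall>n. continuous_on (closure R) (u n) \<and> u n \<in> H1dot R) \<and>
            (\<lambda>n. \<integral>\<^sup>+p\<in>R. ennreal ((u n p - lift (w / h) f p)\<^sup>2) \<partial>lebesgue) \<longlonglongrightarrow> 0 \<and>
            (\<lambda>n. H1dot_seminorm R (\<lambda>p. u n p - lift (w / h) f p)) \<longlonglongrightarrow> 0 \<and>
            (\<lambda>n. \<integral>\<^sup>+x\<in>{c<..<d}. ennreal ((u n (x, 0) - \<tau> x)\<^sup>2) \<partial>lebesgue) \<longlonglongrightarrow> 0)"
    unfolding Let_def \<kappa>_def using \<delta>(1) R(2) by blast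
qed

section \<open>Averaging intervals and the extension to the line\<close>

lemma nonempty_interval_subset_einterval:
  assumes "u < v" "{u<..<v} \<subseteq> einterval \<alpha> \<beta>"
  shows "\<alpha> \<le> ereal u" "ereal v \<le> \<beta>"
proof -
  show "\<alpha> \<le> ereal u"
  proof (rule ccontr)
    assume "\<not> \<alpha> \<le> ereal u"
    then have "ereal u < min \<alpha> (ereal v)" using assms by simp
    then obtain x where x: "ereal u < ereal x" "ereal x < min \<alpha> (ereal v)" by (meson ereal_dense2)
    then have "x \<in> einterval \<alpha> \<beta>" using assms by auto
    then show False using x by (auto simp: einterval_def)
  qed
  show "ereal v \<le> \<beta>"
  proof (rule ccontr)
    assume "\<not> ereal v \<le> \<beta>"
    then have "max \<beta> (ereal u) < ereal v" using assms by simp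
    then obtain x where x: "max \<beta> (ereal u) < ereal x" "ereal x < ereal v" by (meson ereal_dense2)
    then have "x \<in> einterval \<alpha> \<beta>" using assms by auto
    then show False using x by (auto simp: einterval_def)
  qed
qed

lemma bounded_einterval_cases:
  assumes "\<alpha> < \<beta>" "bounded (einterval \<alpha> \<beta>)"
  obtains u v where "u < v" "einterval \<alpha> \<beta> = {u<..<v}"
proof -
  obtain B where B: "\<forall>x\<in>einterval \<alpha> \<beta>. \<bar>x\<bar> \<le> B" using assms(2) unfolding bounded_real by blast
  have "\<alpha> \<noteq> -\<infinity>"
  proof
    assume "\<alpha> = -\<infinity>"
    then have "-\<infinity> < min \<beta> (ereal (- \<bar>B\<bar> - 1))" using assms(1) by simp
    then obtain x where "ereal x < min \<beta> (ereal (- \<bar>B\<bar> - 1))" by (meson ereal_dense2)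
    then have "x \<in> einterval \<alpha> \<beta>" "x < - \<bar>B\<bar> - 1" using \<open>\<alpha> = -\<infinity>\<close> by (auto simp: einterval_def)
    then show False using B by force
  qed
  moreover have "\<beta> \<noteq> \<infinity>"
  proof
    assume "\<beta> = \<infinity>"
    then have "\<alpha> < \<infinity>" using assms(1) by simp
    then have "max \<alpha> (ereal (\<bar>B\<bar> + 1)) < \<infinity>" by (simp add: max_def)
    then obtain x where "max \<alpha> (ereal (\<bar>B\<bar> + 1)) < ereal x" by (meson ereal_dense2)
    then have "x \<in> einterval \<alpha> \<beta>" "\<bar>B\<bar> + 1 < x" using \<open>\<beta> = \<infinity>\<close> by (auto simp: einterval_def)
    then show False using B by force
  qed
  ultimately obtain u v where "\<alpha> = ereal u" "\<beta> = ereal v"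
    using assms(1) by (cases \<alpha>; cases \<beta>) auto
  moreover from this have "einterval \<alpha> \<beta> = {u<..<v}" by (auto simp: einterval_def)
  ultimately show ?thesis using that[of u v] assms(1) by simp
qed

text \<open>Both clauses of the definition give a bounded open interval.\<close>
lemma averaging_interval_bounds:
  assumes "averaging_intervals N xl xr I" "j \<in> {1..N+1}" "xr (j - 1) < xl j"
  obtains u v where "u < v" "I j = {u<..<v}" "{u<..<v} \<subseteq> surface_part xl xr j"
    "xr (j - 1) \<le> ereal u" "ereal v \<le> xl j"
proof -
  have I: "if bounded (surface_part xl xr j) then I j = surface_part xl xr j
      else (\<exists>u v. u < v \<and> I j = {u<..<v} \<and> I j \<subseteq> surface_part xl xr j)"
    using assms(1,2) unfolding averaging_intervals_def by (rule bspec)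
  have "\<exists>u v. u < v \<and> I j = {u<..<v} \<and> I j \<subseteq> surface_part xl xr j"
  proof (cases "bounded (surface_part xl xr j)")
    case True
    then obtain u v where uv: "u < v" "surface_part xl xr j = {u<..<v}"
      unfolding surface_part_def by (rule bounded_einterval_cases[OF assms(3)])
    from I True have "I j = surface_part xl xr j" by (simp only: if_True)
    then show ?thesis using uv by (intro exI[of _ u] exI[of _ v]) simp
  next
    case False
    with I show ?thesis by (simp only: if_False)
  qed
  then obtain u v where uv: "u < v" "I j = {u<..<v}" "I j \<subseteq> surface_part xl xr j"
    by (elim exE conjE)
  have sub: "{u<..<v} \<subseteq> surface_part xl xr j" using uv(2,3) by simp
  show ?thesis
    using nonempty_interval_subset_einterval[OF uv(1) sub[unfolded surface_part_def]]
    by (rule that[OF uv(1,2) sub])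
qed

lemma sum_squares_le_square_sum:
  fixes a :: "'a \<Rightarrow> real"
  assumes "finite A" "\<And>i. i \<in> A \<Longrightarrow> 0 \<le> a i"
  shows "(\<Sum>i\<in>A. (a i)\<^sup>2) \<le> (\<Sum>i\<in>A. a i)\<^sup>2"
proof -
  have "(\<Sum>i\<in>A. (a i)\<^sup>2) \<le> (\<Sum>i\<in>A. a i * (\<Sum>i\<in>A. a i))"
    unfolding power2_eq_square using assms by (intro sum_mono mult_left_mono member_le_sum) auto
  then show ?thesis by (simp add: power2_eq_square sum_distrib_right)
qed

text \<open>
  The range \<open>w\<close> is at most the length of every gap, and at most 1 because the
  energies on half-lines only compare points at distance less than 1.
\<close>
lemma (in curved_polygon) extend_to_line:
  assumes I: "averaging_intervals N xl xr I"
  obtains w T C where "0 < w" "w \<le> 1" "C \<ge> 0" "bounded_extension (Collect loc_int) (Gamma_D N xl xr) T"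
    "\<And>f. loc_int f \<Longrightarrow> gagliardo w UNIV (T f)
      \<le> ennreal C * ((\<Sum>j=1..N+1. gagliardo w (surface_part xl xr j) f) +
         (\<Sum>j=1..N. ennreal ((average (I (j + 1)) f - average (I j) f)\<^sup>2)))"
proof -
  let ?P = "\<lambda>j p. fst p < snd p \<and> I j = {fst p<..<snd p} \<and> {fst p<..<snd p} \<subseteq> surface_part xl xr j \<and>
    xr (j - 1) \<le> ereal (fst p) \<and> ereal (snd p) \<le> xl j"
  have "\<exists>p. ?P j p" if j: "j \<in> {1..N+1}" for j
  proof -
    obtain u v where "u < v" "I j = {u<..<v}" "{u<..<v} \<subseteq> surface_part xl xr j"
      "xr (j - 1) \<le> ereal u" "ereal v \<le> xl j"
      by (rule averaging_interval_bounds[OF I j order_surface[OF j]])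
    then show ?thesis by (intro exI[of _ "(u, v)"]) simp
  qed
  then have "\<exists>f. \<forall>j\<in>{1..N+1}. ?P j (f j)" by (intro bchoice ballI)
  then obtain f where f: "\<forall>j\<in>{1..N+1}. ?P j (f j)" by (rule exE)
  define u v where "u j = fst (f j)" and "v j = snd (f j)" for j
  have uv: "u j < v j" "I j = {u j<..<v j}" "{u j<..<v j} \<subseteq> surface_part xl xr j"
    "xr (j - 1) \<le> ereal (u j) \<and> ereal (v j) \<le> xl j" if "j \<in> {1..N+1}" for j
    using bspec[OF f that] by (simp_all add: u_def v_def)
  define w where "w = Min (insert 1 ((\<lambda>j. real_of_ereal (xr j) - real_of_ereal (xl j)) ` {1..N}))"
  have gap: "0 < real_of_ereal (xr j) - real_of_ereal (xl j)" if "j \<in> {1..N}" for j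
  proof -
    have "ereal (real_of_ereal (xl j)) < ereal (real_of_ereal (xr j))"
      using order_object[OF that] finite_vertices[OF that] by simp
    then show ?thesis by simp
  qed
  have w: "0 < w" "w \<le> 1"
    unfolding w_def using gap by (simp_all add: Min_gr_iff)
  have wg: "w \<le> real_of_ereal (xr j) - real_of_ereal (xl j)" if "j \<in> {1..N}" for j
    unfolding w_def using that by (intro Min_le) auto
  have "\<exists>T C. bounded_extension (Collect loc_int) (Gamma_D N xl xr) T \<and> C \<ge> 0 \<and>
    (\<forall>f. loc_int f \<longrightarrow> gagliardo w (einterval (xr 0) (xl (N + 1))) (T f)
      \<le> ennreal C * ((\<Sum>j=1..N+1. gagliardo w (surface_part xl xr j) f) +
         (\<Sum>j=1..N. ennreal ((average {u j<..<v j} f - average {u (j+1)<..<v (j+1)} f)\<^sup>2))))"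
    using uv(1,3,4) w(1) wg order_refl by (rule extend_over_gaps)
  then obtain T1 C1 where T1: "bounded_extension (Collect loc_int) (Gamma_D N xl xr) T1" "C1 \<ge> 0"
    and T1g: "\<forall>f. loc_int f \<longrightarrow> gagliardo w (einterval (xr 0) (xl (N + 1))) (T1 f)
      \<le> ennreal C1 * ((\<Sum>j=1..N+1. gagliardo w (surface_part xl xr j) f) +
         (\<Sum>j=1..N. ennreal ((average {u j<..<v j} f - average {u (j+1)<..<v (j+1)} f)\<^sup>2)))"
    by (elim exE conjE)
  have first: "xr 0 \<le> ereal (u 1)" "u 1 < v 1" "ereal (v 1) \<le> xl (N + 1)"
    using uv(1)[of 1] uv(4)[of 1] order_trans[OF _ xl_mono[of 1 "N + 1"], of "ereal (v 1)"] by simp_all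
  have ends: "xr 0 \<noteq> \<infinity>" "xl (N + 1) \<noteq> -\<infinity>"
    using first by auto
  obtain T2 C2 where T2: "bounded_extension (Collect loc_int) (einterval (xr 0) (xl (N + 1))) T2" "C2 \<ge> 0"
    "\<And>f. loc_int f \<Longrightarrow> gagliardo w (einterval (-\<infinity>) (xl (N + 1))) (T2 f)
      \<le> ennreal C2 * gagliardo w (einterval (xr 0) (xl (N + 1))) f"
    using extend_left[OF first w(1,2) ends(1)] by blast
  obtain T3 C3 where T3: "bounded_extension (Collect loc_int) (einterval (-\<infinity>) (xl (N + 1))) T3" "C3 \<ge> 0"
    "\<And>f. loc_int f \<Longrightarrow> gagliardo w (einterval (-\<infinity>) \<infinity>) (T3 f)
      \<le> ennreal C3 * gagliardo w (einterval (-\<infinity>) (xl (N + 1))) f"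
    using extend_right[of "-\<infinity>" "u 1" "v 1" "xl (N + 1)" w] first w ends by auto
  have sub: "einterval (xr 0) (xl (N + 1)) \<subseteq> einterval (-\<infinity>) (xl (N + 1))" by (auto simp: einterval_def)
  have ext: "bounded_extension (Collect loc_int) (Gamma_D N xl xr) (\<lambda>f. T3 (T2 (T1 f)))"
    by (rule bounded_extension_subset[OF bounded_extension_comp[OF bounded_extension_comp[OF T1(1) T2(1)] T3(1)]])
      (use Gamma_D_subset sub in blast)
  have bound: "gagliardo w UNIV (T3 (T2 (T1 f))) \<le> ennreal (C3 * (C2 * C1)) * ((\<Sum>j=1..N+1. gagliardo w (surface_part xl xr j) f) +
         (\<Sum>j=1..N. ennreal ((average (I (j + 1)) f - average (I j) f)\<^sup>2)))" if f: "loc_int f" for f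
  proof -
    have l1: "loc_int (T1 f)" using T1(1) f by (simp add: bounded_extension_def)
    then have l2: "loc_int (T2 (T1 f))" using T2(1) by (simp add: bounded_extension_def)
    have s: "(\<Sum>j=1..N. ennreal ((average {u j<..<v j} f - average {u (j+1)<..<v (j+1)} f)\<^sup>2))
      = (\<Sum>j=1..N. ennreal ((average (I (j + 1)) f - average (I j) f)\<^sup>2))"
      by (rule sum.cong) (use uv(2) in \<open>auto simp: power2_commute\<close>)
    define Y where "Y = (\<Sum>j=1..N+1. gagliardo w (surface_part xl xr j) f) +
         (\<Sum>j=1..N. ennreal ((average (I (j + 1)) f - average (I j) f)\<^sup>2))"
    have 1: "gagliardo w (einterval (xr 0) (xl (N + 1))) (T1 f) \<le> ennreal C1 * Y"
      unfolding Y_def s[symmetric] using T1g f by blast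
    have 2: "gagliardo w (einterval (-\<infinity>) (xl (N + 1))) (T2 (T1 f)) \<le> ennreal C2 * (ennreal C1 * Y)"
      using T2(3)[OF l1] mult_left_mono[OF 1, of "ennreal C2"] by (rule order_trans) simp
    have 3: "gagliardo w UNIV (T3 (T2 (T1 f))) \<le> ennreal C3 * (ennreal C2 * (ennreal C1 * Y))"
      using T3(3)[OF l2, unfolded einterval_infinite] mult_left_mono[OF 2, of "ennreal C3"]
      by (rule order_trans) simp
    have "ennreal (C3 * (C2 * C1)) = ennreal C3 * (ennreal C2 * ennreal C1)"
      using T1(2) T2(2) T3(2) by (simp add: ennreal_mult)
    with 3 show ?thesis by (simp only: Y_def[symmetric] mult.assoc)
  qed
  have "C3 * (C2 * C1) \<ge> 0" using T1(2) T2(2) T3(2) by simp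
  then show ?thesis using ext bound by (rule that[OF w(1,2)])
qed

section \<open>The extension operator\<close>

lemma Hhalf_sq_cong_AE:
  assumes "AE x in lborel. x \<in> J \<longrightarrow> f x = g x"
  shows "Hhalf_sq J f = Hhalf_sq J g"
proof -
  obtain w where "\<And>f. Hhalf_sq J f = gagliardo w J f" using Hhalf_sq_eq_gagliardo by blast
  then show ?thesis using gagliardo_cong_AE[OF assms] by simp
qed

lemma gagliardo_le_Hhalf_sq:
  assumes "w \<le> 1"
  shows "gagliardo w J f \<le> Hhalf_sq J f"
proof -
  obtain w' where w': "w' \<ge> 1" "\<And>f. Hhalf_sq J f = gagliardo w' J f" using Hhalf_sq_eq_gagliardo by blast
  have "w \<le> w'" using assms w'(1) by simp
  then show ?thesis unfolding w'(2) by (intro gagliardo_mono order_refl)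
qed

lemma Hhalf_sq_diff_le:
  assumes "f \<in> borel_measurable borel" "g \<in> borel_measurable borel" "J \<in> sets borel"
  shows "Hhalf_sq J (\<lambda>x. f x - g x) \<le> 2 * Hhalf_sq J f + 2 * Hhalf_sq J g"
proof -
  obtain w where "\<And>f. Hhalf_sq J f = gagliardo w J f" using Hhalf_sq_eq_gagliardo by blast
  then show ?thesis using gagliardo_diff_le[OF assms] by simp
qed

text \<open>
  The choice depends on the representative of a class and is not linear, but a difference of two
  choices represents the difference, which is all that continuity needs.
\<close>
definition borel_representative :: "real set \<Rightarrow> (real \<Rightarrow> real) \<Rightarrow> real \<Rightarrow> real" where
  "borel_representative A \<psi> = (SOME h. loc_int h \<and> (AE x in lborel. x \<in> A \<longrightarrow> h x = \<psi> x))"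

lemma borel_representative:
  assumes "\<psi> \<in> L1loc_tilde A"
  shows "loc_int (borel_representative A \<psi>)"
    and "AE x in lborel. x \<in> A \<longrightarrow> borel_representative A \<psi> x = \<psi> x"
proof -
  obtain g where g: "locally_integrable_on g UNIV" "\<forall>x\<in>A. \<psi> x = g x"
    using assms by (auto simp: L1loc_tilde_def)
  obtain h where h: "loc_int h" "AE x in lborel. g x = h x"
    using locally_integrable_imp_loc_int_AE[OF g(1)] by blast
  have "AE x in lborel. x \<in> A \<longrightarrow> h x = \<psi> x"
    using h(2) by eventually_elim (use g(2) in auto)
  with h(1) have "\<exists>h. loc_int h \<and> (AE x in lborel. x \<in> A \<longrightarrow> h x = \<psi> x)" by blast
  then have "loc_int (borel_representative A \<psi>) \<and> (AE x in lborel. x \<in> A \<longrightarrow> borel_representative A \<psi> x = \<psi> x)"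
    unfolding borel_representative_def by (rule someI_ex)
  then show "loc_int (borel_representative A \<psi>)"
    "AE x in lborel. x \<in> A \<longrightarrow> borel_representative A \<psi> x = \<psi> x" by blast+
qed

text \<open>
  The lift is continuously differentiable on \<open>\<Omega>\<close>, and its energy over
  \<open>\<Omega>\<close> is at most that over the strip.
\<close>
lemma lift_in_H1dot:
  assumes f: "loc_int f" and fin: "gagliardo w UNIV f < \<infinity>" and wh: "w > 0" "h > 0"
    and \<Omega>: "open \<Omega>" "\<Omega> \<subseteq> UNIV \<times> {-h<..<0}"
  shows "lift (w / h) f \<in> H1dot \<Omega>"
    and "ennreal ((H1dot_seminorm \<Omega> (lift (w / h) f))\<^sup>2) \<le> ennreal ((1 + 2 * (w / h)\<^sup>2) / (w / h)) * gagliardo w UNIV f"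
proof -
  let ?c = "ennreal ((1 + 2 * (w / h)\<^sup>2) / (w / h))"
  have "w / h > 0" using wh by simp
  note C1 = C1_gradient_subset[OF C1_gradient_lift[OF f this], of \<Omega>]
  have C: "C1_gradient \<Omega> (lift (w / h) f) (lift_grad (w / h) f)" by (rule C1) (use \<Omega>(2) in auto)
  have "(\<integral>\<^sup>+p\<in>\<Omega>. ennreal ((norm (lift_grad (w / h) f p))\<^sup>2) \<partial>lborel)
    \<le> (\<integral>\<^sup>+p\<in>{p. snd p \<in> {-h<..<0}}. ennreal ((norm (lift_grad (w / h) f p))\<^sup>2) \<partial>lborel)"
    using \<Omega>(2) by (intro nn_integral_mono) (auto simp: indicator_def)
  also have "\<dots> \<le> ?c * increment_energy w f"
    using f wh(2,1) by (rule lift_energy)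
  also have "\<dots> \<le> ?c * gagliardo w UNIV f"
    by (intro mult_left_mono increment_energy_le_gagliardo loc_int_measurable f) simp
  finally have le: "(\<integral>\<^sup>+p\<in>\<Omega>. ennreal ((norm (lift_grad (w / h) f p))\<^sup>2) \<partial>lborel) \<le> ?c * gagliardo w UNIV f" .
  also have "\<dots> < \<infinity>" using fin by (simp add: ennreal_mult_less_top)
  finally have fin': "(\<integral>\<^sup>+p\<in>\<Omega>. ennreal ((norm (lift_grad (w / h) f p))\<^sup>2) \<partial>lborel) < \<infinity>" .
  show "lift (w / h) f \<in> H1dot \<Omega>" by (rule C1_gradient_imp_H1dot(1)[OF \<Omega>(1) C fin'])
  show "ennreal ((H1dot_seminorm \<Omega> (lift (w / h) f))\<^sup>2) \<le> ?c * gagliardo w UNIV f"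
    unfolding C1_gradient_imp_H1dot(2)[OF \<Omega>(1) C fin'] by (rule le)
qed

theorem theorem2:
  fixes N :: nat
    and xl xr :: "nat \<Rightarrow> ereal"
    and \<gamma> :: "nat \<Rightarrow> real \<Rightarrow> real \<times> real"
    and b :: "real \<Rightarrow> real"
    and \<Omega> :: "(real \<times> real) set"
    and I :: "nat \<Rightarrow> real set"
  assumes "curved_polygon N xl xr \<gamma> b \<Omega>"
    and "averaging_intervals N xl xr I"
  shows "\<exists>E :: (real \<Rightarrow> real) \<Rightarrow> (real \<times> real \<Rightarrow> real).
    seminorm_continuous (Hhalf_D N xl xr) (Hhalf_D_seminorm N xl xr I)
      (H1dot \<Omega>) (H1dot_seminorm \<Omega>) E \<and>
    (\<forall>\<psi>\<in>Hhalf_D N xl xr. has_trace \<Omega> (Gamma_D N xl xr) (E \<psi>) \<psi>)"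
proof -
  interpret curved_polygon N xl xr \<gamma> b \<Omega> by (rule assms(1))
  let ?\<Gamma> = "Gamma_D N xl xr" and ?S = "surface_part xl xr" and ?V = "Hhalf_D N xl xr" and ?p = "Hhalf_D_seminorm N xl xr I"
  obtain h where h: "h > 0" "\<Omega> \<subseteq> UNIV \<times> {-h<..<0}"
    using finite_depth by (elim exE conjE) (rule that)
  obtain w C T where w: "0 < w" "w \<le> 1" and C: "C \<ge> 0" and T: "bounded_extension (Collect loc_int) ?\<Gamma> T"
    and TC: "\<And>f. loc_int f \<Longrightarrow> gagliardo w UNIV (T f)
      \<le> ennreal C * ((\<Sum>j=1..N+1. gagliardo w (?S j) f) +
         (\<Sum>j=1..N. ennreal ((average (I (j + 1)) f - average (I j) f)\<^sup>2)))"
    by (rule extend_to_line[OF assms(2)]) (rule that)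
  define \<kappa> where "\<kappa> = w / h"
  have \<kappa>: "\<kappa> > 0" using w h by (simp add: \<kappa>_def)
  define B where "B = borel_representative ?\<Gamma>"
  define E where "E \<psi> = lift \<kappa> (T (B \<psi>))" for \<psi>
  \<comment> \<open>The constant of \<open>lift_energy\<close> times that of the extension to the line, for semi-norms instead of their squares.\<close>
  define K where "K = sqrt ((1 + 2 * \<kappa>\<^sup>2) / \<kappa> * C)"
  have K: "K \<ge> 0" using \<kappa> C by (simp add: K_def)
  have S\<Gamma>: "?S j \<subseteq> ?\<Gamma>" if "j \<in> {1..N+1}" for j using that by (auto simp: Gamma_D_def)
  have Sb: "?S j \<in> sets borel" for j by (simp add: surface_part_def)
  have Tl: "loc_int (T f)" and T\<Gamma>: "\<And>x. x \<in> ?\<Gamma> \<Longrightarrow> T f x = f x" if "loc_int f" for f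
    using T that by (auto simp: bounded_extension_def)
  have energy: "gagliardo w UNIV (T f) \<le> ennreal (C * (?p \<phi>)\<^sup>2)"
    if f: "loc_int f" and ae: "AE x in lborel. x \<in> ?\<Gamma> \<longrightarrow> f x = \<phi> x"
      and fin: "\<And>j. j \<in> {1..N+1} \<Longrightarrow> Hhalf_sq (?S j) \<phi> < \<infinity>" for f \<phi>
  proof -
    let ?a = "\<lambda>j. Hhalf_seminorm (?S j) \<phi>" and ?d = "\<lambda>j. \<bar>average (I (j + 1)) \<phi> - average (I j) \<phi>\<bar>"
    have a0: "?a j \<ge> 0" for j by (simp add: Hhalf_seminorm_def)
    have g: "gagliardo w (?S j) f \<le> ennreal ((?a j)\<^sup>2)" if j: "j \<in> {1..N+1}" for j
    proof -
      have "AE x in lborel. x \<in> ?S j \<longrightarrow> f x = \<phi> x"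
        using ae by eventually_elim (use S\<Gamma>[OF j] in auto)
      then have "Hhalf_sq (?S j) f = Hhalf_sq (?S j) \<phi>" by (rule Hhalf_sq_cong_AE)
      also have "\<dots> = ennreal ((?a j)\<^sup>2)"
        using fin[OF j] by (simp add: Hhalf_seminorm_def less_top)
      finally show ?thesis using gagliardo_le_Hhalf_sq[OF w(2), of "?S j" f] by simp
    qed
    have av: "average (I j) f = average (I j) \<phi>" if j: "j \<in> {1..N+1}" for j
    proof -
      obtain u v where uv: "u < v" "I j = {u<..<v}" "{u<..<v} \<subseteq> ?S j"
        by (rule averaging_interval_bounds[OF assms(2) j order_surface[OF j]]) (rule that)
      have "AE x in lborel. x \<in> {u<..<v} \<longrightarrow> \<phi> x = f x"
        using ae by eventually_elim (use uv(3) S\<Gamma>[OF j] in auto)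
      then show ?thesis unfolding uv(2) by (rule average_cong_AE[OF f, symmetric])
    qed
    have "gagliardo w UNIV (T f) \<le> ennreal C * ((\<Sum>j=1..N+1. gagliardo w (?S j) f) +
         (\<Sum>j=1..N. ennreal ((average (I (j + 1)) f - average (I j) f)\<^sup>2)))"
      using f by (rule TC)
    also have "\<dots> \<le> ennreal C * ((\<Sum>j=1..N+1. ennreal ((?a j)\<^sup>2)) + (\<Sum>j=1..N. ennreal ((?d j)\<^sup>2)))"
    proof (intro mult_left_mono add_mono sum_mono)
      fix j assume "j \<in> {1..N}"
      then have "average (I (j + 1)) f = average (I (j + 1)) \<phi>" "average (I j) f = average (I j) \<phi>"
        by (auto intro!: av)
      then show "ennreal ((average (I (j + 1)) f - average (I j) f)\<^sup>2) \<le> ennreal ((?d j)\<^sup>2)" by simp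
    qed (use g in auto)
    also have "\<dots> = ennreal (C * ((\<Sum>j=1..N+1. (?a j)\<^sup>2) + (\<Sum>j=1..N. (?d j)\<^sup>2)))"
      using C by (simp only: sum_ennreal zero_le_power2 ennreal_plus sum_nonneg ennreal_mult add_nonneg_nonneg)
    also have "\<dots> \<le> ennreal (C * (?p \<phi>)\<^sup>2)"
    proof (intro ennreal_leI mult_left_mono C)
      have "(\<Sum>j=1..N+1. (?a j)\<^sup>2) + (\<Sum>j=1..N. (?d j)\<^sup>2) \<le> (\<Sum>j=1..N+1. ?a j)\<^sup>2 + (\<Sum>j=1..N. ?d j)\<^sup>2"
        using a0 by (intro add_mono sum_squares_le_square_sum) auto
      also have "\<dots> \<le> (?p \<phi>)\<^sup>2"
      proof -
        have "x\<^sup>2 + y\<^sup>2 \<le> (x + y)\<^sup>2" if "0 \<le> x" "0 \<le> y" for x y :: real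
          using that by (simp add: power2_sum)
        from this[of "\<Sum>j=1..N+1. ?a j" "\<Sum>j=1..N. ?d j"] show ?thesis
          unfolding Hhalf_D_seminorm_def using a0 by (simp only: sum_nonneg abs_ge_zero)
      qed
      finally show "(\<Sum>j=1..N+1. (?a j)\<^sup>2) + (\<Sum>j=1..N. (?d j)\<^sup>2) \<le> (?p \<phi>)\<^sup>2" .
    qed
    finally show ?thesis .
  qed
  have p0: "?p \<phi> \<ge> 0" for \<phi>
    unfolding Hhalf_D_seminorm_def Hhalf_seminorm_def by (intro add_nonneg_nonneg sum_nonneg) simp_all
  have bound: "lift \<kappa> (T f) \<in> H1dot \<Omega> \<and> H1dot_seminorm \<Omega> (lift \<kappa> (T f)) \<le> K * ?p \<phi> \<and> gagliardo w UNIV (T f) < \<infinity>"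
    if f: "loc_int f" and ae: "AE x in lborel. x \<in> ?\<Gamma> \<longrightarrow> f x = \<phi> x"
      and fin: "\<And>j. j \<in> {1..N+1} \<Longrightarrow> Hhalf_sq (?S j) \<phi> < \<infinity>" for f \<phi>
  proof -
    let ?q = "(1 + 2 * \<kappa>\<^sup>2) / \<kappa>"
    have q: "?q \<ge> 0" using \<kappa> by simp
    note en = energy[OF f ae fin]
    then have g: "gagliardo w UNIV (T f) < \<infinity>"
    unfolding infinity_ennreal_def by (rule le_less_trans[OF _ ennreal_less_top])
    note L = lift_in_H1dot[OF Tl[OF f] g w(1) h(1) domain(1) h(2), folded \<kappa>_def]
    have "ennreal ((H1dot_seminorm \<Omega> (lift \<kappa> (T f)))\<^sup>2) \<le> ennreal ?q * ennreal (C * (?p \<phi>)\<^sup>2)"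
      by (rule order_trans[OF L(2)]) (rule mult_left_mono[OF en zero_le])
    also have "\<dots> = ennreal (?q * (C * (?p \<phi>)\<^sup>2))" using q C by (intro ennreal_mult[symmetric]) auto
    finally have "(H1dot_seminorm \<Omega> (lift \<kappa> (T f)))\<^sup>2 \<le> ?q * (C * (?p \<phi>)\<^sup>2)"
      using ennreal_le_iff[OF mult_nonneg_nonneg[OF q mult_nonneg_nonneg[OF C zero_le_power2]]] by (simp only:)
    also have "\<dots> = (K * ?p \<phi>)\<^sup>2"
    proof -
      have "K\<^sup>2 = ?q * C" unfolding K_def using mult_nonneg_nonneg[OF q C] by (rule real_sqrt_pow2)
      then show ?thesis by (simp only: power_mult_distrib mult.assoc)
    qed
    finally have "H1dot_seminorm \<Omega> (lift \<kappa> (T f)) \<le> K * ?p \<phi>"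
      by (rule power2_le_imp_le) (use K p0 in simp)
    then show ?thesis using L(1) g by (intro conjI)
  qed
  have B: "loc_int (B \<psi>)" "AE x in lborel. x \<in> ?\<Gamma> \<longrightarrow> B \<psi> x = \<psi> x" if "\<psi> \<in> ?V" for \<psi>
    using that borel_representative[of \<psi> ?\<Gamma>] by (auto simp: B_def Hhalf_D_def)
  have finV: "Hhalf_sq (?S j) \<psi> < \<infinity>" if "\<psi> \<in> ?V" "j \<in> {1..N+1}" for \<psi> j
    using that by (auto simp: Hhalf_D_def Hhalf_def)
  have diff: "H1dot_seminorm \<Omega> (\<lambda>p. E g p - E f p) \<le> K * ?p (\<lambda>x. g x - f x)" if fg: "f \<in> ?V" "g \<in> ?V" for f g
  proof -
    have l: "loc_int (\<lambda>x. B g x - B f x)" by (rule loc_int_diff[OF B(1)[OF fg(2)] B(1)[OF fg(1)]])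
    have ae: "AE x in lborel. x \<in> ?\<Gamma> \<longrightarrow> B g x - B f x = g x - f x"
      using B(2)[OF fg(1)] B(2)[OF fg(2)] by eventually_elim auto
    have fin: "Hhalf_sq (?S j) (\<lambda>x. g x - f x) < \<infinity>" if j: "j \<in> {1..N+1}" for j
    proof -
      have aej: "AE x in lborel. x \<in> ?S j \<longrightarrow> B \<psi> x = \<psi> x" if "\<psi> \<in> ?V" for \<psi>
        using B(2)[OF that] by eventually_elim (use S\<Gamma>[OF j] in auto)
      have "AE x in lborel. x \<in> ?S j \<longrightarrow> g x - f x = B g x - B f x"
        using aej[OF fg(1)] aej[OF fg(2)] by eventually_elim auto
      then have "Hhalf_sq (?S j) (\<lambda>x. g x - f x) = Hhalf_sq (?S j) (\<lambda>x. B g x - B f x)"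
        by (rule Hhalf_sq_cong_AE)
      also have "\<dots> \<le> 2 * Hhalf_sq (?S j) (B g) + 2 * Hhalf_sq (?S j) (B f)"
        by (intro Hhalf_sq_diff_le loc_int_measurable B(1) fg Sb)
      also have "\<dots> = 2 * Hhalf_sq (?S j) g + 2 * Hhalf_sq (?S j) f"
        using Hhalf_sq_cong_AE[OF aej[OF fg(1)]] Hhalf_sq_cong_AE[OF aej[OF fg(2)]] by simp
      also have "\<dots> < \<infinity>"
        using finV[OF fg(1) j] finV[OF fg(2) j] by (simp add: ennreal_mult_less_top)
      finally show ?thesis .
    qed
    have "T (\<lambda>x. B g x - B f x) = (\<lambda>x. T (B g) x - T (B f) x)"
      using T B(1)[OF fg(1)] B(1)[OF fg(2)] by (simp add: bounded_extension_def)
    then have "lift \<kappa> (T (\<lambda>x. B g x - B f x)) = (\<lambda>p. E g p - E f p)"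
      using lift_diff[OF Tl[OF B(1)[OF fg(2)]] Tl[OF B(1)[OF fg(1)]], of \<kappa>] by (simp add: E_def)
    then show ?thesis using bound[OF l ae fin] by simp
  qed
  have "seminorm_continuous ?V ?p (H1dot \<Omega>) (H1dot_seminorm \<Omega>) E"
    unfolding seminorm_continuous_def
  proof (intro conjI ballI allI impI)
    show "E \<in> ?V \<rightarrow> H1dot \<Omega>"
      using bound[OF B finV] by (auto simp: E_def)
    fix f and \<epsilon> :: real assume f: "f \<in> ?V" and \<epsilon>: "\<epsilon> > 0"
    \<comment> \<open>The \<open>+ 1\<close> covers a vanishing Lipschitz constant.\<close>
    show "\<exists>\<delta>>0. \<forall>g\<in>?V. ?p (\<lambda>x. g x - f x) < \<delta> \<longrightarrow> H1dot_seminorm \<Omega> (\<lambda>y. E g y - E f y) < \<epsilon>"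
    proof (intro exI[of _ "\<epsilon> / (K + 1)"] conjI ballI impI)
      show "\<epsilon> / (K + 1) > 0" using \<epsilon> K by simp
      fix g assume g: "g \<in> ?V" and lt: "?p (\<lambda>x. g x - f x) < \<epsilon> / (K + 1)"
      have "H1dot_seminorm \<Omega> (\<lambda>y. E g y - E f y) \<le> K * ?p (\<lambda>x. g x - f x)" by (rule diff[OF f g])
      also have "\<dots> \<le> (K + 1) * ?p (\<lambda>x. g x - f x)" using p0 by (intro mult_right_mono) auto
      also have "\<dots> < (K + 1) * (\<epsilon> / (K + 1))" using lt K by (intro mult_strict_left_mono) auto
      also have "\<dots> = \<epsilon>" using K by simp
      finally show "H1dot_seminorm \<Omega> (\<lambda>y. E g y - E f y) < \<epsilon>" .
    qed
  qed
  moreover have "has_trace \<Omega> ?\<Gamma> (E \<psi>) \<psi>" if \<psi>: "\<psi> \<in> ?V" for \<psi>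
    unfolding E_def \<kappa>_def
  proof (rule has_trace_lift[OF Tl[OF B(1)[OF \<psi>]] _ w(1) h(1) rectangle_below_surface])
    have "increment_energy w (T (B \<psi>)) \<le> gagliardo w UNIV (T (B \<psi>))"
      by (intro increment_energy_le_gagliardo loc_int_measurable Tl B(1) \<psi>)
    also have "\<dots> < \<infinity>" using bound[OF B[OF \<psi>] finV[OF \<psi>]] by simp
    finally show "increment_energy w (T (B \<psi>)) < \<infinity>" .
    show "AE x in lborel. x \<in> ?\<Gamma> \<longrightarrow> T (B \<psi>) x = \<psi> x"
      using B(2)[OF \<psi>] by eventually_elim (use T\<Gamma>[OF B(1)[OF \<psi>]] in auto)
  qed
  ultimately show ?thesis by blast
qed

end
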